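(* Let $r,k\in\mathbb Z$ with $0\le k\le r$ and suppose Assumptions (A1), (A2), (A3) hold. Let $u$ be the (sufficiently smooth) solution of the initial value problem and $U$ the solution of the method (M). Suppose that, for $\tau$ sufficiently small, the global error $\sup_{t\in I}\|(u-U)(t)\|$, as well as $U$ and all its derivatives on each mesh interval, are bounded independently of the mesh. Then $$\|(u-U)(t_N^-)\|\le C(f,u)\Big(\sup_{t\in I}\|(u-U)(t)\|^2+\tau^{\min\{2r-k+1,\ r^{\mathscr I,\mathcal I}_{\rm var}+1,\ \max\{r^{\mathscr I}_{\rm ex}+1,\min\{r,r^{\mathscr I}_{\mathcal I}+1\}\}\}}\Big),$$ where $r^{\mathscr I,\mathcal I}_{\rm var}:=\min_{0\le i\le r-k}\{r^{\mathscr I}_{\mathcal I,i}+i\}$ and $C(f,u)$ is independent of the mesh.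
   Context: Problem: $u'(t)=f(t,u(t))$, $u(t_0)=u_0\in\mathbb R^d$, on $I=(t_0,t_0+T]$, $f$ smooth. Mesh $t_0<\dots<t_N=t_0+T$, $I_n=(t_{n-1},t_n]$, $\tau_n=t_n-t_{n-1}\le1$, $\tau=\max_n\tau_n$; one-sided limits $v(t_n^\pm)$, $[v]_n=v(t_n^+)-v(t_n^-)$. $T_n(\hat t)=\frac{t_n+t_{n-1}}{2}+\frac{\tau_n}{2}\hat t$. $\|\cdot\|$, $(\cdot,\cdot)$ Euclidean norm/inner product; $P_s$ polynomials of degree $\le s$, $P_{-1}:=\{0\}$; $\delta_{i,j}$ Kronecker symbol. Operators: $\widehat{\mathscr I}$ linear functional, $\widehat{\mathcal I}$ linear operator; $k_{\mathscr I},k_{\mathcal I}\ge0$ smallest integers with well-definedness on $C^{k_{\mathscr I}}([-1,1])$ resp. $C^{k_{\mathcal I}}([-1,1])$; $\widehat{\mathcal I}\hat v\in C^l$ whenever $\hat v\in C^{\max\{k_{\mathcal I},l\}}$. Local: $\mathscr I_n[\varphi]=\frac{\tau_n}{2}\widehat{\mathscr I}[\varphi\circ T_n]$, $\mathcal I_n\psi=(\widehat{\mathcal I}(\psi\circ T_n))\circ T_n^{-1}$, componentwise. $k_{\mathcal J}:=\max\{\lfloor k/2\rfloor-1,k_{\mathscr I},k_{\mathcal I}\}$. Method (M): given $U(t_{n-1}^-)$ ($U(t_0^-)=u_0$), find $U\in P_r(I_n,\mathbb R^d)$ with: if $k\ge1$, $U(t_{n-1}^+)=U(t_{n-1}^-)$;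 if $k\ge2$, $U^{(i+1)}(t_n^-)=\frac{d^i}{dt^i}f(t,U(t))|_{t_n^-}$, $i=0,\dots,\lfloor k/2\rfloor-1$; if $k\ge3$, $U^{(i+1)}(t_{n-1}^+)=\frac{d^i}{dt^i}f(t,U(t))|_{t_{n-1}^+}$, $i=0,\dots,\lfloor (k-1)/2\rfloor-1$; and $\mathscr I_n[(U',\varphi)]+\delta_{0,k}([U]_{n-1},\varphi(t_{n-1}^+))=\mathscr I_n[(\mathcal I_nf(\cdot,U(\cdot)),\varphi)]$ for all $\varphi\in P_{r-k}(I_n,\mathbb R^d)$. Approximation orders (values in $\mathbb N_0\cup\{-1,\infty\}$): $r^{\mathscr I}_{\rm ex}$ largest with $\int_{I_n}\varphi\,dt=\mathscr I_n[\varphi]$ for all $\varphi\in P_{r^{\mathscr I}_{\rm ex}}(I_n)$; $r^{\mathscr I}_{\mathcal I,i}$ largest with $\mathscr I_n[\varphi\psi]=\mathscr I_n[(\mathcal I_n\varphi)\psi]$ for all $\varphi\in P_{r^{\mathscr I}_{\mathcal I,i}}(I_n)$, $\psi\in P_i(I_n)$; $r^{\mathscr I}_{\mathcal I}:=r^{\mathscr I}_{\mathcal I,r-k}$. (A1): if $\hat\psi\in P_{r-\max\{1,k\}}([-1,1])$ and $\widehat{\mathscr I}[(1-\hat t)^{\lfloor k/2\rfloor}(1+\hat t)^{|\lfloor (k-1)/2\rfloor|}\hat\psi\hat\varphi]=0$ for all $\hat\varphi\in P_{r-\max\{1,k\}}([-1,1])$, then $\hat\psi\equiv0$. (A2): $\|\widehat{\mathscr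 I}[\hat\varphi]\|\le\mathfrak C_0\sum_{j=0}^{k_{\mathscr I}}\sup_{[-1,1]}\|\hat\varphi^{(j)}\|$ for all $\hat\varphi\in C^{k_{\mathscr I}}([-1,1],\mathbb R^d)$. (A3): for $0\le l\le k_{\mathscr I}$, $\sup_{[-1,1]}\|(\widehat{\mathcal I}\hat\varphi)^{(l)}\|\le\mathfrak C_1\sum_{j=0}^{\max\{k_{\mathcal I},l\}}\sup_{[-1,1]}\|\hat\varphi^{(j)}\|$ for all $\hat\varphi\in C^{\max\{k_{\mathcal I},l\}}([-1,1],\mathbb R^d)$. *)

theory Defs
  imports "HOL-Analysis.Analysis" "HOL-Computational_Algebra.Polynomial" "HOL-Library.Extended_Nat"
begin

text \<open>C^m on the whole space (finite dimensional), via directional derivatives.\<close>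
fun Cn :: "nat \<Rightarrow> ('x::real_normed_vector \<Rightarrow> 'y::real_normed_vector) \<Rightarrow> bool" where
  "Cn 0 g = continuous_on UNIV g"
| "Cn (Suc m) g = ((\<forall>x. g differentiable (at x)) \<and>
      (\<forall>v. Cn m (\<lambda>x. frechet_derivative g (at x) v)))"

definition smooth_fun :: "('x::real_normed_vector \<Rightarrow> 'y::real_normed_vector) \<Rightarrow> bool" where
  "smooth_fun g \<longleftrightarrow> (\<forall>m. Cn m g)"

fun vder :: "real set \<Rightarrow> nat \<Rightarrow> (real \<Rightarrow> 'y::real_normed_vector) \<Rightarrow> real \<Rightarrow> 'y" where
  "vder S 0 g = g"
| "vder S (Suc m) g = (\<lambda>t. vector_derivative (vder S m g) (at t within S))"

fun Ck_on :: "nat \<Rightarrow> real set \<Rightarrow> (real \<Rightarrow> 'y::real_normed_vector) \<Rightarrow> bool" where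
  "Ck_on 0 S g = continuous_on S g"
| "Ck_on (Suc m) S g = ((\<forall>t\<in>S. (g has_vector_derivative vector_derivative g (at t within S)) (at t within S))
      \<and> Ck_on m S (\<lambda>t. vector_derivative g (at t within S)))"

definition polys_deg :: "int \<Rightarrow> real poly set" where
  "polys_deg s = {p. if s < 0 then p = 0 else int (degree p) \<le> s}"

definition vpoly_deg :: "nat \<Rightarrow> (real \<Rightarrow> 'a::real_vector) \<Rightarrow> bool" where
  "vpoly_deg s g \<longleftrightarrow> (\<exists>c. \<forall>t. g t = (\<Sum>j\<le>s. t ^ j *\<^sub>R c j))"

definition cwF :: "((real \<Rightarrow> real) \<Rightarrow> real) \<Rightarrow> (real \<Rightarrow> 'a::euclidean_space) \<Rightarrow> 'a" where
  "cwF J \<phi> = (\<Sum>b\<in>Basis. J (\<lambda>x. \<phi> x \<bullet> b) *\<^sub>R b)"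

definition cwO :: "((real \<Rightarrow> real) \<Rightarrow> (real \<Rightarrow> real)) \<Rightarrow> (real \<Rightarrow> 'a::euclidean_space) \<Rightarrow> real \<Rightarrow> 'a" where
  "cwO Op \<phi> = (\<lambda>s. \<Sum>b\<in>Basis. Op (\<lambda>x. \<phi> x \<bullet> b) s *\<^sub>R b)"

definition Tn :: "(nat \<Rightarrow> real) \<Rightarrow> nat \<Rightarrow> real \<Rightarrow> real" where
  "Tn tm n s = (tm n + tm (n-1)) / 2 + (tm n - tm (n-1)) / 2 * s"

definition Tn_inv :: "(nat \<Rightarrow> real) \<Rightarrow> nat \<Rightarrow> real \<Rightarrow> real" where
  "Tn_inv tm n t = (2 * t - (tm n + tm (n-1))) / (tm n - tm (n-1))"

definition locF :: "((real \<Rightarrow> real) \<Rightarrow> real) \<Rightarrow> (nat \<Rightarrow> real) \<Rightarrow> nat \<Rightarrow> (real \<Rightarrow> real) \<Rightarrow> real" where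
  "locF J tm n g = (tm n - tm (n-1)) / 2 * J (g \<circ> Tn tm n)"

definition locO :: "((real \<Rightarrow> real) \<Rightarrow> (real \<Rightarrow> real)) \<Rightarrow> (nat \<Rightarrow> real) \<Rightarrow> nat
    \<Rightarrow> (real \<Rightarrow> 'a::euclidean_space) \<Rightarrow> real \<Rightarrow> 'a" where
  "locO Op tm n \<psi> = cwO Op (\<psi> \<circ> Tn tm n) \<circ> Tn_inv tm n"

definition is_mesh :: "real \<Rightarrow> real \<Rightarrow> nat \<Rightarrow> (nat \<Rightarrow> real) \<Rightarrow> bool" where
  "is_mesh t0 T N tm \<longleftrightarrow> N \<ge> 1 \<and> tm 0 = t0 \<and> tm N = t0 + T \<and>
     (\<forall>n\<in>{1..N}. tm (n-1) < tm n \<and> tm n - tm (n-1) \<le> 1)"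

definition mesh_size :: "nat \<Rightarrow> (nat \<Rightarrow> real) \<Rightarrow> real" where
  "mesh_size N tm = Max ((\<lambda>n. tm n - tm (n-1)) ` {1..N})"

text \<open>Up n is the polynomial representing U on I_n (extended to all of R);
  U(t_n^-) = Up n (t_n), U(t_{n-1}^+) = Up n (t_{n-1}), U(t_0^-) = u0.\<close>
definition Uminus :: "'a \<Rightarrow> (nat \<Rightarrow> real) \<Rightarrow> (nat \<Rightarrow> real \<Rightarrow> 'a) \<Rightarrow> nat \<Rightarrow> 'a" where
  "Uminus u0 tm Up m = (if m = 0 then u0 else Up m (tm m))"

definition solves_M ::
  "((real \<Rightarrow> real) \<Rightarrow> real) \<Rightarrow> ((real \<Rightarrow> real) \<Rightarrow> (real \<Rightarrow> real)) \<Rightarrow>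
   (real \<Rightarrow> 'a::euclidean_space \<Rightarrow> 'a) \<Rightarrow> 'a \<Rightarrow> nat \<Rightarrow> nat \<Rightarrow>
   nat \<Rightarrow> (nat \<Rightarrow> real) \<Rightarrow> (nat \<Rightarrow> real \<Rightarrow> 'a) \<Rightarrow> bool" where
  "solves_M J Op f u0 r k N tm Up \<longleftrightarrow>
    (\<forall>n\<in>{1..N}.
       vpoly_deg r (Up n) \<and>
       (k \<ge> 1 \<longrightarrow> Up n (tm (n-1)) = Uminus u0 tm Up (n-1)) \<and>
       (k \<ge> 2 \<longrightarrow> (\<forall>i < k div 2.
           vder UNIV (Suc i) (Up n) (tm n) = vder UNIV i (\<lambda>t. f t (Up n t)) (tm n))) \<and>
       (k \<ge> 3 \<longrightarrow> (\<forall>i < (k - 1) div 2.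
           vder UNIV (Suc i) (Up n) (tm (n-1)) = vder UNIV i (\<lambda>t. f t (Up n t)) (tm (n-1)))) \<and>
       (\<forall>\<phi>. vpoly_deg (r - k) \<phi> \<longrightarrow>
           locF J tm n (\<lambda>t. vder UNIV 1 (Up n) t \<bullet> \<phi> t)
           + (if k = 0 then (Up n (tm (n-1)) - Uminus u0 tm Up (n-1)) \<bullet> \<phi> (tm (n-1)) else 0)
           = locF J tm n (\<lambda>t. locO Op tm n (\<lambda>s. f s (Up n s)) t \<bullet> \<phi> t)))"

text \<open>For a downward closed property P on {-1,0,1,...}, ord1 P = (largest s with P s) + 1,
  with value \<infinity> if P holds for all s.\<close>
definition ord1 :: "(int \<Rightarrow> bool) \<Rightarrow> enat" where
  "ord1 P = Sup {enat m | m. P (int m - 1)}"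

text \<open>All orders are computed on the reference interval I_n = (-1,1] (tau_n = 2, T_n = id);
  by the affine change of variables they do not depend on n.\<close>
definition r_ex1 :: "((real \<Rightarrow> real) \<Rightarrow> real) \<Rightarrow> enat" where
  "r_ex1 J = ord1 (\<lambda>s. \<forall>p\<in>polys_deg s. integral {-1..1} (poly p) = J (poly p))"

definition r_Ii1 :: "((real \<Rightarrow> real) \<Rightarrow> real) \<Rightarrow> ((real \<Rightarrow> real) \<Rightarrow> (real \<Rightarrow> real)) \<Rightarrow> nat \<Rightarrow> enat" where
  "r_Ii1 J Op i = ord1 (\<lambda>s. \<forall>p\<in>polys_deg s. \<forall>q\<in>polys_deg (int i).
      J (\<lambda>x. poly p x * poly q x) = J (\<lambda>x. Op (poly p) x * poly q x))"

definition r_var1 :: "((real \<Rightarrow> real) \<Rightarrow> real) \<Rightarrow> ((real \<Rightarrow> real) \<Rightarrow> (real \<Rightarrow> real)) \<Rightarrow> nat \<Rightarrow> nat \<Rightarrow> enat" where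
  "r_var1 J Op r k = Min ((\<lambda>i. r_Ii1 J Op i + enat i) ` {0..r-k})"

definition conv_order :: "((real \<Rightarrow> real) \<Rightarrow> real) \<Rightarrow> ((real \<Rightarrow> real) \<Rightarrow> (real \<Rightarrow> real)) \<Rightarrow> nat \<Rightarrow> nat \<Rightarrow> nat" where
  "conv_order J Op r k = the_enat (min (enat (2*r - k + 1))
      (min (r_var1 J Op r k) (max (r_ex1 J) (min (enat r) (r_Ii1 J Op (r - k))))))"

definition sup_der :: "nat \<Rightarrow> (real \<Rightarrow> 'y::real_normed_vector) \<Rightarrow> real" where
  "sup_der m \<phi> = (\<Sum>j\<le>m. (SUP x\<in>{-1..1::real}. norm (vder {-1..1} j \<phi> x)))"

definition std_assms :: "((real \<Rightarrow> real) \<Rightarrow> real) \<Rightarrow> ((real \<Rightarrow> real) \<Rightarrow> (real \<Rightarrow> real)) \<Rightarrow> nat \<Rightarrow> nat \<Rightarrow> bool" where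
  "std_assms J Op kF kO \<longleftrightarrow>
    (\<forall>g h a b. Ck_on kF {-1..1} g \<longrightarrow> Ck_on kF {-1..1} h \<longrightarrow>
        J (\<lambda>x. a * g x + b * h x) = a * J g + b * J h) \<and>
    (\<forall>g h a b. Ck_on kO {-1..1} g \<longrightarrow> Ck_on kO {-1..1} h \<longrightarrow>
        (\<forall>x\<in>{-1..1}. Op (\<lambda>x. a * g x + b * h x) x = a * Op g x + b * Op h x)) \<and>
    (\<forall>l v. Ck_on (max kO l) {-1..1} v \<longrightarrow> Ck_on l {-1..1} (Op v))"

definition A1 :: "((real \<Rightarrow> real) \<Rightarrow> real) \<Rightarrow> nat \<Rightarrow> nat \<Rightarrow> bool" where
  "A1 J r k \<longleftrightarrow> (\<forall>\<psi>\<in>polys_deg (int r - int (max 1 k)).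
     (\<forall>\<phi>\<in>polys_deg (int r - int (max 1 k)).
        J (\<lambda>x. (1 - x) ^ (k div 2) * (1 + x) ^ nat \<bar>(int k - 1) div 2\<bar> * poly \<psi> x * poly \<phi> x) = 0)
     \<longrightarrow> \<psi> = 0)"

definition A2 :: "((real \<Rightarrow> real) \<Rightarrow> real) \<Rightarrow> nat \<Rightarrow> real \<Rightarrow> 'a::euclidean_space itself \<Rightarrow> bool" where
  "A2 J kF C0 _ \<longleftrightarrow> (\<forall>\<phi> :: real \<Rightarrow> 'a. Ck_on kF {-1..1} \<phi> \<longrightarrow>
      norm (cwF J \<phi>) \<le> C0 * sup_der kF \<phi>)"

definition A3 :: "((real \<Rightarrow> real) \<Rightarrow> (real \<Rightarrow> real)) \<Rightarrow> nat \<Rightarrow> nat \<Rightarrow> real \<Rightarrow> 'a::euclidean_space itself \<Rightarrow> bool" where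
  "A3 Op kF kO C1 _ \<longleftrightarrow> (\<forall>l \<le> kF. \<forall>\<phi> :: real \<Rightarrow> 'a. Ck_on (max kO l) {-1..1} \<phi> \<longrightarrow>
      (SUP x\<in>{-1..1}. norm (vder {-1..1} l (cwO Op \<phi>) x)) \<le> C1 * sup_der (max kO l) \<phi>)"

end

(*
  Proof idea. Let z solve the linearized adjoint equation backwards from a unit vector at the final
  time. Pairing the error e = u - U with z and integrating over the mesh intervals leaves two terms:
  the linearization error, which is quadratic in e, and the residual R = U' - f(t, U) (with the jump
  if k = 0) tested with z. The latter is estimated on each interval separately, transported to the
  reference element. The collocation and variational conditions, the unisolvence (A1) and Taylor
  expansion show R = O(tau^min(r, r_I + 1)). Split z = phi + eta with phi the Taylor polynomial of
  degree r - k at the left end point, so that eta = O(tau^(r-k+1)). The part tested with phi reduces,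
  by the variational condition, to the defect of the operator I applied to monomials, of order
  r_var + 1; the part tested with eta gives min(2r - k + 1, r_var + 1); and replacing the integral
  by the functional costs max(r_ex + 1, min(r, r_I + 1)).
*)
theory Submission
  imports Defs
begin

text \<open>The functional \<open>J\<close> and the operator \<open>Op\<close> may evaluate
  derivatives, so a residual that is small in the sup norm is not enough: its derivatives up to
  order \<open>kF\<close> have to be small as well. This is why all estimates are bounds in C^K,
  with Taylor remainders whose derivatives are all O(h^s). Powers of the step size have one source,
  the affine map, which turns a bound M for all derivatives into M h^j. The exponents arise by
  matching such powers. The Taylor coefficient of z of order j is O(h^j) and meets a defect
  O(h^(p-j)) for test degree j, hence the minimum over r_{I,i} + i; and 2r-k+1 is the order r of the
  residual plus the order r-k+1 of eta. Expanding z at the left end point makes phi and z agree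
  where the jump is tested, so that the variational condition absorbs the jump exactly. Each local
  bound carries a further factor h, so the sum over the mesh is a multiple of T; stability is
  contained in the bounds of the adjoint solution.\<close>

section \<open>Scaled derivative bounds\<close>

text \<open>\<open>sdb S K M h g\<close>: the derivatives of \<open>g\<close> on \<open>S\<close> up to order \<open>K\<close> exist and satisfy
  \<open>\<parallel>g\<^sup>(\<^sup>j\<^sup>)\<parallel> \<le> M h\<^sup>j\<close>, as for a function of bounded derivatives transported from a mesh interval of length
  \<open>2 h\<close> to the reference element. The recursive form makes products, compositions and Taylor
  remainders plain inductions.\<close>

fun sdb :: "real set \<Rightarrow> nat \<Rightarrow> real \<Rightarrow> real \<Rightarrow> (real \<Rightarrow> 'b::real_normed_vector) \<Rightarrow> bool" where
  "sdb S 0 M h g \<longleftrightarrow> continuous_on S g \<and> (\<forall>t\<in>S. norm (g t) \<le> M)"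
| "sdb S (Suc K) M h g \<longleftrightarrow> (\<forall>t\<in>S. norm (g t) \<le> M) \<and>
     (\<exists>g'. (\<forall>t\<in>S. (g has_vector_derivative g' t) (at t within S)) \<and> sdb S K (M * h) h g')"

lemma sdb_SucI:
  assumes "\<And>t. t \<in> S \<Longrightarrow> norm (g t) \<le> M"
    and "\<And>t. t \<in> S \<Longrightarrow> (g has_vector_derivative g' t) (at t within S)"
    and "sdb S K (M * h) h g'"
  shows "sdb S (Suc K) M h g"
  using assms by auto

lemma sdb_SucE:
  assumes "sdb S (Suc K) M h g"
  obtains g' where "\<And>t. t \<in> S \<Longrightarrow> (g has_vector_derivative g' t) (at t within S)"
    and "sdb S K (M * h) h g'"
  using assms by auto

lemma sdb_norm: "sdb S K M h g \<Longrightarrow> t \<in> S \<Longrightarrow> norm (g t) \<le> M"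
  by (cases K) auto

lemma sdb_continuous: "sdb S K M h g \<Longrightarrow> continuous_on S g"
  by (cases K) (auto simp: continuous_on_eq_continuous_within intro: has_vector_derivative_continuous)

lemma sdb_mono:
  assumes "sdb S K M h g" "M \<le> M'" "0 \<le> M'" "0 \<le> h" "h \<le> h'"
  shows "sdb S K M' h' g"
  using assms
proof (induction K arbitrary: M M' g)
  case 0
  then show ?case by force
next
  case (Suc K)
  then obtain g' where g': "\<forall>t\<in>S. (g has_vector_derivative g' t) (at t within S)"
    "sdb S K (M * h) h g'" by auto
  have "M * h \<le> M' * h'"
    using Suc.prems by (meson mult_left_mono mult_right_mono order_trans)
  then have "sdb S K (M' * h') h' g'"
    using Suc.IH[OF g'(2)] Suc.prems by auto
  then show ?case using g'(1) Suc.prems by force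
qed

lemma sdb_le_order:
  assumes "sdb S K M h g" "K' \<le> K"
  shows "sdb S K' M h g"
  using assms
proof (induction K' arbitrary: K M g)
  case 0
  then show ?case using sdb_continuous sdb_norm by fastforce
next
  case (Suc K')
  then obtain K0 where "K = Suc K0" "K' \<le> K0" by (cases K) auto
  then show ?case using Suc by auto
qed

lemma sdb_subset:
  assumes "sdb S K M h g" "S' \<subseteq> S"
  shows "sdb S' K M h g"
  using assms
proof (induction K arbitrary: M g)
  case 0
  then show ?case using continuous_on_subset by auto
next
  case (Suc K)
  from Suc.prems(1) show ?case
  proof (rule sdb_SucE)
    fix d assume d: "\<And>t. t \<in> S \<Longrightarrow> (g has_vector_derivative d t) (at t within S)" "sdb S K (M * h) h d"
    show "sdb S' (Suc K) M h g"
    proof (rule sdb_SucI[OF _ _ Suc.IH[OF d(2) Suc.prems(2)]])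
      fix t assume "t \<in> S'"
      then show "norm (g t) \<le> M" using sdb_norm[OF Suc.prems(1)] Suc.prems(2) by blast
      show "(g has_vector_derivative d t) (at t within S')"
        using d(1) \<open>t \<in> S'\<close> Suc.prems(2) by (blast intro: has_vector_derivative_within_subset)
    qed
  qed
qed

lemma sdb_cong:
  assumes "sdb S K M h g" "\<And>t. t \<in> S \<Longrightarrow> g t = g' t"
  shows "sdb S K M h g'"
proof (cases K)
  case 0
  then show ?thesis using assms by (auto cong: continuous_on_cong)
next
  case (Suc K0)
  from assms(1)[unfolded Suc] show ?thesis unfolding Suc
  proof (rule sdb_SucE)
    fix d assume d: "\<And>t. t \<in> S \<Longrightarrow> (g has_vector_derivative d t) (at t within S)" "sdb S K0 (M * h) h d"
    show "sdb S (Suc K0) M h g'"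
      by (rule sdb_SucI[OF _ _ d(2)])
        (use assms sdb_norm[OF assms(1)] in \<open>auto intro: has_vector_derivative_transform[OF _ _ d(1)]\<close>)
  qed
qed

lemma sdb_const:
  "norm c \<le> M \<Longrightarrow> 0 \<le> h \<Longrightarrow> sdb S K M h (\<lambda>_. c)"
proof (induction K arbitrary: M c)
  case (Suc K)
  have "0 \<le> M" using Suc.prems norm_ge_zero order_trans by blast
  then have "sdb S K (M * h) h (\<lambda>_. 0::'a)" using Suc by simp
  then show ?case using Suc.prems has_vector_derivative_const by (intro sdb_SucI[of _ _ _ "\<lambda>_. 0"]) auto
qed auto

lemma sdb_add:
  assumes "sdb S K M1 h g1" "sdb S K M2 h g2"
  shows "sdb S K (M1 + M2) h (\<lambda>t. g1 t + g2 t)"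
  using assms
proof (induction K arbitrary: M1 M2 g1 g2)
  case 0
  then show ?case by (auto intro!: continuous_intros intro: norm_triangle_mono)
next
  case (Suc K)
  then obtain d1 d2 where
    "\<forall>t\<in>S. (g1 has_vector_derivative d1 t) (at t within S)" "sdb S K (M1 * h) h d1"
    "\<forall>t\<in>S. (g2 has_vector_derivative d2 t) (at t within S)" "sdb S K (M2 * h) h d2"
    by auto
  then have "\<forall>t\<in>S. ((\<lambda>t. g1 t + g2 t) has_vector_derivative d1 t + d2 t) (at t within S)"
    "sdb S K ((M1 + M2) * h) h (\<lambda>t. d1 t + d2 t)"
    using Suc.IH[of "M1*h" d1 "M2*h" d2] by (auto intro: has_vector_derivative_add simp: algebra_simps)
  moreover have "\<forall>t\<in>S. norm (g1 t + g2 t) \<le> M1 + M2"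
    using Suc.prems by (auto intro: norm_triangle_mono)
  ultimately show ?case by auto
qed

lemma sdb_linear:
  assumes L: "bounded_linear L" "\<And>x. norm (L x) \<le> c * norm x" and "0 \<le> c"
    and "sdb S K M h g"
  shows "sdb S K (c * M) h (\<lambda>t. L (g t))"
  using assms(4)
proof (induction K arbitrary: M g)
  case 0
  have "norm (L (g t)) \<le> c * M" if "t \<in> S" for t
    using order_trans[OF L(2) mult_left_mono[OF _ \<open>0 \<le> c\<close>]] 0 that by auto
  then show ?case
    using bounded_linear.continuous_on[OF L(1)] 0 by auto
next
  case (Suc K)
  then obtain g' where "\<forall>t\<in>S. (g has_vector_derivative g' t) (at t within S)"
    "sdb S K (M * h) h g'" by auto
  then have "((\<lambda>t. L (g t)) has_vector_derivative L (g' t)) (at t within S)" if "t \<in> S" for t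
    using bounded_linear.has_vector_derivative[OF L(1)] that by blast
  moreover have "sdb S K (c * M * h) h (\<lambda>t. L (g' t))"
    using Suc.IH[OF \<open>sdb S K (M * h) h g'\<close>] by (simp add: mult.assoc)
  moreover have "norm (L (g t)) \<le> c * M" if "t \<in> S" for t
    using order_trans[OF L(2) mult_left_mono[OF _ \<open>0 \<le> c\<close>]] Suc.prems that by auto
  ultimately show ?case by (intro sdb_SucI[of _ _ _ "\<lambda>t. L (g' t)"]) auto
qed

lemma sdb_scaleR:
  "sdb S K M h g \<Longrightarrow> sdb S K (\<bar>c\<bar> * M) h (\<lambda>t. c *\<^sub>R g t)"
  by (rule sdb_linear) (auto intro: bounded_linear_scaleR_right)

lemma sdb_cmult:
  fixes c :: real
  shows "sdb S K M h g \<Longrightarrow> sdb S K (\<bar>c\<bar> * M) h (\<lambda>t. c * g t)"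
  using sdb_scaleR[of S K M h g c] by simp

lemma sdb_diff:
  assumes "sdb S K M1 h g1" "sdb S K M2 h g2"
  shows "sdb S K (M1 + M2) h (\<lambda>t. g1 t - g2 t)"
  using sdb_add[OF assms(1) sdb_scaleR[OF assms(2), of "-1"]] by simp

lemma sdb_sum:
  assumes "finite A" "\<And>i. i \<in> A \<Longrightarrow> sdb S K (M i) h (g i)" "0 \<le> h"
  shows "sdb S K (\<Sum>i\<in>A. M i) h (\<lambda>t. \<Sum>i\<in>A. g i t)"
  using assms(1,2)
proof (induction A rule: finite_induct)
  case empty
  then show ?case using sdb_const[of 0 0 h] \<open>0 \<le> h\<close> by auto
next
  case (insert i A)
  then show ?case by (auto intro: sdb_add)
qed

text \<open>The product rule produces two terms with the same bound \<open>M1 * M2 * h\<close>, so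
  the Leibniz sum costs one factor 2 per order and keeps the scaling in \<open>h\<close>.\<close>

lemma sdb_bilinear:
  assumes bl: "bounded_bilinear pr" and n: "\<And>x y. norm (pr x y) \<le> norm x * norm y"
    and "sdb S K M1 h g1" "sdb S K M2 h g2"
  shows "sdb S K (2 ^ K * (M1 * M2)) h (\<lambda>t. pr (g1 t) (g2 t))"
  using assms(3,4)
proof (induction K arbitrary: M1 M2 g1 g2)
  case 0
  have "norm (pr (g1 t) (g2 t)) \<le> M1 * M2" if "t \<in> S" for t
    using order_trans[OF n mult_mono'[of "norm (g1 t)" M1 "norm (g2 t)" M2]] 0 that by auto
  then show ?case using 0 by (auto intro: bounded_bilinear.continuous_on[OF bl])
next
  case (Suc K)
  then obtain d1 d2 where d:
    "\<forall>t\<in>S. (g1 has_vector_derivative d1 t) (at t within S)" "sdb S K (M1 * h) h d1"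
    "\<forall>t\<in>S. (g2 has_vector_derivative d2 t) (at t within S)" "sdb S K (M2 * h) h d2"
    by auto
  have g: "sdb S K M1 h g1" "sdb S K M2 h g2"
    using Suc.prems sdb_le_order le_SucI by blast+
  have e: "2 ^ K * (M1 * (M2 * h)) + 2 ^ K * (M1 * h * M2) = 2 ^ Suc K * (M1 * M2) * h"
    by (simp add: algebra_simps)
  show ?case
  proof (rule sdb_SucI)
    show "sdb S K (2 ^ Suc K * (M1 * M2) * h) h (\<lambda>t. pr (g1 t) (d2 t) + pr (d1 t) (g2 t))"
      using sdb_add[OF Suc.IH[OF g(1) d(4)] Suc.IH[OF d(2) g(2)]] unfolding e .
    show "((\<lambda>t. pr (g1 t) (g2 t)) has_vector_derivative
      pr (g1 t) (d2 t) + pr (d1 t) (g2 t)) (at t within S)" if "t \<in> S" for t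
      using d that by (auto intro: bounded_bilinear.has_vector_derivative[OF bl])
    fix t assume t: "t \<in> S"
    have a: "norm (g1 t) \<le> M1" "norm (g2 t) \<le> M2" using g t sdb_norm by blast+
    then have p: "0 \<le> M1 * M2" by (meson mult_nonneg_nonneg norm_ge_zero order_trans)
    have "norm (pr (g1 t) (g2 t)) \<le> norm (g1 t) * norm (g2 t)" by (rule n)
    also have "\<dots> \<le> M1 * M2" using a by (simp add: mult_mono')
    also have "\<dots> \<le> 2 ^ Suc K * (M1 * M2)"
      using mult_right_mono[OF one_le_power[of 2 "Suc K"] p] by simp
    finally show "norm (pr (g1 t) (g2 t)) \<le> 2 ^ Suc K * (M1 * M2)" .
  qed
qed

lemma sdb_mult:
  fixes g1 g2 :: "real \<Rightarrow> real"
  assumes "sdb S K M1 h g1" "sdb S K M2 h g2"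
  shows "sdb S K (2 ^ K * (M1 * M2)) h (\<lambda>t. g1 t * g2 t)"
  by (rule sdb_bilinear[OF bounded_bilinear_mult _ assms]) (simp add: abs_mult)

lemma sdb_ident:
  assumes "\<And>t. t \<in> S \<Longrightarrow> \<bar>t\<bar> \<le> M" "1 \<le> M"
  shows "sdb S K M 1 (\<lambda>t::real. t)"
proof (cases K)
  case (Suc K0)
  then show ?thesis using assms sdb_const[of "1::real" M 1 S K0]
    by (auto simp del: sdb.simps intro!: sdb_SucI[of _ _ _ "\<lambda>_. 1"])
qed (use assms in auto)

text \<open>The place where powers of the step size enter: each use of the chain rule yields one
  factor \<open>h\<close>, so scale 1 on the mesh interval becomes scale \<open>h\<close> on the
  reference interval.\<close>

lemma sdb_affine:
  assumes "sdb S K M 1 g" "\<And>s. s \<in> S' \<Longrightarrow> m + h * s \<in> S" "0 \<le> h"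
  shows "sdb S' K M h (\<lambda>s. g (m + h * s))"
  using assms(1)
proof (induction K arbitrary: M g)
  case 0
  then show ?case using assms(2)
    by (auto intro!: continuous_on_compose2[of S g] continuous_intros)
next
  case (Suc K)
  then obtain g' where g': "\<forall>t\<in>S. (g has_vector_derivative g' t) (at t within S)"
    "sdb S K M 1 g'" by auto
  have "sdb S' K (M * h) h (\<lambda>s. h *\<^sub>R g' (m + h * s))"
    using sdb_scaleR[OF Suc.IH[OF g'(2)], of h] \<open>0 \<le> h\<close> by (simp add: mult.commute)
  moreover have "((\<lambda>s. g (m + h * s)) has_vector_derivative h *\<^sub>R g' (m + h * s)) (at s within S')"
    if "s \<in> S'" for s
  proof -
    have "((\<lambda>s. m + h * s) has_vector_derivative h) (at s within S')"
      by (auto intro!: derivative_eq_intros simp flip: has_real_derivative_iff_has_vector_derivative)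
    moreover have "(g has_vector_derivative g' (m + h * s)) (at (m + h * s) within (\<lambda>s. m + h * s) ` S')"
      using g'(1) assms(2) that by (auto intro: has_vector_derivative_within_subset[where S=S])
    ultimately show ?thesis
      using vector_diff_chain_within[of "\<lambda>s. m + h * s" h s S' g "g' (m + h * s)"] by (simp add: o_def)
  qed
  moreover have "norm (g (m + h * s)) \<le> M" if "s \<in> S'" for s
    using assms(2) Suc.prems that by auto
  ultimately show ?case by (intro sdb_SucI[of S' _ M "\<lambda>s. h *\<^sub>R g' (m + h * s)"]) auto
qed

lemma norm_diff_le_vector_derivative:
  fixes g :: "real \<Rightarrow> 'b::real_normed_vector"
  assumes "\<And>t. t \<in> {a..b} \<Longrightarrow> (g has_vector_derivative g' t) (at t within {a..b})"
    and "\<And>t. t \<in> {a..b} \<Longrightarrow> norm (g' t) \<le> B" and "x \<in> {a..b}" "y \<in> {a..b}"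
  shows "norm (g x - g y) \<le> B * \<bar>x - y\<bar>"
proof -
  have "norm (g x - g y) \<le> B * norm (x - y)"
  proof (rule differentiable_bound[of "{a..b}" g "\<lambda>t y. y *\<^sub>R g' t"])
    fix t assume t: "t \<in> {a..b}"
    show "(g has_derivative (\<lambda>y. y *\<^sub>R g' t)) (at t within {a..b})"
      using assms(1)[OF t] by (simp add: has_vector_derivative_def)
    show "onorm (\<lambda>y. y *\<^sub>R g' t) \<le> B"
      using assms(2)[OF t] by (intro onorm_le) (metis mult.commute mult_right_mono norm_ge_zero norm_scaleR real_norm_def)
  qed (use assms in auto)
  then show ?thesis by simp
qed

text \<open>The expansion of \<open>g'\<close> is integrated term by term. The remainder is measured
  with scale 1: all its derivatives up to order \<open>K\<close> are of size \<open>h ^ s\<close>,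
  which is what functionals that see derivatives require. The factor 2 per order is the maximal
  interval length in the mean value estimate.\<close>

lemma sdb_taylor:
  fixes g :: "real \<Rightarrow> 'b::real_normed_vector"
  assumes "sdb {a..b} (s + K) M h g" and ab: "a \<le> b" "b \<le> a + 2" and h: "0 \<le> h" "h \<le> 1"
  shows "\<exists>c. (\<forall>j<s. norm (c j) \<le> M * h ^ j) \<and> (0 < s \<longrightarrow> c 0 = g a) \<and>
     sdb {a..b} K (2 ^ s * M * h ^ s) 1 (\<lambda>x. g x - (\<Sum>j<s. (x - a) ^ j *\<^sub>R c j))"
  using assms(1)
proof (induction s arbitrary: M g)
  case 0
  have "0 \<le> M" using sdb_norm[OF 0] ab(1) norm_ge_zero order_trans
    by (metis atLeastAtMost_iff order_refl)
  then show ?case using 0 sdb_mono[of _ K M h g M 1] h by auto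
next
  case (Suc s)
  have M: "norm (g a) \<le> M" using sdb_norm[OF Suc.prems] ab by auto
  then have M0: "0 \<le> M" using norm_ge_zero order_trans by blast
  obtain g' where g': "\<forall>t\<in>{a..b}. (g has_vector_derivative g' t) (at t within {a..b})"
    "sdb {a..b} (s + K) (M * h) h g'" using Suc.prems by auto
  obtain c where c: "\<forall>j<s. norm (c j) \<le> M * h * h ^ j"
    and r: "sdb {a..b} K (2 ^ s * (M * h) * h ^ s) 1 (\<lambda>x. g' x - (\<Sum>j<s. (x - a) ^ j *\<^sub>R c j))"
    using Suc.IH[OF g'(2)] by blast
  \<comment> \<open>Coefficients of the antiderivative of the expansion of \<open>g'\<close>, with
    the value \<open>g a\<close> at \<open>a\<close>.\<close>
  define c' where "c' j = (case j of 0 \<Rightarrow> g a | Suc i \<Rightarrow> (1 / real (Suc i)) *\<^sub>R c i)" for j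
  define rho where "rho x = g x - (\<Sum>j<Suc s. (x - a) ^ j *\<^sub>R c' j)" for x
  define rho' where "rho' x = g' x - (\<Sum>j<s. (x - a) ^ j *\<^sub>R c j)" for x
  define B where "B = 2 ^ s * (M * h) * h ^ s"
  have B0: "0 \<le> B" using M0 h by (simp add: B_def)
  have c'b: "norm (c' j) \<le> M * h ^ j" if "j < Suc s" for j
  proof (cases j)
    case (Suc i)
    then have "norm (c i) \<le> M * h ^ j" using c that by (auto simp: mult_ac)
    moreover have "norm (c' j) \<le> norm (c i)"
      using Suc mult_right_mono[of "1 / real (Suc i)" 1 "norm (c i)"] by (simp add: c'_def divide_simps)
    ultimately show ?thesis by linarith
  qed (use M in \<open>auto simp: c'_def\<close>)
  have rd: "(rho has_vector_derivative rho' t) (at t within {a..b})" if "t \<in> {a..b}" for t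
  proof -
    have pd: "((\<lambda>x. (x - a) ^ Suc i *\<^sub>R c' (Suc i)) has_vector_derivative (t - a) ^ i *\<^sub>R c i) (at t within {a..b})" for i
    proof -
      have "((\<lambda>x. (x - a) ^ Suc i) has_real_derivative real (Suc i) * (t - a) ^ i) (at t within {a..b})"
        by (rule derivative_eq_intros refl)+ simp
      then have "((\<lambda>x. (x - a) ^ Suc i *\<^sub>R c' (Suc i)) has_vector_derivative
          (real (Suc i) * (t - a) ^ i) *\<^sub>R c' (Suc i)) (at t within {a..b})"
        using has_vector_derivative_scaleR[OF _ has_vector_derivative_const[of "c' (Suc i)"]] by fastforce
      moreover have "(real (Suc i) * (t - a) ^ i) *\<^sub>R c' (Suc i) = (t - a) ^ i *\<^sub>R c i"
        by (simp add: c'_def del: of_nat_Suc)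
      ultimately show ?thesis by simp
    qed
    have "((\<lambda>x. \<Sum>i<s. (x - a) ^ Suc i *\<^sub>R c' (Suc i)) has_vector_derivative (\<Sum>i<s. (t - a) ^ i *\<^sub>R c i)) (at t within {a..b})"
      by (intro has_vector_derivative_sum pd)
    then have "((\<lambda>x. g x - (c' 0 + (\<Sum>i<s. (x - a) ^ Suc i *\<^sub>R c' (Suc i)))) has_vector_derivative
        g' t - (0 + (\<Sum>i<s. (t - a) ^ i *\<^sub>R c i))) (at t within {a..b})"
      using g'(1) that by (intro has_vector_derivative_diff has_vector_derivative_add has_vector_derivative_const) auto
    moreover have "(\<Sum>j<Suc s. (x - a) ^ j *\<^sub>R c' j) = c' 0 + (\<Sum>i<s. (x - a) ^ Suc i *\<^sub>R c' (Suc i))" for x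
      by (simp only: sum.lessThan_Suc_shift) simp
    ultimately show ?thesis by (simp add: rho_def[abs_def] rho'_def)
  qed
  have r0: "rho a = 0"
  proof -
    have "(\<Sum>j<Suc s. (a - a) ^ j *\<^sub>R c' j) = c' 0"
      by (simp only: sum.lessThan_Suc_shift) simp
    then show ?thesis by (simp add: rho_def c'_def)
  qed
  have rb: "norm (rho x) \<le> 2 * B" if x: "x \<in> {a..b}" for x
  proof -
    have "norm (rho x - rho a) \<le> B * \<bar>x - a\<bar>"
    proof (rule norm_diff_le_vector_derivative[OF rd])
      show "norm (rho' t) \<le> B" if "t \<in> {a..b}" for t
        using sdb_norm[OF r that] by (simp add: rho'_def B_def)
    qed (use x ab in auto)
    also have "\<dots> \<le> B * 2" using x ab B0 by (intro mult_left_mono) auto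
    finally show ?thesis using r0 by simp
  qed
  have B2: "2 ^ Suc s * M * h ^ Suc s = 2 * B" by (simp add: B_def)
  have "sdb {a..b} (Suc K) (2 * B) 1 rho"
    using rb rd sdb_mono[OF r[folded B_def rho'_def], of "2*B" 1] B0
    by (intro sdb_SucI[of _ _ _ rho']) auto
  then have "sdb {a..b} K (2 ^ Suc s * M * h ^ Suc s) 1 rho"
    unfolding B2 using sdb_le_order le_SucI by blast
  then show ?case
    using c'b by (intro exI[of _ c']) (auto simp: rho_def[abs_def] c'_def simp del: sum.lessThan_Suc)
qed

section \<open>Composition with smooth functions\<close>

lemma smooth_fun_continuous: "smooth_fun g \<Longrightarrow> continuous_on UNIV g"
  unfolding smooth_fun_def by (metis Cn.simps(1))

lemma smooth_fun_bounded_cball: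
  fixes g :: "'x::euclidean_space \<Rightarrow> 'y::real_normed_vector"
  assumes "smooth_fun g"
  obtains B where "\<And>x. norm x \<le> M \<Longrightarrow> norm (g x) \<le> B"
proof -
  have "compact (g ` cball 0 M)"
    by (intro compact_continuous_image continuous_on_subset[OF smooth_fun_continuous[OF assms]]) auto
  then obtain B where "\<forall>y\<in>g ` cball 0 M. norm y \<le> B"
    using compact_imp_bounded bounded_iff by metis
  then show thesis by (intro that[of B]) (auto simp: mem_cball)
qed

lemma smooth_fun_differentiable: "smooth_fun g \<Longrightarrow> g differentiable (at x)"
  unfolding smooth_fun_def by (metis Cn.simps(2))

lemma smooth_fun_directional: "smooth_fun g \<Longrightarrow> smooth_fun (\<lambda>x. frechet_derivative g (at x) v)"
  unfolding smooth_fun_def by (metis Cn.simps(2))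

text \<open>Reduces the total derivative to finitely many directional derivatives, the form in which
  \<open>smooth_fun\<close> can be iterated.\<close>

lemma frechet_derivative_basis_expansion:
  fixes g :: "'x::euclidean_space \<Rightarrow> 'y::real_normed_vector"
  assumes "g differentiable (at x)"
  shows "frechet_derivative g (at x) v = (\<Sum>b\<in>Basis. (v \<bullet> b) *\<^sub>R frechet_derivative g (at x) b)"
proof -
  have "linear (frechet_derivative g (at x))"
    using assms linear_frechet_derivative by blast
  then have "frechet_derivative g (at x) (\<Sum>b\<in>Basis. (v \<bullet> b) *\<^sub>R b) = (\<Sum>b\<in>Basis. (v \<bullet> b) *\<^sub>R frechet_derivative g (at x) b)"
    by (simp add: linear_sum linear_scale)
  then show ?thesis by (simp add: euclidean_representation)
qed

lemma smooth_compose_derivative: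
  fixes g :: "'x::euclidean_space \<Rightarrow> 'y::real_normed_vector"
  assumes "smooth_fun g" "(\<gamma> has_vector_derivative \<gamma>') (at t within S)"
  shows "((\<lambda>t. g (\<gamma> t)) has_vector_derivative
     (\<Sum>b\<in>Basis. (\<gamma>' \<bullet> b) *\<^sub>R frechet_derivative g (at (\<gamma> t)) b)) (at t within S)"
proof -
  have "(g has_derivative frechet_derivative g (at (\<gamma> t))) (at (\<gamma> t) within \<gamma> ` S)"
    using smooth_fun_differentiable[OF assms(1)] frechet_derivative_works has_derivative_at_withinI by blast
  from vector_derivative_diff_chain_within[OF assms(2) this]
  show ?thesis
    by (simp add: o_def frechet_derivative_basis_expansion[OF smooth_fun_differentiable[OF assms(1)], of _ "\<gamma>'"])
qed

text \<open>Induction on \<open>K\<close> with \<open>g\<close> generalized to its directional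
  derivatives takes the place of the formula of Faa di Bruno. The inner derivative carries the
  factor \<open>h\<close>, so the scaling survives. \<open>M'\<close> is fixed before
  \<open>S\<close>, \<open>h\<close> and the curve; constants independent of the mesh come from
  here.\<close>

lemma sdb_smooth_compose:
  fixes g :: "'x::euclidean_space \<Rightarrow> 'y::real_normed_vector"
  assumes "smooth_fun g"
  shows "\<exists>M'\<ge>0. \<forall>S h \<gamma>. 0 \<le> h \<longrightarrow> sdb S K M h \<gamma> \<longrightarrow> sdb S K M' h (\<lambda>t. g (\<gamma> t))"
  using assms
proof (induction K arbitrary: g)
  case (0 g)
  obtain B where B: "\<And>x. norm x \<le> M \<Longrightarrow> norm (g x) \<le> B"
    using smooth_fun_bounded_cball[OF 0] by blast
  show ?case
  proof (intro exI[of _ "max B 0"] conjI allI impI)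
    fix S h and \<gamma> :: "real \<Rightarrow> 'x" assume a: "sdb S 0 M h \<gamma>"
    have "continuous_on S (\<lambda>t. g (\<gamma> t))"
      using a smooth_fun_continuous[OF 0] by (auto intro: continuous_on_compose2[of UNIV g])
    moreover have "norm (g (\<gamma> t)) \<le> max B 0" if "t \<in> S" for t
      using B[of "\<gamma> t"] a that by auto
    ultimately show "sdb S 0 (max B 0) h (\<lambda>t. g (\<gamma> t))" by auto
  qed auto
next
  case (Suc K g)
  obtain B where B: "\<And>x. norm x \<le> M \<Longrightarrow> norm (g x) \<le> B"
    using smooth_fun_bounded_cball[OF Suc.prems] by blast
  have "\<forall>b. \<exists>M'\<ge>0. \<forall>S h \<gamma>. 0 \<le> h \<longrightarrow> sdb S K M h \<gamma> \<longrightarrow> sdb S K M' h (\<lambda>t. frechet_derivative g (at (\<gamma> t)) b)"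
    using Suc.IH[OF smooth_fun_directional[OF Suc.prems]] by blast
  then obtain Q where Q0: "\<And>b. 0 \<le> Q b"
    and Q: "\<And>b S h \<gamma>. 0 \<le> h \<Longrightarrow> sdb S K M h \<gamma> \<Longrightarrow> sdb S K (Q b) h (\<lambda>t. frechet_derivative g (at (\<gamma> t)) b)"
    by metis
  \<comment> \<open>The first summand bounds \<open>g\<close> itself, the second its derivative
    along the curve. \<open>max B 0\<close> and \<open>\<bar>M\<bar>\<close> keep the bounds
    nonnegative when \<open>M < 0\<close>, where the ball is empty.\<close>
  define M' where "M' = max B 0 + (\<Sum>b\<in>(Basis::'x set). 2 ^ K * (\<bar>M\<bar> * Q b))"
  have s0: "0 \<le> (\<Sum>b\<in>(Basis::'x set). 2 ^ K * (\<bar>M\<bar> * Q b))" using Q0 by (intro sum_nonneg) auto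
  then have M'0: "0 \<le> M'" by (auto simp: M'_def)
  show ?case
  proof (intro exI[of _ M'] conjI allI impI M'0)
    fix S and h :: real and \<gamma> :: "real \<Rightarrow> 'x" assume h: "0 \<le> h" and a: "sdb S (Suc K) M h \<gamma>"
    then obtain \<gamma>' where d: "\<forall>t\<in>S. (\<gamma> has_vector_derivative \<gamma>' t) (at t within S)"
      and d': "sdb S K (M * h) h \<gamma>'" by auto
    have aK: "sdb S K M h \<gamma>" using a sdb_le_order le_SucI by blast
    have "sdb S K (\<bar>M\<bar> * h) h \<gamma>'" using h by (intro sdb_mono[OF d']) (auto intro: mult_right_mono)
    then have "sdb S K (\<bar>M\<bar> * h) h (\<lambda>t. \<gamma>' t \<bullet> b)" if "b \<in> Basis" for b
      using sdb_linear[OF bounded_linear_inner_left[of b], of 1 S K "\<bar>M\<bar>*h" h \<gamma>'] that Basis_le_norm[of b]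
      by simp
    then have "sdb S K (2 ^ K * (\<bar>M\<bar> * h * Q b)) h (\<lambda>t. (\<gamma>' t \<bullet> b) *\<^sub>R frechet_derivative g (at (\<gamma> t)) b)" if "b \<in> Basis" for b
      using sdb_bilinear[OF bounded_bilinear_scaleR _ _ Q[OF h aK, of b]] that by simp
    then have "sdb S K (\<Sum>b\<in>(Basis::'x set). 2 ^ K * (\<bar>M\<bar> * h * Q b)) h
        (\<lambda>t. \<Sum>b\<in>Basis. (\<gamma>' t \<bullet> b) *\<^sub>R frechet_derivative g (at (\<gamma> t)) b)"
      using h by (intro sdb_sum) auto
    then have "sdb S K (M' * h) h (\<lambda>t. \<Sum>b\<in>Basis. (\<gamma>' t \<bullet> b) *\<^sub>R frechet_derivative g (at (\<gamma> t)) b)"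
    proof (rule sdb_mono)
      have "(\<Sum>b\<in>(Basis::'x set). 2 ^ K * (\<bar>M\<bar> * h * Q b)) = (\<Sum>b\<in>(Basis::'x set). 2 ^ K * (\<bar>M\<bar> * Q b)) * h"
        by (simp add: sum_distrib_left sum_distrib_right mult_ac)
      also have "\<dots> \<le> M' * h" using h by (intro mult_right_mono) (auto simp: M'_def)
      finally show "(\<Sum>b\<in>(Basis::'x set). 2 ^ K * (\<bar>M\<bar> * h * Q b)) \<le> M' * h" .
    qed (use h M'0 in auto)
    moreover have "norm (g (\<gamma> t)) \<le> M'" if "t \<in> S" for t
    proof -
      have "norm (\<gamma> t) \<le> M" using sdb_norm[OF a that] .
      then have "norm (g (\<gamma> t)) \<le> B" using B by auto
      then show ?thesis using s0 by (auto simp: M'_def)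
    qed
    moreover have "\<forall>t\<in>S. ((\<lambda>t. g (\<gamma> t)) has_vector_derivative
        (\<Sum>b\<in>Basis. (\<gamma>' t \<bullet> b) *\<^sub>R frechet_derivative g (at (\<gamma> t)) b)) (at t within S)"
      using smooth_compose_derivative[OF Suc.prems] d by blast
    ultimately show "sdb S (Suc K) M' h (\<lambda>t. g (\<gamma> t))" by auto
  qed
qed

section \<open>Derivative towers and iterated derivatives\<close>

text \<open>An explicit sequence of successive derivatives. It mediates between the existential
  derivatives in \<open>sdb\<close> and the chosen \<open>vector_derivative\<close> in
  \<open>vder\<close> and \<open>Ck_on\<close>.\<close>

definition deriv_tower :: "real set \<Rightarrow> nat \<Rightarrow> (nat \<Rightarrow> real \<Rightarrow> 'b::real_normed_vector) \<Rightarrow> bool" where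
  "deriv_tower S K D \<longleftrightarrow> (\<forall>j<K. \<forall>t\<in>S. (D j has_vector_derivative D (Suc j) t) (at t within S))"

lemma deriv_towerD:
  "deriv_tower S K D \<Longrightarrow> j < K \<Longrightarrow> t \<in> S \<Longrightarrow> (D j has_vector_derivative D (Suc j) t) (at t within S)"
  by (simp add: deriv_tower_def)

lemma deriv_tower_subset: "deriv_tower S K D \<Longrightarrow> S' \<subseteq> S \<Longrightarrow> deriv_tower S' K D"
  by (auto simp: deriv_tower_def intro: has_vector_derivative_within_subset)

lemma sdb_tower:
  assumes "sdb S K M h g"
  obtains D where "D 0 = g" "deriv_tower S K D" "\<And>j t. j \<le> K \<Longrightarrow> t \<in> S \<Longrightarrow> norm (D j t) \<le> M * h ^ j"
    "continuous_on S (D K)"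
  using assms
proof (induction K arbitrary: M g thesis)
  case 0
  show ?case by (rule 0(1)[of "\<lambda>_. g"]) (use 0 in \<open>auto simp: deriv_tower_def\<close>)
next
  case (Suc K)
  obtain g' where g': "\<And>t. t \<in> S \<Longrightarrow> (g has_vector_derivative g' t) (at t within S)" "sdb S K (M * h) h g'"
    by (rule sdb_SucE[OF Suc.prems(2)]) auto
  obtain D where D: "D 0 = g'" "deriv_tower S K D"
    "\<And>j t. j \<le> K \<Longrightarrow> t \<in> S \<Longrightarrow> norm (D j t) \<le> M * h * h ^ j" "continuous_on S (D K)"
    using Suc.IH[OF _ g'(2)] by blast
  define E where "E j = (case j of 0 \<Rightarrow> g | Suc i \<Rightarrow> D i)" for j
  show ?case
  proof (rule Suc.prems(1)[of E])
    show "deriv_tower S (Suc K) E"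
      using D(1,2) g'(1) by (auto simp: deriv_tower_def E_def less_Suc_eq_0_disj)
    show "norm (E j t) \<le> M * h ^ j" if "j \<le> Suc K" "t \<in> S" for j t
      using that D(3) sdb_norm[OF Suc.prems(2)] by (cases j) (auto simp: E_def mult_ac)
  qed (use D in \<open>auto simp: E_def\<close>)
qed

lemma tower_sdb:
  assumes "deriv_tower S K D" "\<And>j t. j \<le> K \<Longrightarrow> t \<in> S \<Longrightarrow> norm (D j t) \<le> M * h ^ j" "continuous_on S (D K)"
  shows "sdb S K M h (D 0)"
  using assms
proof (induction K arbitrary: M D)
  case 0
  then show ?case by force
next
  case (Suc K)
  have "sdb S K (M * h) h (D (Suc 0))"
  proof (rule Suc.IH[of "\<lambda>j. D (Suc j)"])
    show "norm (D (Suc j) t) \<le> M * h * h ^ j" if "j \<le> K" "t \<in> S" for j t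
      using Suc.prems(2)[of "Suc j" t] that by (simp add: mult_ac)
  qed (use Suc.prems in \<open>auto simp: deriv_tower_def\<close>)
  moreover have "norm (D 0 t) \<le> M" if "t \<in> S" for t
    using Suc.prems(2)[of 0 t] that by simp
  ultimately show ?case
    using deriv_towerD[OF Suc.prems(1)] by (intro sdb_SucI[of _ _ _ "D (Suc 0)"]) auto
qed

text \<open>A nontrivial filter makes the derivative within \<open>S\<close> unique, so the choice
  made by \<open>vder\<close> has to follow the tower.\<close>

lemma vder_tower:
  assumes "deriv_tower S K D" "\<And>t. t \<in> S \<Longrightarrow> at t within S \<noteq> bot" "j \<le> K" "t \<in> S"
  shows "vder S j (D 0) t = D j t"
  using assms(3,4)
proof (induction j arbitrary: t)
  case (Suc j)
  have "(D j has_vector_derivative D (Suc j) t) (at t within S)"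
    by (rule deriv_towerD[OF assms(1)]) (use Suc.prems in auto)
  then have "(vder S j (D 0) has_vector_derivative D (Suc j) t) (at t within S)"
    by (rule has_vector_derivative_transform[rotated 2]) (use Suc in auto)
  with vector_derivative_within[OF assms(2)[OF Suc.prems(2)]] show ?case by simp
qed simp

lemma vder_tower_open:
  assumes "deriv_tower S K D" "open S" "j \<le> K" "t \<in> S"
  shows "vder UNIV j (D 0) t = D j t"
  using assms(3,4)
proof (induction j arbitrary: t)
  case (Suc j)
  have "(D j has_vector_derivative D (Suc j) t) (at t within S)"
    by (rule deriv_towerD[OF assms(1)]) (use Suc.prems in auto)
  then have "(D j has_vector_derivative D (Suc j) t) (at t)"
    using at_within_open[OF Suc.prems(2) assms(2)] by simp
  then have "(vder UNIV j (D 0) has_vector_derivative D (Suc j) t) (at t)"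
    by (rule has_vector_derivative_transform_within_open[OF _ assms(2) Suc.prems(2)]) (use Suc in auto)
  from vector_derivative_at[OF this] show ?case by simp
qed simp

lemma at_within_Icc_neq_bot: "a < b \<Longrightarrow> t \<in> {a..b} \<Longrightarrow> at t within {a..b} \<noteq> (bot :: real filter)"
  using trivial_limit_within[of t "{a..b}"] islimpt_Icc[of a b t] by auto

lemma Ck_on_cong:
  assumes "Ck_on m S g" "\<And>t. t \<in> S \<Longrightarrow> g t = g' t"
  shows "Ck_on m S g'"
  using assms
proof (induction m arbitrary: g g')
  case 0
  then show ?case by (auto cong: continuous_on_cong)
next
  case (Suc m)
  have iff: "(g has_vector_derivative d) (at t within S) \<longleftrightarrow> (g' has_vector_derivative d) (at t within S)"
    if "t \<in> S" for t d
  proof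
    show "(g' has_vector_derivative d) (at t within S)" if "(g has_vector_derivative d) (at t within S)"
      by (rule has_vector_derivative_transform[OF \<open>t \<in> S\<close> _ that]) (use Suc.prems(2) in auto)
    show "(g has_vector_derivative d) (at t within S)" if "(g' has_vector_derivative d) (at t within S)"
      by (rule has_vector_derivative_transform[OF \<open>t \<in> S\<close> _ that]) (use Suc.prems(2) in auto)
  qed
  then have eq: "vector_derivative g (at t within S) = vector_derivative g' (at t within S)" if "t \<in> S" for t
    using that by (simp add: vector_derivative_def)
  show ?case
    using Suc.prems iff eq Suc.IH[of "\<lambda>t. vector_derivative g (at t within S)" "\<lambda>t. vector_derivative g' (at t within S)"]
    by auto
qed

lemma tower_Ck_on:
  assumes "deriv_tower S K D" "continuous_on S (D K)" "\<And>t. t \<in> S \<Longrightarrow> at t within S \<noteq> bot"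
  shows "Ck_on K S (D 0)"
  using assms(1,2)
proof (induction K arbitrary: D)
  case (Suc K)
  have eq: "vector_derivative (D 0) (at t within S) = D (Suc 0) t" if "t \<in> S" for t
    using vector_derivative_within[OF assms(3)] deriv_towerD[OF Suc.prems(1)] that by blast
  have "Ck_on K S (D (Suc 0))"
    using Suc.IH[of "\<lambda>j. D (Suc j)"] Suc.prems by (auto simp: deriv_tower_def)
  then have "Ck_on K S (\<lambda>t. vector_derivative (D 0) (at t within S))"
    by (rule Ck_on_cong) (use eq in auto)
  then show ?case using eq deriv_towerD[OF Suc.prems(1)] by auto
qed auto

text \<open>\<open>vder\<close> adds a derivative on the outside, \<open>Ck_on\<close> peels one off
  on the inside; this exchanges the two recursions.\<close>

lemma vder_Suc_shift: "vder S (Suc j) g = vder S j (\<lambda>t. vector_derivative g (at t within S))"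
proof (induction j)
  case (Suc j)
  show ?case using Suc by (subst vder.simps(2), simp)
qed simp

lemma Ck_on_tower:
  assumes "Ck_on K S g"
  shows "deriv_tower S K (\<lambda>j. vder S j g)" "continuous_on S (vder S K g)"
proof -
  have "deriv_tower S K (\<lambda>j. vder S j g) \<and> continuous_on S (vder S K g)"
    using assms
  proof (induction K arbitrary: g)
    case (Suc K)
    define g' where "g' = (\<lambda>t. vector_derivative g (at t within S))"
    have IH: "deriv_tower S K (\<lambda>j. vder S j g')" "continuous_on S (vder S K g')"
      using Suc by (auto simp: g'_def)
    have sh: "vder S (Suc j) g = vder S j g'" for j
      unfolding g'_def by (rule vder_Suc_shift)
    have "(vder S j g has_vector_derivative vder S (Suc j) g t) (at t within S)" if "j < Suc K" "t \<in> S" for j t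
    proof (cases j)
      case 0
      then show ?thesis using Suc.prems that by simp
    next
      case (Suc i)
      then have "i < K" using that by simp
      then show ?thesis unfolding Suc sh by (rule deriv_towerD[OF IH(1) _ that(2)])
    qed
    then show ?case using IH(2) sh by (auto simp: deriv_tower_def simp del: vder.simps(2))
  qed (auto simp: deriv_tower_def)
  then show "deriv_tower S K (\<lambda>j. vder S j g)" "continuous_on S (vder S K g)" by auto
qed

lemma Ck_on_sdb:
  assumes "Ck_on K S g" "\<And>j t. j \<le> K \<Longrightarrow> t \<in> S \<Longrightarrow> norm (vder S j g t) \<le> M"
  shows "sdb S K M 1 g"
  using tower_sdb[OF Ck_on_tower(1)[OF assms(1)], of M 1] assms(2) Ck_on_tower(2)[OF assms(1)] by simp

lemma sdb_Ck_on:
  assumes "sdb {a..b} K M h g" "a < b"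
  shows "Ck_on K {a..b} g"
  using sdb_tower[OF assms(1)] tower_Ck_on at_within_Icc_neq_bot[OF assms(2)] by metis

lemma sdb_vder_tower:
  assumes "sdb {a..b} K M h g" "a < b"
  shows "deriv_tower {a..b} K (\<lambda>j. vder {a..b} j g)"
  by (rule Ck_on_tower(1)[OF sdb_Ck_on[OF assms]])

lemma sdb_vder_bound:
  assumes "sdb {a..b} K M h g" "a < b" "j \<le> K" "t \<in> {a..b}"
  shows "norm (vder {a..b} j g t) \<le> M * h ^ j"
  using sdb_tower[OF assms(1)] vder_tower[of "{a..b}" K] at_within_Icc_neq_bot[OF assms(2)] assms(3,4) by metis

text \<open>Derivatives within the interval do not see values outside it, so agreement on the
  interval suffices. This form fits \<open>Op\<close>, whose output is controlled on
  \<open>{-1..1}\<close> only.\<close>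

lemma vder_Icc_tower_eq:
  assumes "deriv_tower {a..b} K D" "a < b" "j \<le> K" "t \<in> {a..b}" "\<And>t. t \<in> {a..b} \<Longrightarrow> D 0 t = g t"
  shows "vder {a..b} j g t = D j t"
proof -
  have "deriv_tower {a..b} K (D(0 := g))"
    unfolding deriv_tower_def
  proof (intro allI impI ballI)
    fix i s assume i: "i < K" "s \<in> {a..b}"
    have "((D(0 := g)) i has_vector_derivative D (Suc i) s) (at s within {a..b})"
      by (rule has_vector_derivative_transform[OF i(2) _ deriv_towerD[OF assms(1) i]]) (use assms(5) in auto)
    then show "((D(0 := g)) i has_vector_derivative (D(0 := g)) (Suc i) s) (at s within {a..b})" by simp
  qed
  from vder_tower[OF this at_within_Icc_neq_bot[OF assms(2)] assms(3,4)]
  show ?thesis using assms(4,5) by (cases j) auto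
qed

text \<open>The method uses two-sided derivatives at the mesh points, the estimates use one-sided
  ones. Regularity on an open neighbourhood identifies them.\<close>

lemma vder_UNIV_eq:
  assumes "sdb S K M h g" "open S" "{a..b} \<subseteq> S" "a < b" "j \<le> K" "t \<in> {a..b}"
  shows "vder UNIV j g t = vder {a..b} j g t"
proof -
  obtain D where D: "D 0 = g" "deriv_tower S K D" by (rule sdb_tower[OF assms(1)])
  show ?thesis
    using vder_tower_open[OF D(2) assms(2,5), of t] assms(3,6) D(1)
      vder_Icc_tower_eq[OF deriv_tower_subset[OF D(2) assms(3)] assms(4-6), of g] by auto
qed

lemma vder_affine:
  assumes "sdb {a..b} K M h0 g" "a < b" "c < d" "\<And>s. s \<in> {c..d} \<Longrightarrow> m + h * s \<in> {a..b}"
    "j \<le> K" "s \<in> {c..d}"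
  shows "vder {c..d} j (\<lambda>s. g (m + h * s)) s = h ^ j *\<^sub>R vder {a..b} j g (m + h * s)"
proof -
  let ?D = "\<lambda>j. vder {a..b} j g"
  have "deriv_tower {c..d} K (\<lambda>j s. h ^ j *\<^sub>R ?D j (m + h * s))"
    unfolding deriv_tower_def
  proof (intro allI impI ballI)
    fix j s assume j: "j < K" "s \<in> {c..d}"
    have "((\<lambda>s. m + h * s) has_vector_derivative h) (at s within {c..d})"
      by (auto intro!: derivative_eq_intros simp flip: has_real_derivative_iff_has_vector_derivative)
    moreover have "(?D j has_vector_derivative ?D (Suc j) (m + h * s)) (at (m + h * s) within (\<lambda>s. m + h * s) ` {c..d})"
      using deriv_towerD[OF sdb_vder_tower[OF assms(1,2)] j(1)] assms(4) j(2)
      by (blast intro: has_vector_derivative_within_subset[where S="{a..b}"])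
    ultimately have "((\<lambda>s. ?D j (m + h * s)) has_vector_derivative h *\<^sub>R ?D (Suc j) (m + h * s)) (at s within {c..d})"
      using vector_diff_chain_within[of "\<lambda>s. m + h * s" h s "{c..d}" "?D j" "?D (Suc j) (m + h * s)"] by (simp add: o_def)
    then show "((\<lambda>s. h ^ j *\<^sub>R ?D j (m + h * s)) has_vector_derivative h ^ Suc j *\<^sub>R ?D (Suc j) (m + h * s)) (at s within {c..d})"
      using bounded_linear.has_vector_derivative[OF bounded_linear_scaleR_right[of "h ^ j"]] by (fastforce simp: mult.commute)
  qed
  from vder_Icc_tower_eq[OF this assms(3,5,6), of "\<lambda>s. g (m + h * s)"]
  show ?thesis by simp
qed

lemma vder_linear:
  assumes "bounded_linear L" "sdb {a..b} K M h g" "a < b" "j \<le> K" "t \<in> {a..b}"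
  shows "vder {a..b} j (\<lambda>t. L (g t)) t = L (vder {a..b} j g t)"
proof -
  have "deriv_tower {a..b} K (\<lambda>j t. L (vder {a..b} j g t))"
    using sdb_vder_tower[OF assms(2,3)] bounded_linear.has_vector_derivative[OF assms(1)]
    by (auto simp: deriv_tower_def simp del: vder.simps(2))
  from vder_Icc_tower_eq[OF this assms(3-5), of "\<lambda>t. L (g t)"] show ?thesis by simp
qed

lemma vder_diff:
  assumes "sdb {a..b} K M h g" "sdb {a..b} K M' h' g'" "a < b" "j \<le> K" "t \<in> {a..b}"
  shows "vder {a..b} j (\<lambda>t. g t - g' t) t = vder {a..b} j g t - vder {a..b} j g' t"
proof -
  have "deriv_tower {a..b} K (\<lambda>j t. vder {a..b} j g t - vder {a..b} j g' t)"
    using sdb_vder_tower[OF assms(1,3)] sdb_vder_tower[OF assms(2,3)]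
    by (auto simp: deriv_tower_def simp del: vder.simps(2) intro: has_vector_derivative_diff)
  from vder_Icc_tower_eq[OF this assms(3-5), of "\<lambda>t. g t - g' t"] show ?thesis by simp
qed

lemma sdb_derivative:
  assumes "sdb {a..b} (Suc K) M h g" "a < b" "\<And>t. t \<in> {a..b} \<Longrightarrow> (g has_vector_derivative d t) (at t within {a..b})"
  shows "sdb {a..b} K (M * h) h d"
proof -
  obtain g' where g': "\<And>t. t \<in> {a..b} \<Longrightarrow> (g has_vector_derivative g' t) (at t within {a..b})"
    "sdb {a..b} K (M * h) h g'" by (rule sdb_SucE[OF assms(1)]) auto
  have "g' t = d t" if t: "t \<in> {a..b}" for t
    using vector_derivative_within[OF at_within_Icc_neq_bot[OF assms(2) t]] g'(1)[OF t] assms(3)[OF t]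
    by metis
  then show ?thesis by (rule sdb_cong[OF g'(2)])
qed

lemma poly_deriv_tower: "deriv_tower S K (\<lambda>j. poly ((pderiv ^^ j) p))"
  by (auto simp: deriv_tower_def simp flip: has_real_derivative_iff_has_vector_derivative
      intro: DERIV_subset[OF poly_DERIV])

lemma vder_poly: "a < b \<Longrightarrow> t \<in> {a..b} \<Longrightarrow> vder {a..b} j (poly p) t = poly ((pderiv ^^ j) p) t"
  using vder_Icc_tower_eq[OF poly_deriv_tower[of _ j p]] by simp

lemma sup_der_le:
  assumes "sdb {-1..1} K M 1 g" "m \<le> K"
  shows "sup_der m g \<le> real (m + 1) * M"
proof -
  have "(SUP x\<in>{-1..1::real}. norm (vder {-1..1} j g x)) \<le> M" if "j \<le> m" for j
    using sdb_vder_bound[OF assms(1), of j] that assms(2) by (intro cSUP_least) auto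
  then have "sup_der m g \<le> (\<Sum>j\<le>m. M)" unfolding sup_der_def by (intro sum_mono) auto
  then show ?thesis by simp
qed

text \<open>Continuity on a compact interval makes the set of norms bounded above; only then is the
  real \<open>SUP\<close> an upper bound.\<close>

lemma norm_vder_le_SUP:
  assumes "Ck_on K {-1..1} g" "j \<le> K" "x \<in> {-1..1}"
  shows "norm (vder {-1..1} j g x) \<le> (SUP x\<in>{-1..1::real}. norm (vder {-1..1} j g x))"
proof (rule cSUP_upper[OF assms(3)])
  have "continuous_on {-1..1} (vder {-1..1} j g)"
  proof (cases "j = K")
    case True
    then show ?thesis using Ck_on_tower(2)[OF assms(1)] by simp
  next
    case False
    then have "(vder {-1..1} j g has_vector_derivative vder {-1..1} (Suc j) g t) (at t within {-1..1})"
      if "t \<in> {-1..1}" for t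
      using deriv_towerD[OF Ck_on_tower(1)[OF assms(1)]] assms(2) that by simp
    then show ?thesis
      unfolding continuous_on_eq_continuous_within using has_vector_derivative_continuous by blast
  qed
  then have "compact ((\<lambda>x. norm (vder {-1..1} j g x)) ` {-1..1})"
    by (intro compact_continuous_image continuous_intros) auto
  then show "bdd_above ((\<lambda>x. norm (vder {-1..1} j g x)) ` {-1..1})"
    by (intro bounded_imp_bdd_above compact_imp_bounded)
qed

section \<open>Polynomials and their coefficients\<close>

lemma sdb_monomial:
  assumes "bounded S"
  shows "\<exists>B\<ge>0. sdb S K B 1 (\<lambda>x::real. x ^ i)"
proof -
  obtain R where R: "\<And>t. t \<in> S \<Longrightarrow> \<bar>t\<bar> \<le> R" using assms by (auto simp: bounded_iff)
  have id: "sdb S K (max R 1) 1 (\<lambda>t. t)" by (rule sdb_ident) (use R in \<open>auto simp: le_max_iff_disj\<close>)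
  show ?thesis
  proof (induction i)
    case 0
    have "sdb S K 1 1 (\<lambda>_. 1 :: real)" by (rule sdb_const) auto
    then show ?case by (intro exI[of _ 1]) simp
  next
    case (Suc i)
    then obtain B where "B \<ge> 0" "sdb S K B 1 (\<lambda>x. x ^ i)" by blast
    with sdb_mult[OF id this(2)] show ?case by (auto intro!: exI[of _ "2 ^ K * (max R 1 * B)"])
  qed
qed

text \<open>The space of polynomials of degree at most n - 1, which is \<open>{0}\<close> for
  \<open>n = 0\<close>. Stated by coefficients, it is closed under linear combinations without a
  case distinction on degrees.\<close>

definition polys_below :: "nat \<Rightarrow> real poly set" where
  "polys_below n = {p. \<forall>i\<ge>n. coeff p i = 0}"

lemma polys_below_polys_deg: "p \<in> polys_below n \<longleftrightarrow> p \<in> polys_deg (int n - 1)"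
proof -
  have "(\<forall>i\<ge>n. coeff p i = 0) \<longleftrightarrow> p = 0 \<or> degree p < n"
  proof
    assume "\<forall>i\<ge>n. coeff p i = 0"
    then show "p = 0 \<or> degree p < n" using leading_coeff_0_iff[of p] not_le by blast
  qed (auto simp: coeff_eq_0)
  then show ?thesis by (auto simp: polys_below_def polys_deg_def)
qed

lemma polys_below_degree: "p \<in> polys_below (Suc n) \<longleftrightarrow> degree p \<le> n"
  by (simp add: polys_below_polys_deg polys_deg_def)

lemma poly_polys_below:
  assumes "p \<in> polys_below n"
  shows "poly p x = (\<Sum>i<n. coeff p i * x ^ i)"
proof (cases "p = 0")
  case False
  then have "degree p < n"
    using assms leading_coeff_0_iff[of p] by (auto simp: polys_below_def not_le[symmetric])
  then have "(\<Sum>i\<le>degree p. coeff p i * x ^ i) = (\<Sum>i<n. coeff p i * x ^ i)"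
    by (intro sum.mono_neutral_left) (auto simp: coeff_eq_0)
  then show ?thesis by (simp add: poly_altdef)
qed simp

text \<open>Turns a bound of the coefficients into a bound in C^K with one constant for the whole
  space of polynomials.\<close>

lemma sdb_poly_coeffs:
  assumes "bounded S"
  shows "\<exists>B\<ge>0. \<forall>p\<in>polys_below n. \<forall>m. (\<forall>i<n. \<bar>coeff p i\<bar> \<le> m) \<longrightarrow> 0 \<le> m \<longrightarrow> sdb S K (B * m) 1 (poly p)"
proof -
  have "\<forall>i. \<exists>B\<ge>0. sdb S K B 1 (\<lambda>x::real. x ^ i)"
    using sdb_monomial[OF assms] by blast
  from choice[OF this] obtain B where B0: "\<And>i. 0 \<le> B i" and B: "\<And>i. sdb S K (B i) 1 (\<lambda>x::real. x ^ i)"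
    by blast
  show ?thesis
  proof (intro exI[of _ "\<Sum>i<n. B i"] conjI allI impI ballI)
    fix p :: "real poly" and m :: real
    assume p: "p \<in> polys_below n" and m: "\<forall>i<n. \<bar>coeff p i\<bar> \<le> m" "0 \<le> m"
    have "sdb S K (\<Sum>i<n. B i * m) 1 (\<lambda>x. \<Sum>i<n. coeff p i * x ^ i)"
    proof (intro sdb_sum)
      fix i assume i: "i \<in> {..<n}"
      show "sdb S K (B i * m) 1 (\<lambda>x. coeff p i * x ^ i)"
        using i m B0[of i] by (intro sdb_mono[OF sdb_cmult[OF B]]) (auto simp: mult.commute[of m] mult.commute[of _ "B i"] intro!: mult_left_mono)
    qed auto
    then have "sdb S K (\<Sum>i<n. B i * m) 1 (poly p)"
      by (rule sdb_cong) (use poly_polys_below[OF p] in simp)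
    then show "sdb S K ((\<Sum>i<n. B i) * m) 1 (poly p)" by (simp add: sum_distrib_right)
  qed (use B0 in \<open>auto intro: sum_nonneg\<close>)
qed

lemma sdb_poly:
  assumes "bounded S"
  shows "\<exists>M\<ge>0. sdb S K M 1 (poly p)"
proof -
  define m where "m = (\<Sum>i\<le>degree p. \<bar>coeff p i\<bar>)"
  have "\<bar>coeff p i\<bar> \<le> m" if "i < Suc (degree p)" for i
    unfolding m_def using that by (intro member_le_sum[of i _ "\<lambda>i. \<bar>coeff p i\<bar>"]) auto
  moreover have "0 \<le> m" by (auto simp: m_def sum_nonneg)
  moreover obtain B where "0 \<le> B"
    "\<forall>q\<in>polys_below (Suc (degree p)). \<forall>m. (\<forall>i<Suc (degree p). \<bar>coeff q i\<bar> \<le> m) \<longrightarrow> 0 \<le> m \<longrightarrow> sdb S K (B * m) 1 (poly q)"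
    using sdb_poly_coeffs[OF assms] by blast
  moreover have "p \<in> polys_below (Suc (degree p))" by (simp add: polys_below_degree)
  ultimately show ?thesis by (intro exI[of _ "B * m"]) auto
qed

section \<open>The reference element\<close>

text \<open>The supremum may be infinite and then is not attained, but every finite \<open>m\<close>
  below it is reached: some member exceeds \<open>m - 1\<close>, and downward closure does the rest.
  The value -1, hidden in the shift by one, has to be supplied as the assumption
  \<open>P (- 1)\<close>.\<close>

lemma ord1_attained:
  assumes "enat m \<le> ord1 P" "P (- 1)" "\<And>s s'. s \<le> s' \<Longrightarrow> P s' \<Longrightarrow> P s"
  shows "P (int m - 1)"
proof (cases m)
  case (Suc n)
  have "enat n < enat m" using Suc by simp
  also note assms(1)
  finally have "\<exists>x\<in>{enat m | m. P (int m - 1)}. enat n < x"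
    unfolding ord1_def less_Sup_iff .
  then obtain m' where "P (int m' - 1)" "n < m'" by auto
  then show ?thesis using assms(3)[of "int m - 1" "int m' - 1"] Suc by auto
qed (use assms(2) in simp)

lemma polys_deg_mono: "s \<le> s' \<Longrightarrow> p \<in> polys_deg s \<Longrightarrow> p \<in> polys_deg s'"
  by (auto simp: polys_deg_def split: if_splits)

text \<open>Leibniz rule for a linear factor, whose second derivative vanishes. At \<open>a\<close>
  only the last term survives, so vanishing derivatives of the product pass to \<open>q\<close> with
  the order lowered by one.\<close>

lemma higher_pderiv_linear_factor:
  "(pderiv ^^ Suc i) ([:- a, 1:] * q) = [:- a, 1:] * (pderiv ^^ Suc i) q + smult (of_nat (Suc i)) ((pderiv ^^ i) (q :: real poly))"
proof (induction i)
  case 0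
  show ?case by (simp add: pderiv_mult pderiv_pCons del: mult_pCons_left)
next
  case (Suc i)
  have "(pderiv ^^ Suc (Suc i)) ([:- a, 1:] * q) = pderiv ([:- a, 1:] * (pderiv ^^ Suc i) q + smult (of_nat (Suc i)) ((pderiv ^^ i) q))"
    using Suc by simp
  also have "\<dots> = [:- a, 1:] * (pderiv ^^ Suc (Suc i)) q + (pderiv ^^ Suc i) q + smult (of_nat (Suc i)) ((pderiv ^^ Suc i) q)"
    by (simp add: pderiv_add pderiv_mult pderiv_smult pderiv_pCons del: of_nat_Suc mult_pCons_left)
  also have "\<dots> = [:- a, 1:] * (pderiv ^^ Suc (Suc i)) q + smult (of_nat (Suc (Suc i))) ((pderiv ^^ Suc i) q)"
    by (simp only: of_nat_Suc smult_add_left smult_1_left ac_simps)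
  finally show ?case .
qed

lemma linear_factor_power_dvd:
  assumes "\<And>i. i < n \<Longrightarrow> poly ((pderiv ^^ i) p) a = 0"
  shows "[:- a, 1:] ^ n dvd (p :: real poly)"
  using assms
proof (induction n arbitrary: p)
  case (Suc n)
  have "poly p a = 0" using Suc.prems[of 0] by simp
  then obtain q where q: "p = [:- a, 1:] * q" using poly_eq_0_iff_dvd by blast
  have "poly ((pderiv ^^ i) q) a = 0" if "i < n" for i
  proof -
    have "poly ((pderiv ^^ Suc i) ([:- a, 1:] * q)) a = 0" using Suc.prems[of "Suc i"] that q by simp
    then show ?thesis unfolding higher_pderiv_linear_factor by (simp add: add_eq_0_iff)
  qed
  then have "[:- a, 1:] ^ n dvd q" using Suc.IH by blast
  then show ?case using q by (simp add: mult_dvd_mono del: mult_pCons_left)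
qed simp

lemma higher_pderiv_diff_smult:
  "(pderiv ^^ i) (p - smult c q) = (pderiv ^^ i) p - smult c ((pderiv ^^ i) (q :: real poly))"
  by (induction i) (auto simp: pderiv_diff pderiv_smult)

text \<open>A functional that vanishes on the common kernel of finitely many functionals is a linear
  combination of them; this yields bounds without any compactness argument.\<close>

lemma functional_combination:
  fixes f :: "real poly \<Rightarrow> real"
  assumes "finite A"
    and V: "\<And>p q a. p \<in> V \<Longrightarrow> q \<in> V \<Longrightarrow> p + smult a q \<in> V"
    and A: "\<And>L p q a. L \<in> A \<Longrightarrow> p \<in> V \<Longrightarrow> q \<in> V \<Longrightarrow> L (p + smult a q) = L p + a * L q"
    and f: "\<And>p q a. p \<in> V \<Longrightarrow> q \<in> V \<Longrightarrow> f (p + smult a q) = f p + a * f q"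
    and ker: "\<And>p. p \<in> V \<Longrightarrow> \<forall>L\<in>A. L p = 0 \<Longrightarrow> f p = 0"
  shows "\<exists>c. \<forall>p\<in>V. f p = (\<Sum>L\<in>A. c L * L p)"
  using assms(1) A f ker
proof (induction A arbitrary: f rule: finite_induct)
  case (insert L A)
  show ?case
  proof (cases "\<forall>p\<in>V. (\<forall>K\<in>A. K p = 0) \<longrightarrow> L p = 0")
    \<comment> \<open>\<open>L\<close> vanishes on the common kernel of \<open>A\<close>, so the
      combination for \<open>A\<close> alone serves, with coefficient 0 at \<open>L\<close>.\<close>
    case True
    have "\<exists>c. \<forall>p\<in>V. f p = (\<Sum>L\<in>A. c L * L p)"
      by (rule insert.IH) (use insert.prems True in auto)
    then obtain c where c: "\<forall>p\<in>V. f p = (\<Sum>L\<in>A. c L * L p)" by blast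
    have e: "(\<Sum>K\<in>A. (c(L := 0)) K * K p) = (\<Sum>K\<in>A. c K * K p)" for p
      using insert.hyps by (intro sum.cong) auto
    show ?thesis
      by (intro exI[of _ "c(L := 0)"]) (use insert.hyps c e in simp)
  next
    case False
    then obtain x where x: "x \<in> V" "\<forall>K\<in>A. K x = 0" "L x \<noteq> 0" by auto
    \<comment> \<open>\<open>x\<close> lies in the kernel of \<open>A\<close> but not of
      \<open>L\<close>. The coefficient \<open>b\<close> makes \<open>f - b L\<close> vanish at
      \<open>x\<close>; it then vanishes on the kernel of \<open>A\<close>, since
      \<open>p - (L p / L x) x\<close> is also killed by \<open>L\<close>.\<close>
    define b where "b = f x / L x"
    define g where "g p = f p - b * L p" for p
    have "\<exists>c. \<forall>p\<in>V. g p = (\<Sum>L\<in>A. c L * L p)"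
    proof (rule insert.IH)
      show "g (p + smult a q) = g p + a * g q" if "p \<in> V" "q \<in> V" for p q a
        using insert.prems(1)[of L p q a] insert.prems(2)[of p q a] that by (simp add: g_def algebra_simps)
      show "g p = 0" if p: "p \<in> V" "\<forall>K\<in>A. K p = 0" for p
      proof -
        let ?y = "p + smult (- (L p / L x)) x"
        have yV: "?y \<in> V" using V p(1) x(1) by blast
        have lin: "K ?y = K p + - (L p / L x) * K x" if "K \<in> insert L A" for K
          by (rule insert.prems(1)[OF that p(1) x(1)])
        have "L ?y = 0" using lin[of L] x(3) by simp
        moreover have "K ?y = 0" if "K \<in> A" for K
        proof -
          have "K p = 0" "K x = 0" using that p(2) x(2) by auto
          then show ?thesis using lin[of K] that by simp
        qed
        ultimately have "f ?y = 0" by (intro insert.prems(3)[OF yV]) blast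
        moreover have "f ?y = f p + - (L p / L x) * f x" by (rule insert.prems(2)[OF p(1) x(1)])
        ultimately show ?thesis by (simp add: g_def b_def mult.commute)
      qed
    qed (use insert.prems in auto)
    then obtain c where c: "\<forall>p\<in>V. g p = (\<Sum>L\<in>A. c L * L p)" by blast
    have e: "(\<Sum>K\<in>A. (c(L := b)) K * K p) = (\<Sum>K\<in>A. c K * K p)" for p
      using insert.hyps by (intro sum.cong) auto
    show ?thesis
    proof (intro exI[of _ "c(L := b)"] ballI)
      fix p assume "p \<in> V"
      then have "f p = b * L p + (\<Sum>K\<in>A. c K * K p)" using c by (simp add: g_def algebra_simps)
      then show "f p = (\<Sum>K\<in>insert L A. (c(L := b)) K * K p)" using insert.hyps e by simp
    qed
  qed
qed auto

text \<open>\<open>[:1, 1:]\<close> is \<open>x + 1\<close>, so this has the form of a Taylor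
  polynomial at the left end point -1.\<close>

definition shifted_poly :: "nat \<Rightarrow> (nat \<Rightarrow> real) \<Rightarrow> real poly" where
  "shifted_poly n c = (\<Sum>j<n. smult (c j) ([:1, 1:] ^ j))"

lemma poly_shifted_poly: "poly (shifted_poly n c) x = (\<Sum>j<n. (x - (- 1)) ^ j *\<^sub>R c j)"
  by (simp add: shifted_poly_def poly_sum mult.commute add.commute)

lemma shifted_poly_below: "shifted_poly n c \<in> polys_below n"
proof -
  have "coeff ([:1, 1:] ^ j :: real poly) i = 0" if "j < n" "n \<le> i" for i j
    using that by (intro coeff_eq_0) (simp add: degree_linear_power[of 1 j, simplified])
  then show ?thesis by (auto simp: polys_below_def shifted_poly_def coeff_sum)
qed

lemma abs_integral_le:
  assumes "\<And>x. x \<in> {-1..1::real} \<Longrightarrow> \<bar>g x\<bar> \<le> B" "continuous_on {-1..1} g"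
  shows "\<bar>integral {-1..1} g\<bar> \<le> 2 * (B :: real)"
  using integral_bound[of "-1" 1 g B] assms by (simp add: mult.commute)

text \<open>Scalar form of the assumptions on functional and operator, with the bounds phrased by
  \<open>sdb\<close>. The order \<open>kF + kO\<close> dominates every \<open>max kO l\<close> with
  \<open>l \<le> kF\<close> that occurs in (A3).\<close>

locale reference_element =
  fixes J :: "(real \<Rightarrow> real) \<Rightarrow> real" and Op :: "(real \<Rightarrow> real) \<Rightarrow> real \<Rightarrow> real" and kF kO :: nat
    and CJ CO :: real
  assumes J_linear: "\<And>g h a b. Ck_on kF {-1..1} g \<Longrightarrow> Ck_on kF {-1..1} h \<Longrightarrow>
        J (\<lambda>x. a * g x + b * h x) = a * J g + b * J h"
    and Op_linear: "\<And>g h a b x. Ck_on kO {-1..1} g \<Longrightarrow> Ck_on kO {-1..1} h \<Longrightarrow> x \<in> {-1..1} \<Longrightarrow>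
        Op (\<lambda>x. a * g x + b * h x) x = a * Op g x + b * Op h x"
    and J_bound: "\<And>g M. sdb {-1..1} kF M 1 g \<Longrightarrow> \<bar>J g\<bar> \<le> CJ * M"
    and Op_bound: "\<And>g M. sdb {-1..1} (kF + kO) M 1 g \<Longrightarrow> sdb {-1..1} kF (CO * M) 1 (Op g)"
    and CJ0: "0 \<le> CJ" and CO0: "0 \<le> CO"
begin

abbreviation "S \<equiv> {-1..1::real}"

lemma sdb_S_nonneg: "sdb S K M h g \<Longrightarrow> 0 \<le> M"
  using sdb_norm[of S K M h g 0] order_trans[OF norm_ge_zero[of "g 0"]] by auto

definition regular :: "nat \<Rightarrow> (real \<Rightarrow> real) \<Rightarrow> bool" where
  "regular K g \<longleftrightarrow> (\<exists>M. sdb S K M 1 g)"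

lemma regularI: "sdb S K M h g \<Longrightarrow> 0 \<le> h \<Longrightarrow> h \<le> 1 \<Longrightarrow> regular K g"
  unfolding regular_def using sdb_mono[of S K M h g M 1] sdb_S_nonneg by blast

lemma regular_Ck: "regular K g \<Longrightarrow> Ck_on K S g"
  unfolding regular_def using sdb_Ck_on[of "-1" 1] by fastforce

lemma regular_le: "regular K g \<Longrightarrow> K' \<le> K \<Longrightarrow> regular K' g"
  unfolding regular_def using sdb_le_order by blast

lemma regular_add: "regular K g \<Longrightarrow> regular K h \<Longrightarrow> regular K (\<lambda>x. g x + h x)"
  unfolding regular_def using sdb_add by blast

lemma regular_diff: "regular K g \<Longrightarrow> regular K h \<Longrightarrow> regular K (\<lambda>x. g x - h x)"
  unfolding regular_def using sdb_diff by blast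

lemma regular_mult: "regular K g \<Longrightarrow> regular K h \<Longrightarrow> regular K (\<lambda>x. g x * h x)"
  unfolding regular_def using sdb_mult by blast

lemma regular_cmult: "regular K g \<Longrightarrow> regular K (\<lambda>x. c * g x)"
  unfolding regular_def using sdb_cmult by blast

lemma regular_poly: "regular K (poly p)"
  unfolding regular_def using sdb_poly[of S K p] by auto

lemma regular_const: "regular K (\<lambda>_. c)"
  using sdb_const[of c "\<bar>c\<bar>" 1 S K] unfolding regular_def by auto

lemma regular_Op: "regular (kF + kO) g \<Longrightarrow> regular kF (Op g)"
  unfolding regular_def using Op_bound by blast

lemmas regular_intros = regular_add regular_diff regular_mult regular_cmult regular_poly regular_const regular_Op

lemma J_add: "regular kF g \<Longrightarrow> regular kF h \<Longrightarrow> J (\<lambda>x. g x + h x) = J g + J h"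
  using J_linear[of g h 1 1] regular_Ck by simp

lemma J_diff: "regular kF g \<Longrightarrow> regular kF h \<Longrightarrow> J (\<lambda>x. g x - h x) = J g - J h"
  using J_linear[of g h 1 "-1"] regular_Ck by simp

lemma J_cmult: "regular kF g \<Longrightarrow> J (\<lambda>x. c * g x) = c * J g"
  using J_linear[of g g c 0] regular_Ck by simp

text \<open>\<open>J\<close> takes functions on the whole line. Its bound forces it to vanish on
  functions that are zero on \<open>S\<close>, so by linearity only the values on \<open>S\<close>
  matter.\<close>

lemma J_cong:
  assumes "regular kF g" "\<And>x. x \<in> S \<Longrightarrow> g x = g' x"
  shows "J g = J g'"
proof -
  have g': "regular kF g'" using assms sdb_cong unfolding regular_def by blast
  have "sdb S kF 0 1 (\<lambda>_. 0 :: real)" by (rule sdb_const) auto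
  then have "sdb S kF 0 1 (\<lambda>x. g x - g' x)" by (rule sdb_cong) (use assms(2) in simp)
  then have "J (\<lambda>x. g x - g' x) = 0" using J_bound by fastforce
  then show ?thesis using J_diff[OF assms(1) g'] by simp
qed

lemma J_zero: "J (\<lambda>_. 0) = 0"
  using J_cmult[OF regular_const, of 0 0] by simp

lemma J_sum:
  assumes "finite A" "\<And>i. i \<in> A \<Longrightarrow> regular kF (g i)"
  shows "J (\<lambda>x. \<Sum>i\<in>A. c i * g i x) = (\<Sum>i\<in>A. c i * J (g i)) \<and> regular kF (\<lambda>x. \<Sum>i\<in>A. c i * g i x)"
  using assms
proof (induction A rule: finite_induct)
  case empty
  then show ?case using J_zero regular_const[of kF 0] by simp
next
  case (insert i A)
  then show ?case
    by (simp add: J_add J_cmult regular_cmult regular_add)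
qed

lemma Op_diff:
  assumes "regular kO g" "regular kO h" "x \<in> S"
  shows "Op (\<lambda>x. g x - h x) x = Op g x - Op h x"
  using Op_linear[of g h x 1 "-1"] regular_Ck assms by simp

text \<open>\<open>r_Ii1\<close> is the order plus one, hence exactness for degrees strictly below
  \<open>m\<close>. The base case -1 concerns the zero polynomial, where linearity gives
  \<open>Op 0 = 0\<close> on \<open>S\<close>.\<close>

lemma order_defect_exact:
  assumes "enat m \<le> r_Ii1 J Op i" "p \<in> polys_below m" "q \<in> polys_below (Suc i)"
  shows "J (\<lambda>x. poly p x * poly q x) = J (\<lambda>x. Op (poly p) x * poly q x)"
proof -
  let ?P = "\<lambda>s. \<forall>p\<in>polys_deg s. \<forall>q\<in>polys_deg (int i).
      J (\<lambda>x. poly p x * poly q x) = J (\<lambda>x. Op (poly p) x * poly q x)"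
  have "?P (- 1)"
  proof (intro ballI)
    fix p q :: "real poly" assume "p \<in> polys_deg (- 1)"
    then have p: "poly p = (\<lambda>x. 0)" by (auto simp: polys_deg_def)
    have "Op (\<lambda>x. 0) x = 0" if "x \<in> S" for x
      using Op_diff[OF regular_poly[of kO 0] regular_poly[of kO 0] that] by simp
    then have "J (\<lambda>x. 0 * poly q x) = J (\<lambda>x. Op (\<lambda>x. 0) x * poly q x)"
      using regular_const[of kF 0] by (intro J_cong) auto
    then show "J (\<lambda>x. poly p x * poly q x) = J (\<lambda>x. Op (poly p) x * poly q x)"
      by (simp add: p)
  qed
  then have "?P (int m - 1)"
    by (intro ord1_attained[OF assms(1)[unfolded r_Ii1_def]]) (blast intro: polys_deg_mono)+
  then show ?thesis
    using assms(2,3) by (simp add: polys_below_polys_deg)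
qed

lemma order_quadrature_exact:
  assumes "enat m \<le> r_ex1 J" "p \<in> polys_below m"
  shows "integral S (poly p) = J (poly p)"
proof -
  let ?P = "\<lambda>s. \<forall>p\<in>polys_deg s. integral S (poly p) = J (poly p)"
  have p0: "poly 0 = (\<lambda>_. 0 :: real)" by auto
  have "?P (- 1)" using J_zero by (simp add: polys_deg_def p0)
  then have "?P (int m - 1)"
    by (intro ord1_attained[OF assms(1)[unfolded r_ex1_def]]) (blast intro: polys_deg_mono)+
  then show ?thesis
    using assms(2) by (simp add: polys_below_polys_deg)
qed

section \<open>Consistency estimates by Taylor expansion\<close>

lemma taylor_split:
  fixes g :: "real \<Rightarrow> real"
  assumes "sdb S (m + K) M h g" "0 \<le> h" "h \<le> 1"
  obtains c where "\<And>j. j < m \<Longrightarrow> \<bar>c j\<bar> \<le> M * h ^ j" "0 < m \<Longrightarrow> c 0 = g (- 1)"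
    "sdb S K (2 ^ m * M * h ^ m) 1 (\<lambda>x. g x - poly (shifted_poly m c) x)"
  using sdb_taylor[OF assms(1) _ _ assms(2,3)] by (auto simp: poly_shifted_poly)

text \<open>A Bramble-Hilbert argument: the defect vanishes on the Taylor polynomial of degree below
  \<open>m\<close>, and the remainder is O(h^m) in C^(kF + kO), where \<open>J\<close> and
  \<open>Op\<close> are bounded.\<close>

lemma defect_bound:
  assumes "enat m \<le> r_Ii1 J Op i" "q \<in> polys_below (Suc i)"
  shows "\<exists>C\<ge>0. \<forall>M h g. 0 \<le> h \<longrightarrow> h \<le> 1 \<longrightarrow> sdb S (m + (kF + kO)) M h g \<longrightarrow>
     \<bar>J (\<lambda>x. (g x - Op g x) * poly q x)\<bar> \<le> C * M * h ^ m"
proof -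
  obtain Mq where Mq: "Mq \<ge> 0" "sdb S kF Mq 1 (poly q)" using sdb_poly[of S kF q] by auto
  define C where "C = CJ * (2 ^ kF * ((1 + CO) * 2 ^ m * Mq))"
  show ?thesis
  proof (intro exI[of _ C] conjI allI impI)
    show "0 \<le> C" using CJ0 CO0 Mq(1) by (simp add: C_def)
    fix M h and g :: "real \<Rightarrow> real" assume h: "0 \<le> h" "h \<le> 1" and g: "sdb S (m + (kF + kO)) M h g"
    obtain c where rho: "sdb S (kF + kO) (2 ^ m * M * h ^ m) 1 (\<lambda>x. g x - poly (shifted_poly m c) x)"
      by (rule taylor_split[OF g h]) auto
    define P where "P = shifted_poly m c"
    define R where "R = (\<lambda>x. g x - poly P x)"
    define B where "B = 2 ^ m * M * h ^ m"
    have R: "sdb S (kF + kO) B 1 R" using rho by (simp add: R_def P_def B_def)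
    have rg: "regular (kF + kO) g" using regular_le[OF regularI[OF g h], of "kF + kO"] by simp
    then have rgF: "regular kF g" "regular kO g" by (auto intro: regular_le)
    have RF: "sdb S kF B 1 R" by (rule sdb_le_order[OF R]) simp
    have rR: "regular (kF + kO) R" "regular kF R" using R RF by (auto simp: regular_def)
    then have rR': "regular kF (Op R)" by (intro regular_Op)
    have "sdb S kF (2 ^ kF * ((B + CO * B) * Mq)) 1 (\<lambda>x. (R x - Op R x) * poly q x)"
      by (rule sdb_mult[OF sdb_diff[OF RF Op_bound[OF R]] Mq(2)])
    then have b: "\<bar>J (\<lambda>x. (R x - Op R x) * poly q x)\<bar> \<le> CJ * (2 ^ kF * ((B + CO * B) * Mq))"
      by (rule J_bound)
    have "J (\<lambda>x. (g x - Op g x) * poly q x) =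
        J (\<lambda>x. (R x - Op R x) * poly q x + (poly P x * poly q x - Op (poly P) x * poly q x))"
    proof (rule J_cong)
      show "regular kF (\<lambda>x. (g x - Op g x) * poly q x)"
        using rg rgF by (intro regular_intros)
      fix x assume "x \<in> S"
      then have e: "Op R x = Op g x - Op (poly P) x"
        unfolding R_def using rgF by (intro Op_diff regular_poly)
      have e': "R x = g x - poly P x" by (simp add: R_def)
      show "(g x - Op g x) * poly q x = (R x - Op R x) * poly q x + (poly P x * poly q x - Op (poly P) x * poly q x)"
        unfolding e e' by (simp add: algebra_simps)
    qed
    also have "\<dots> = J (\<lambda>x. (R x - Op R x) * poly q x) + J (\<lambda>x. poly P x * poly q x - Op (poly P) x * poly q x)"
      using rR rR' by (intro J_add regular_intros)
    also have "J (\<lambda>x. poly P x * poly q x - Op (poly P) x * poly q x) =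
        J (\<lambda>x. poly P x * poly q x) - J (\<lambda>x. Op (poly P) x * poly q x)"
      by (intro J_diff regular_intros)
    finally have "J (\<lambda>x. (g x - Op g x) * poly q x) = J (\<lambda>x. (R x - Op R x) * poly q x)"
      using order_defect_exact[OF assms(1) _ assms(2), of P] shifted_poly_below by (simp add: P_def)
    then show "\<bar>J (\<lambda>x. (g x - Op g x) * poly q x)\<bar> \<le> C * M * h ^ m"
      using b by (simp add: C_def B_def algebra_simps)
  qed
qed

text \<open>The same argument for integration; the 2 is the length of the reference interval,
  \<open>CJ\<close> the bound of \<open>J\<close>.\<close>

lemma quadrature_bound:
  assumes "enat m \<le> r_ex1 J" "0 \<le> h" "h \<le> 1" "sdb S (m + kF) M h g"
  shows "\<bar>integral S g - J g\<bar> \<le> (2 + CJ) * 2 ^ m * M * h ^ m"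
proof -
  obtain c where rho: "sdb S kF (2 ^ m * M * h ^ m) 1 (\<lambda>x. g x - poly (shifted_poly m c) x)"
    by (rule taylor_split[OF assms(4,2,3)]) auto
  define P where "P = shifted_poly m c"
  define R where "R = (\<lambda>x. g x - poly P x)"
  define B where "B = 2 ^ m * M * h ^ m"
  have R: "sdb S kF B 1 R" using rho by (simp add: R_def P_def B_def)
  have gc: "continuous_on S g" using assms(4) sdb_continuous by blast
  have pc: "continuous_on S (poly P)" by (intro continuous_intros)
  have "regular kF g" using regular_le[OF regularI[OF assms(4,2,3)]] by simp
  then have "J R = J g - J (poly P)" unfolding R_def by (intro J_diff regular_poly)
  moreover have "integral S R = integral S g - integral S (poly P)"
    unfolding R_def by (intro integral_diff integrable_continuous_interval gc pc)
  moreover have "integral S (poly P) = J (poly P)"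
    using order_quadrature_exact[OF assms(1)] shifted_poly_below by (simp add: P_def)
  moreover have "\<bar>integral S R\<bar> \<le> 2 * B"
    using sdb_norm[OF R] sdb_continuous[OF R] by (intro abs_integral_le) auto
  moreover have "\<bar>J R\<bar> \<le> CJ * B" by (rule J_bound[OF R])
  ultimately have "\<bar>integral S g - J g\<bar> \<le> 2 * B + CJ * B" by linarith
  then show ?thesis by (simp add: B_def algebra_simps)
qed

section \<open>Unisolvence of the local conditions\<close>

lemma J_poly_linear:
  "J (\<lambda>x. poly (p + smult a q) x * poly w x) = J (\<lambda>x. poly p x * poly w x) + a * J (\<lambda>x. poly q x * poly w x)"
proof -
  have "J (\<lambda>x. poly (p + smult a q) x * poly w x) = J (\<lambda>x. poly p x * poly w x + a * (poly q x * poly w x))"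
    by (simp add: algebra_simps)
  also have "\<dots> = J (\<lambda>x. poly p x * poly w x) + J (\<lambda>x. a * (poly q x * poly w x))"
    by (rule J_add) (intro regular_intros)+
  finally show ?thesis by (subst (asm) J_cmult) (intro regular_intros)+
qed

lemma J_mult_poly_zero:
  assumes "\<And>j. j < n \<Longrightarrow> J (\<lambda>x. poly W x * poly (w * monom 1 j) x) = 0" "\<phi> \<in> polys_below n"
  shows "J (\<lambda>x. poly W x * poly (w * \<phi>) x) = 0"
proof -
  have "poly W x * poly (w * \<phi>) x = (\<Sum>j<n. coeff \<phi> j * (poly W x * poly (w * monom 1 j) x))" for x
    unfolding poly_mult poly_polys_below[OF assms(2)] by (simp add: sum_distrib_left poly_monom mult_ac)
  moreover have "J (\<lambda>x. \<Sum>j<n. coeff \<phi> j * (poly W x * poly (w * monom 1 j) x)) =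
      (\<Sum>j<n. coeff \<phi> j * J (\<lambda>x. poly W x * poly (w * monom 1 j) x))"
    by (rule conjunct1[OF J_sum]) (auto intro!: regular_intros)
  ultimately show ?thesis using assms(1) by simp
qed

text \<open>For \<open>k = 0\<close> the factor \<open>x + 1\<close> makes the jump term at -1
  disappear. It is also the weight that (A1) prescribes, because the floor of -1/2 has absolute
  value 1.\<close>

definition test_weight :: "nat \<Rightarrow> real poly" where
  "test_weight k = (if k = 0 then [:1, 1:] else 1)"

text \<open>The dimension of the polynomial space of degree at most r - max(1,k) in (A1).\<close>

definition n_test :: "nat \<Rightarrow> nat \<Rightarrow> nat" where
  "n_test r k = Suc r - max 1 k"

text \<open>The end point conditions split off powers of \<open>x - 1\<close> and
  \<open>x + 1\<close>. The cofactor has degree below \<open>n_test r k\<close>, so it lies in the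
  space of (A1), and the conditions on \<open>J\<close> say that it is orthogonal to that space in
  the sense of (A1).\<close>

lemma unisolvent:
  assumes A1: "A1 J r k" and kr: "k \<le> r"
    and W: "W \<in> polys_below r"
    and W1: "\<And>i. i < k div 2 \<Longrightarrow> poly ((pderiv ^^ i) W) 1 = 0"
    and W2: "\<And>i. i < (k - 1) div 2 \<Longrightarrow> poly ((pderiv ^^ i) W) (- 1) = 0"
    and WJ: "\<And>j. j < n_test r k \<Longrightarrow> J (\<lambda>x. poly W x * poly (test_weight k * monom 1 j) x) = 0"
  shows "W = 0"
proof (rule ccontr)
  assume W0: "W \<noteq> 0"
  have deg: "degree W < r"
    using W W0 leading_coeff_0_iff[of W] by (auto simp: polys_below_def not_le[symmetric])
  have n: "int (n_test r k) - 1 = int r - int (max 1 k)"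
    using kr deg by (auto simp: n_test_def)
  define a b where "a = k div 2" and "b = (k - 1) div 2"
  have "[:- 1, 1:] ^ a dvd W" using W1 by (intro linear_factor_power_dvd) (auto simp: a_def)
  then obtain X where X: "W = [:- 1, 1:] ^ a * X" by (elim dvdE)
  have "[:- (- 1), 1:] ^ b dvd W" using W2 by (intro linear_factor_power_dvd) (auto simp: b_def)
  \<comment> \<open>The factors \<open>x - 1\<close> do not contribute to the multiplicity at -1, so
    the power of \<open>x + 1\<close> already divides the cofactor \<open>X\<close>.\<close>
  then have "b \<le> order (- 1) W" using W0 by (simp only: order_divides) simp
  also have "order (- 1) W = order (- 1) X"
    using W0 unfolding X by (simp add: order_mult order_0I)
  finally have "[:- (- 1), 1:] ^ b dvd X" by (simp only: order_divides) simp
  then obtain \<psi>0 where "X = [:1, 1:] ^ b * \<psi>0" by (auto elim!: dvdE)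
  then have \<psi>0: "W = [:- 1, 1:] ^ a * [:1, 1:] ^ b * \<psi>0" using X by (simp only: mult.assoc)
  \<comment> \<open>The sign turns \<open>(x - 1) ^ a\<close> into the weight
    \<open>(1 - x) ^ a\<close> of (A1).\<close>
  define \<psi> where "\<psi> = smult ((- 1) ^ a) \<psi>0"
  have \<psi>00: "\<psi>0 \<noteq> 0" using W0 \<psi>0 by auto
  have "degree W = a + b + degree \<psi>0"
    using \<psi>0 \<psi>00 by (simp add: degree_mult_eq degree_power_eq)
  \<comment> \<open>For \<open>k = 0\<close> truncated subtraction gives \<open>b = 0\<close>; the
    exponent 1 of \<open>1 + x\<close> in (A1) is then provided by
    \<open>test_weight\<close>.\<close>
  moreover have "a + b = (if k = 0 then 0 else k - 1)"
    unfolding a_def b_def by presburger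
  ultimately have "degree \<psi> < n_test r k"
    using deg by (auto simp: \<psi>_def n_test_def split: if_splits)
  then have \<psi>V: "\<psi> \<in> polys_below (n_test r k)" by (auto simp: polys_below_def coeff_eq_0)
  have pW: "(1 - x) ^ a * (1 + x) ^ b * poly \<psi> x = poly W x" for x
  proof -
    have "(1 - x) ^ a * (- 1) ^ a = (x - 1) ^ a" by (simp flip: power_mult_distrib)
    then have "(1 - x) ^ a * (1 + x) ^ b * ((- 1) ^ a * poly \<psi>0 x) = (x - 1) ^ a * (1 + x) ^ b * poly \<psi>0 x"
      by (metis mult.assoc mult.commute)
    then show ?thesis by (simp add: \<psi>_def \<psi>0)
  qed
  have e: "(1 - x) ^ (k div 2) * (1 + x) ^ nat \<bar>(int k - 1) div 2\<bar> * poly \<psi> x * poly \<phi> x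
      = poly W x * poly (test_weight k * \<phi>) x" for x \<phi>
  proof (cases "k = 0")
    case True
    then show ?thesis using pW[of x] by (simp add: test_weight_def a_def b_def algebra_simps)
  next
    case False
    then obtain l where l: "k = Suc l" using not0_implies_Suc by blast
    have "int l div 2 = int (l div 2)" by (simp add: zdiv_int)
    then have "nat \<bar>(int k - 1) div 2\<bar> = b" by (simp add: b_def l)
    then show ?thesis using pW[of x] False by (simp add: test_weight_def a_def)
  qed
  have "\<psi> \<in> polys_deg (int r - int (max 1 k))"
    using \<psi>V unfolding polys_below_polys_deg n .
  moreover have "J (\<lambda>x. (1 - x) ^ (k div 2) * (1 + x) ^ nat \<bar>(int k - 1) div 2\<bar> * poly \<psi> x * poly \<phi> x) = 0"
    if "\<phi> \<in> polys_deg (int r - int (max 1 k))" for \<phi>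
    unfolding e using that by (intro J_mult_poly_zero[OF WJ]) (auto simp: polys_below_polys_deg n)
  ultimately have "\<psi> = 0" using A1 unfolding A1_def by blast
  then show False using \<psi>00 by (simp add: \<psi>_def)
qed

text \<open>By unisolvence each coefficient vanishes on the common kernel of the finitely many data
  functionals, hence is a fixed linear combination of them. The number \<open>m\<close> bounds all
  data at once.\<close>

lemma coeff_bound:
  assumes A1: "A1 J r k" and kr: "k \<le> r"
  shows "\<exists>C\<ge>0. \<forall>W\<in>polys_below r. \<forall>m.
    (\<forall>i < k div 2. \<bar>poly ((pderiv ^^ i) W) 1\<bar> \<le> m) \<longrightarrow>
    (\<forall>i < (k - 1) div 2. \<bar>poly ((pderiv ^^ i) W) (- 1)\<bar> \<le> m) \<longrightarrow>
    (\<forall>j < n_test r k. \<bar>J (\<lambda>x. poly W x * poly (test_weight k * monom 1 j) x)\<bar> \<le> m) \<longrightarrow> 0 \<le> m \<longrightarrow>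
    (\<forall>i<r. \<bar>coeff W i\<bar> \<le> C * m)"
proof -
  define A where "A = (\<lambda>i W. poly ((pderiv ^^ i) W) 1) ` {..<k div 2} \<union>
     (\<lambda>i W. poly ((pderiv ^^ i) W) (- 1)) ` {..<(k - 1) div 2} \<union>
     (\<lambda>j W. J (\<lambda>x. poly W x * poly (test_weight k * monom 1 j) x)) ` {..<n_test r k}"
  have fin: "finite A" by (simp add: A_def)
  have pd: "(pderiv ^^ i) (p + smult a q) = (pderiv ^^ i) p + smult a ((pderiv ^^ i) (q :: real poly))" for i p a q
    by (induction i) (auto simp: pderiv_add pderiv_smult)
  have "\<exists>c. \<forall>W\<in>polys_below r. coeff W i = (\<Sum>L\<in>A. c L * L W)" for i
  proof (rule functional_combination[OF fin])
    show "p + smult a q \<in> polys_below r" if "p \<in> polys_below r" "q \<in> polys_below r" for p q a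
      using that by (simp add: polys_below_def)
    show "L (p + smult a q) = L p + a * L q" if "L \<in> A" for L :: "real poly \<Rightarrow> real" and p q a
      using that J_poly_linear[of p a q] by (force simp: A_def pd simp del: poly_mult)
    show "coeff W i = 0" if W: "W \<in> polys_below r" "\<forall>L\<in>A. L W = 0" for W
    proof -
      have "W = 0" by (rule unisolvent[OF A1 kr W(1)]) (use W(2) in \<open>auto simp: A_def\<close>)
      then show ?thesis by simp
    qed
  qed auto
  then obtain c where c: "\<And>i W. W \<in> polys_below r \<Longrightarrow> coeff W i = (\<Sum>L\<in>A. c i L * L W)" by metis
  show ?thesis
  proof (intro exI[of _ "\<Sum>i<r. \<Sum>L\<in>A. \<bar>c i L\<bar>"] conjI ballI allI impI)
    show "0 \<le> (\<Sum>i<r. \<Sum>L\<in>A. \<bar>c i L\<bar>)" by (intro sum_nonneg) auto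
    fix W m i assume W: "W \<in> polys_below r"
      and m: "\<forall>i < k div 2. \<bar>poly ((pderiv ^^ i) W) 1\<bar> \<le> m"
        "\<forall>i < (k - 1) div 2. \<bar>poly ((pderiv ^^ i) W) (- 1)\<bar> \<le> m"
        "\<forall>j < n_test r k. \<bar>J (\<lambda>x. poly W x * poly (test_weight k * monom 1 j) x)\<bar> \<le> m" "0 \<le> m" and i: "i < r"
    have L: "\<bar>L W\<bar> \<le> m" if "L \<in> A" for L using that m by (auto simp: A_def)
    have "\<bar>coeff W i\<bar> \<le> (\<Sum>L\<in>A. \<bar>c i L\<bar> * m)"
      unfolding c[OF W] using L by (intro order_trans[OF sum_abs] sum_mono) (auto simp: abs_mult intro: mult_left_mono)
    also have "\<dots> = (\<Sum>L\<in>A. \<bar>c i L\<bar>) * m" by (simp add: sum_distrib_right)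
    also have "\<dots> \<le> (\<Sum>i<r. \<Sum>L\<in>A. \<bar>c i L\<bar>) * m"
      using i m(4) by (intro mult_right_mono member_le_sum[of i _ "\<lambda>i. \<Sum>L\<in>A. \<bar>c i L\<bar>"]) (auto intro: sum_nonneg)
    finally show "\<bar>coeff W i\<bar> \<le> (\<Sum>i<r. \<Sum>L\<in>A. \<bar>c i L\<bar>) * m" .
  qed
qed

section \<open>Residual and local error on the reference element\<close>

text \<open>The method on one mesh interval, for one component and transported to the reference element:
  \<open>v\<close> is the discrete solution, \<open>G\<close> the right-hand side, \<open>h\<close> half the step size and \<open>y\<close> the jump.\<close>

definition local_method :: "nat \<Rightarrow> nat \<Rightarrow> real \<Rightarrow> real poly \<Rightarrow> (real \<Rightarrow> real) \<Rightarrow> real \<Rightarrow> bool" where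
  "local_method r k h v G y \<longleftrightarrow> degree v \<le> r \<and>
     (\<forall>q. degree q \<le> r - k \<longrightarrow>
        J (\<lambda>x. poly (pderiv v) x * poly q x) + (if k = 0 then y * poly q (- 1) else 0)
          = h * J (\<lambda>x. Op G x * poly q x)) \<and>
     (\<forall>i < k div 2. poly ((pderiv ^^ Suc i) v) 1 = h * vder S i G 1) \<and>
     (\<forall>i < (k - 1) div 2. poly ((pderiv ^^ Suc i) v) (- 1) = h * vder S i G (- 1))"

text \<open>Let \<open>P\<close> be the Taylor polynomial of \<open>G\<close> of degree below
  \<open>r\<close>, \<open>R = G - P\<close> and \<open>W = v' - h P\<close>. The method expresses
  the data of \<open>W\<close> by small quantities: end point derivatives are \<open>h\<close> times
  those of \<open>R\<close>, and the tested values are h (J(R q) - J((G - Op G) q)). So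
  \<open>W\<close> is O(h h^\<mu>) by \<open>coeff_bound\<close>, and the residual is
  \<open>W - h R\<close>. Derivative bounds are asked of \<open>G\<close> only.\<close>

lemma residual_bound:
  assumes A1: "A1 J r k" and kr: "k \<le> r" and \<mu>: "\<mu> \<le> r" "enat \<mu> \<le> r_Ii1 J Op (r - k)"
  shows "\<exists>C\<ge>0. \<forall>M h v G y. 0 \<le> h \<longrightarrow> h \<le> 1 \<longrightarrow> sdb S (r + (K + k + kF + kO)) M h G \<longrightarrow>
      local_method r k h v G y \<longrightarrow>
      sdb S K (C * M * h * h ^ \<mu>) 1 (\<lambda>x. poly (pderiv v) x - h * G x)"
proof -
  define K' where "K' = K + k + kF + kO"
  obtain Cw where Cw: "Cw \<ge> 0" "\<forall>W\<in>polys_below r. \<forall>m.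
    (\<forall>i < k div 2. \<bar>poly ((pderiv ^^ i) W) 1\<bar> \<le> m) \<longrightarrow>
    (\<forall>i < (k - 1) div 2. \<bar>poly ((pderiv ^^ i) W) (- 1)\<bar> \<le> m) \<longrightarrow>
    (\<forall>j < n_test r k. \<bar>J (\<lambda>x. poly W x * poly (test_weight k * monom 1 j) x)\<bar> \<le> m) \<longrightarrow> 0 \<le> m \<longrightarrow>
    (\<forall>i<r. \<bar>coeff W i\<bar> \<le> Cw * m)"
    using coeff_bound[OF A1 kr] by blast
  obtain Bp where Bp: "Bp \<ge> 0"
    "\<forall>p\<in>polys_below r. \<forall>m. (\<forall>i<r. \<bar>coeff p i\<bar> \<le> m) \<longrightarrow> 0 \<le> m \<longrightarrow> sdb S K (Bp * m) 1 (poly p)"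
    using sdb_poly_coeffs[of S r K] by auto
  define q where "q j = test_weight k * monom 1 j" for j
  have q: "q j \<in> polys_below (Suc (r - k))" if "j < n_test r k" for j
  proof -
    have "degree (q j) \<le> (if k = 0 then 1 else 0) + j"
      unfolding q_def by (rule order_trans[OF degree_mult_le]) (auto simp: test_weight_def degree_monom_eq)
    then show ?thesis using that kr by (auto simp: n_test_def polys_below_degree split: if_splits)
  qed
  have "\<forall>j. \<exists>C\<ge>0. j < n_test r k \<longrightarrow> (\<forall>M h g. 0 \<le> h \<longrightarrow> h \<le> 1 \<longrightarrow> sdb S (\<mu> + (kF + kO)) M h g \<longrightarrow>
     \<bar>J (\<lambda>x. (g x - Op g x) * poly (q j) x)\<bar> \<le> C * M * h ^ \<mu>)"
  proof
    fix j
    show "\<exists>C\<ge>0. j < n_test r k \<longrightarrow> (\<forall>M h g. 0 \<le> h \<longrightarrow> h \<le> 1 \<longrightarrow> sdb S (\<mu> + (kF + kO)) M h g \<longrightarrow>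
     \<bar>J (\<lambda>x. (g x - Op g x) * poly (q j) x)\<bar> \<le> C * M * h ^ \<mu>)"
      using defect_bound[OF \<mu>(2) q, of j] by (cases "j < n_test r k") auto
  qed
  from choice[OF this] obtain Cd where Cd0: "\<And>j. 0 \<le> Cd j"
    and Cd: "\<And>j M h g. j < n_test r k \<Longrightarrow> 0 \<le> h \<Longrightarrow> h \<le> 1 \<Longrightarrow> sdb S (\<mu> + (kF + kO)) M h g \<Longrightarrow>
     \<bar>J (\<lambda>x. (g x - Op g x) * poly (q j) x)\<bar> \<le> Cd j * M * h ^ \<mu>" by blast
  have "\<forall>j. \<exists>M\<ge>0. sdb S kF M 1 (poly (q j))" by (intro allI sdb_poly) simp
  from choice[OF this] obtain Mq where Mq: "\<And>j. 0 \<le> Mq j" "\<And>j. sdb S kF (Mq j) 1 (poly (q j))"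
    by blast
  \<comment> \<open>A sum in place of a maximum: one constant for all test functions, with
    \<open>2 ^ r\<close> for the end point data.\<close>
  define Cm where "Cm = 2 ^ r + (\<Sum>j<n_test r k. Cd j + CJ * (2 ^ kF * (2 ^ r * Mq j)))"
  have sm0: "0 \<le> (\<Sum>j<n_test r k. Cd j + CJ * (2 ^ kF * (2 ^ r * Mq j)))"
    using Cd0 CJ0 Mq(1) by (intro sum_nonneg) auto
  then have Cm0: "0 \<le> Cm" by (simp add: Cm_def)
  have Cm1: "Cd j + CJ * (2 ^ kF * (2 ^ r * Mq j)) \<le> Cm" if "j < n_test r k" for j
  proof -
    have "Cd j + CJ * (2 ^ kF * (2 ^ r * Mq j)) \<le> (\<Sum>j<n_test r k. Cd j + CJ * (2 ^ kF * (2 ^ r * Mq j)))"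
      using that Cd0 CJ0 Mq(1) by (intro member_le_sum[of j _ "\<lambda>j. Cd j + CJ * (2 ^ kF * (2 ^ r * Mq j))"]) auto
    also have "\<dots> \<le> Cm" unfolding Cm_def by simp
    finally show ?thesis .
  qed
  show ?thesis
  proof (intro exI[of _ "Bp * (Cw * Cm) + 2 ^ r"] conjI allI impI)
    show "0 \<le> Bp * (Cw * Cm) + 2 ^ r" using Bp(1) Cw(1) Cm0 by simp
    fix M h v G y
    assume h: "0 \<le> h" "h \<le> 1" and G: "sdb S (r + (K + k + kF + kO)) M h G" and lm: "local_method r k h v G y"
    have M0: "0 \<le> M" using sdb_S_nonneg[OF G] .
    obtain c where rho: "sdb S K' (2 ^ r * M * h ^ r) 1 (\<lambda>x. G x - poly (shifted_poly r c) x)"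
      by (rule taylor_split[OF G[folded K'_def] h]) auto
    define P where "P = shifted_poly r c"
    define R where "R = (\<lambda>x. G x - poly P x)"
    define B where "B = 2 ^ r * M * h ^ r"
    define W where "W = pderiv v - smult h P"
    define m where "m = h * (Cm * M * h ^ \<mu>)"
    have R: "sdb S K' B 1 R" using rho by (simp add: R_def P_def B_def)
    have B0: "0 \<le> B" using M0 h by (simp add: B_def)
    have hr: "h ^ r \<le> h ^ \<mu>" using h \<mu>(1) by (intro power_decreasing)
    have Bm: "B \<le> 2 ^ r * M * h ^ \<mu>" unfolding B_def using hr M0 by (intro mult_left_mono) auto
    have m0: "0 \<le> m" using h M0 Cm0 by (simp add: m_def)
    have Bm2: "h * B \<le> m"
    proof -
      have "2 ^ r * M * h ^ \<mu> \<le> Cm * M * h ^ \<mu>" using sm0 M0 h by (intro mult_right_mono) (auto simp: Cm_def)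
      then show ?thesis unfolding m_def using Bm h by (intro mult_left_mono) auto
    qed
    have Gk: "sdb S k M h G" "sdb S (\<mu> + (kF + kO)) M h G"
      by (rule sdb_le_order[OF G]; use \<mu>(1) in simp)+
    have rG: "regular (kF + kO) G" by (rule regular_le[OF regularI[OF G h]]) simp
    then have rGF: "regular kF G" by (rule regular_le) simp
    have RF: "sdb S kF B 1 R" by (rule sdb_le_order[OF R]) (simp add: K'_def)
    then have rR: "regular kF R" by (auto simp: regular_def)
    have "coeff (pderiv v) i = 0" if "r \<le> i" for i
      using lm that by (simp add: coeff_pderiv local_method_def coeff_eq_0)
    then have W: "W \<in> polys_below r"
      using shifted_poly_below[of r c] by (auto simp: W_def P_def polys_below_def)
    have endp: "\<bar>poly ((pderiv ^^ i) W) t\<bar> \<le> m"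
      if t: "t \<in> S" and e: "poly ((pderiv ^^ Suc i) v) t = h * vder S i G t" and i: "i \<le> k" for i t
    proof -
      have "poly ((pderiv ^^ i) W) t = h * vder S i G t - h * vder S i (poly P) t"
        using e t unfolding W_def higher_pderiv_diff_smult by (simp add: vder_poly funpow_swap1)
      also have "\<dots> = h * vder S i R t"
      proof -
        obtain Mp where "sdb S k Mp 1 (poly P)" using sdb_poly[of S k P] by auto
        from vder_diff[OF Gk(1) this _ i t] have "vder S i R t = vder S i G t - vder S i (poly P) t"
          by (simp add: R_def)
        then show ?thesis by (simp add: right_diff_distrib)
      qed
      finally have "\<bar>poly ((pderiv ^^ i) W) t\<bar> = h * \<bar>vder S i R t\<bar>" using h by (simp add: abs_mult)
      also have "\<dots> \<le> h * B"
        using sdb_vder_bound[OF R _ _ t, of i] i h by (intro mult_left_mono) (auto simp: K'_def)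
      finally show ?thesis using Bm2 by simp
    qed
    have WJ: "\<bar>J (\<lambda>x. poly W x * poly (q j) x)\<bar> \<le> m" if j: "j < n_test r k" for j
    proof -
      have "degree (q j) \<le> r - k" using q[OF j] by (simp add: polys_below_degree)
      with lm have "J (\<lambda>x. poly (pderiv v) x * poly (q j) x) + (if k = 0 then y * poly (q j) (- 1) else 0)
          = h * J (\<lambda>x. Op G x * poly (q j) x)" unfolding local_method_def by blast
      moreover have "k = 0 \<Longrightarrow> poly (q j) (- 1) = 0" by (simp add: q_def test_weight_def)
      ultimately have e1: "J (\<lambda>x. poly (pderiv v) x * poly (q j) x) = h * J (\<lambda>x. Op G x * poly (q j) x)"
        by (simp split: if_splits)
      have "J (\<lambda>x. poly W x * poly (q j) x) = J (\<lambda>x. poly (pderiv v) x * poly (q j) x - h * (poly P x * poly (q j) x))"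
        by (simp add: W_def algebra_simps)
      also have "\<dots> = J (\<lambda>x. poly (pderiv v) x * poly (q j) x) - h * J (\<lambda>x. poly P x * poly (q j) x)"
        by (subst J_diff, (intro regular_intros)+, subst J_cmult, (intro regular_intros)+) simp
      also have "\<dots> = h * (J (\<lambda>x. Op G x * poly (q j) x) - J (\<lambda>x. poly P x * poly (q j) x))"
        using e1 by (simp add: algebra_simps)
      also have "J (\<lambda>x. Op G x * poly (q j) x) - J (\<lambda>x. poly P x * poly (q j) x)
          = J (\<lambda>x. R x * poly (q j) x) - J (\<lambda>x. (G x - Op G x) * poly (q j) x)"
      proof -
        have "J (\<lambda>x. Op G x * poly (q j) x) - J (\<lambda>x. poly P x * poly (q j) x) =
            J (\<lambda>x. Op G x * poly (q j) x - poly P x * poly (q j) x)"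
          using rG by (intro J_diff[symmetric] regular_intros)
        also have "\<dots> = J (\<lambda>x. R x * poly (q j) x - (G x - Op G x) * poly (q j) x)"
          by (simp add: R_def algebra_simps)
        also have "\<dots> = J (\<lambda>x. R x * poly (q j) x) - J (\<lambda>x. (G x - Op G x) * poly (q j) x)"
          using rG rGF rR by (intro J_diff regular_intros)
        finally show ?thesis .
      qed
      finally have eq: "J (\<lambda>x. poly W x * poly (q j) x) = h * (J (\<lambda>x. R x * poly (q j) x) - J (\<lambda>x. (G x - Op G x) * poly (q j) x))" .
      have "\<bar>J (\<lambda>x. R x * poly (q j) x)\<bar> \<le> CJ * (2 ^ kF * (B * Mq j))"
        by (rule J_bound[OF sdb_mult[OF RF Mq(2)]])
      also have "\<dots> \<le> CJ * (2 ^ kF * ((2 ^ r * M * h ^ \<mu>) * Mq j))"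
        using Bm CJ0 Mq(1)[of j] by (intro mult_left_mono mult_right_mono) auto
      finally have "\<bar>J (\<lambda>x. R x * poly (q j) x) - J (\<lambda>x. (G x - Op G x) * poly (q j) x)\<bar>
          \<le> CJ * (2 ^ kF * ((2 ^ r * M * h ^ \<mu>) * Mq j)) + Cd j * M * h ^ \<mu>"
        using Cd[OF j h Gk(2)] by linarith
      also have "\<dots> = (Cd j + CJ * (2 ^ kF * (2 ^ r * Mq j))) * (M * h ^ \<mu>)"
        by (simp add: algebra_simps)
      also have "\<dots> \<le> Cm * (M * h ^ \<mu>)" using Cm1[OF j] M0 h by (intro mult_right_mono) auto
      finally show ?thesis unfolding eq m_def using h by (auto simp: abs_mult mult.assoc intro!: mult_left_mono)
    qed
    have "\<forall>i<r. \<bar>coeff W i\<bar> \<le> Cw * m"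
    proof (intro allI impI)
      show "\<bar>coeff W i\<bar> \<le> Cw * m" if "i < r" for i
        using Cw(2) W m0 WJ endp lm that unfolding q_def local_method_def by simp
    qed
    then have sW: "sdb S K (Bp * (Cw * m)) 1 (poly W)"
      using Bp(2) W Cw(1) m0 by simp
    have "sdb S K B 1 R" by (rule sdb_le_order[OF R]) (simp add: K'_def)
    from sdb_diff[OF sW sdb_cmult[OF this, of h]]
    have "sdb S K (Bp * (Cw * m) + h * B) 1 (\<lambda>x. poly W x - h * R x)" using h by simp
    then have "sdb S K (Bp * (Cw * m) + h * B) 1 (\<lambda>x. poly (pderiv v) x - h * G x)"
      by (rule sdb_cong) (simp add: W_def R_def algebra_simps)
    then show "sdb S K ((Bp * (Cw * Cm) + 2 ^ r) * M * h * h ^ \<mu>) 1 (\<lambda>x. poly (pderiv v) x - h * G x)"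
    proof (rule sdb_mono)
      have "h * B \<le> h * (2 ^ r * M * h ^ \<mu>)" using Bm h by (intro mult_left_mono)
      then show "Bp * (Cw * m) + h * B \<le> (Bp * (Cw * Cm) + 2 ^ r) * M * h * h ^ \<mu>"
        by (simp add: m_def algebra_simps)
      show "0 \<le> (Bp * (Cw * Cm) + 2 ^ r) * M * h * h ^ \<mu>"
        using Bp(1) Cw(1) Cm0 M0 h by simp
    qed auto
  qed
qed

lemma sdb_poly_pderiv: "sdb S (Suc K) M h (poly v) \<Longrightarrow> sdb S K (M * h) h (poly (pderiv v))"
  by (rule sdb_derivative)
    (auto simp flip: has_real_derivative_iff_has_vector_derivative intro: DERIV_subset[OF poly_DERIV])

text \<open>The Taylor polynomial of the adjoint solution is an admissible test function, so the
  method turns the tested residual, jump included, into -h J((G - Op G) phi). In the expansion of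
  phi, c_j = O(h^j) multiplies a defect for test degree j, which is O(h^(p-j)). This is the origin
  of the minimum in \<open>r_var1\<close>.\<close>

lemma consistency_term:
  assumes kr: "k \<le> r" and p: "\<And>j. j \<le> r - k \<Longrightarrow> enat p \<le> r_Ii1 J Op j + enat j"
  shows "\<exists>C\<ge>0. \<forall>M h v G y c. 0 \<le> h \<longrightarrow> h \<le> 1 \<longrightarrow> 0 \<le> M \<longrightarrow> sdb S (p + (kF + kO)) M h G \<longrightarrow>
      local_method r k h v G y \<longrightarrow> (\<forall>j < Suc (r - k). \<bar>c j\<bar> \<le> M * h ^ j) \<longrightarrow>
      \<bar>J (\<lambda>x. (poly (pderiv v) x - h * G x) * poly (shifted_poly (Suc (r - k)) c) x)
        + (if k = 0 then y * c 0 else 0)\<bar> \<le> C * M\<^sup>2 * h * h ^ p"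
proof -
  let ?n = "Suc (r - k)"
  define q where "q j = ([:1, 1:] :: real poly) ^ j" for j
  have q: "q j \<in> polys_below (Suc j)" for j
    using degree_linear_power[of "1::real" j] by (simp add: q_def polys_below_degree)
  have "\<forall>j. \<exists>C\<ge>0. j < ?n \<longrightarrow> (\<forall>M h g. 0 \<le> h \<longrightarrow> h \<le> 1 \<longrightarrow> sdb S ((p - j) + (kF + kO)) M h g \<longrightarrow>
     \<bar>J (\<lambda>x. (g x - Op g x) * poly (q j) x)\<bar> \<le> C * M * h ^ (p - j))"
  proof
    fix j
    have "enat (p - j) \<le> r_Ii1 J Op j" if "j < ?n"
      using p[of j] that by (cases "r_Ii1 J Op j") auto
    then show "\<exists>C\<ge>0. j < ?n \<longrightarrow> (\<forall>M h g. 0 \<le> h \<longrightarrow> h \<le> 1 \<longrightarrow> sdb S ((p - j) + (kF + kO)) M h g \<longrightarrow>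
        \<bar>J (\<lambda>x. (g x - Op g x) * poly (q j) x)\<bar> \<le> C * M * h ^ (p - j))"
      using defect_bound[OF _ q, of "p - j" j] by (cases "j < ?n") auto
  qed
  from choice[OF this] obtain Cd where Cd0: "\<And>j. 0 \<le> Cd j"
    and Cd: "\<And>j M h g. j < ?n \<Longrightarrow> 0 \<le> h \<Longrightarrow> h \<le> 1 \<Longrightarrow> sdb S ((p - j) + (kF + kO)) M h g \<Longrightarrow>
     \<bar>J (\<lambda>x. (g x - Op g x) * poly (q j) x)\<bar> \<le> Cd j * M * h ^ (p - j)" by blast
  show ?thesis
  proof (intro exI[of _ "\<Sum>j<?n. Cd j"] conjI allI impI)
    show "0 \<le> (\<Sum>j<?n. Cd j)" using Cd0 by (intro sum_nonneg) auto
    fix M h v y c and G :: "real \<Rightarrow> real"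
    assume h: "0 \<le> h" "h \<le> 1" and M0: "0 \<le> M" and G: "sdb S (p + (kF + kO)) M h G"
      and lm: "local_method r k h v G y" and c: "\<forall>j < ?n. \<bar>c j\<bar> \<le> M * h ^ j"
    have rG: "regular (kF + kO) G" by (rule regular_le[OF regularI[OF G h]]) simp
    then have rGF: "regular kF G" by (rule regular_le) simp
    define \<phi> where "\<phi> = shifted_poly ?n c"
    define D where "D = J (\<lambda>x. (G x - Op G x) * poly \<phi> x)"
    have \<phi>1: "poly \<phi> (- 1) = c 0"
      by (simp add: \<phi>_def poly_shifted_poly sum.lessThan_Suc_shift del: sum.lessThan_Suc)
    have "degree \<phi> \<le> r - k" using shifted_poly_below[of ?n c] by (simp add: \<phi>_def polys_below_degree)
    then have e1: "J (\<lambda>x. poly (pderiv v) x * poly \<phi> x) + (if k = 0 then y * c 0 else 0) = h * J (\<lambda>x. Op G x * poly \<phi> x)"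
      using lm unfolding local_method_def \<phi>1[symmetric] by blast
    have "J (\<lambda>x. (poly (pderiv v) x - h * G x) * poly \<phi> x) = J (\<lambda>x. poly (pderiv v) x * poly \<phi> x - h * (G x * poly \<phi> x))"
      by (simp add: algebra_simps)
    also have "\<dots> = J (\<lambda>x. poly (pderiv v) x * poly \<phi> x) - J (\<lambda>x. h * (G x * poly \<phi> x))"
      using rGF by (intro J_diff regular_intros)
    also have "J (\<lambda>x. h * (G x * poly \<phi> x)) = h * J (\<lambda>x. G x * poly \<phi> x)"
      using rGF by (intro J_cmult regular_intros)
    finally have e2: "J (\<lambda>x. (poly (pderiv v) x - h * G x) * poly \<phi> x) + (if k = 0 then y * c 0 else 0)
        = h * (J (\<lambda>x. Op G x * poly \<phi> x) - J (\<lambda>x. G x * poly \<phi> x))"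
      using e1 by (simp add: right_diff_distrib)
    have "D = J (\<lambda>x. G x * poly \<phi> x - Op G x * poly \<phi> x)"
      by (simp add: D_def left_diff_distrib)
    also have "\<dots> = J (\<lambda>x. G x * poly \<phi> x) - J (\<lambda>x. Op G x * poly \<phi> x)"
      using rG rGF by (intro J_diff regular_intros)
    finally have e3: "J (\<lambda>x. (poly (pderiv v) x - h * G x) * poly \<phi> x) + (if k = 0 then y * c 0 else 0) = - (h * D)"
      using e2 by (simp add: right_diff_distrib)
    have "D = J (\<lambda>x. \<Sum>j<?n. c j * ((G x - Op G x) * poly (q j) x))"
      unfolding D_def \<phi>_def shifted_poly_def poly_sum poly_smult q_def by (simp only: sum_distrib_left mult_ac)
    also have "\<dots> = (\<Sum>j<?n. c j * J (\<lambda>x. (G x - Op G x) * poly (q j) x))"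
      using rG rGF by (intro conjunct1[OF J_sum] regular_intros) auto
    finally have "\<bar>D\<bar> \<le> (\<Sum>j<?n. \<bar>c j * J (\<lambda>x. (G x - Op G x) * poly (q j) x)\<bar>)"
      by (simp only: sum_abs)
    also have "\<dots> \<le> (\<Sum>j<?n. Cd j * M\<^sup>2 * h ^ p)"
    proof (intro sum_mono)
      fix j assume j: "j \<in> {..<?n}"
      have Gj: "sdb S ((p - j) + (kF + kO)) M h G" by (rule sdb_le_order[OF G]) simp
      have "\<bar>c j * J (\<lambda>x. (G x - Op G x) * poly (q j) x)\<bar> \<le> (M * h ^ j) * (Cd j * M * h ^ (p - j))"
        unfolding abs_mult using c j Cd[OF _ h Gj] h M0 by (intro mult_mono) auto
      also have "\<dots> = Cd j * M\<^sup>2 * h ^ (j + (p - j))" by (simp add: power_add power2_eq_square mult_ac)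
      \<comment> \<open>Truncated subtraction makes \<open>j + (p - j)\<close> larger than
        \<open>p\<close> when \<open>j > p\<close>; since \<open>h \<le> 1\<close>, only
        \<open>\<ge>\<close> matters.\<close>
      also have "\<dots> \<le> Cd j * M\<^sup>2 * h ^ p" using Cd0 h by (intro mult_left_mono power_decreasing) auto
      finally show "\<bar>c j * J (\<lambda>x. (G x - Op G x) * poly (q j) x)\<bar> \<le> Cd j * M\<^sup>2 * h ^ p" .
    qed
    also have "\<dots> = (\<Sum>j<?n. Cd j) * M\<^sup>2 * h ^ p" by (simp only: sum_distrib_right)
    finally have "h * \<bar>D\<bar> \<le> h * ((\<Sum>j<?n. Cd j) * M\<^sup>2 * h ^ p)" using h by (intro mult_left_mono)
    then show "\<bar>J (\<lambda>x. (poly (pderiv v) x - h * G x) * poly (shifted_poly ?n c) x) + (if k = 0 then y * c 0 else 0)\<bar>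
        \<le> (\<Sum>j<?n. Cd j) * M\<^sup>2 * h * h ^ p"
      unfolding e3[unfolded \<phi>_def] using h by (simp add: abs_mult mult_ac)
  qed
qed

text \<open>The maximum leaves two alternatives. Either the functional is exact to order
  \<open>p\<close>, and the integrand has scaled derivatives; or \<open>p\<close> is at most the
  order of the residual, and then integral and functional are small separately.\<close>

lemma quadrature_term:
  assumes A1: "A1 J r k" and kr: "k \<le> r"
    and p: "enat p \<le> max (r_ex1 J) (min (enat r) (r_Ii1 J Op (r - k)))"
  shows "\<exists>C\<ge>0. \<forall>M h v G y \<zeta>. 0 \<le> h \<longrightarrow> h \<le> 1 \<longrightarrow> sdb S (Suc (p + r + k + kF + kO)) M h (poly v) \<longrightarrow>
      sdb S (p + r + (k + kF + kF + kO)) M h G \<longrightarrow> sdb S (p + kF) M h \<zeta> \<longrightarrow> local_method r k h v G y \<longrightarrow>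
      \<bar>integral S (\<lambda>x. (poly (pderiv v) x - h * G x) * \<zeta> x) - J (\<lambda>x. (poly (pderiv v) x - h * G x) * \<zeta> x)\<bar>
        \<le> C * M\<^sup>2 * h * h ^ p"
proof (cases "enat p \<le> r_ex1 J")
  case True
  let ?C = "(2 + CJ) * 2 ^ p * 2 ^ (p + kF) * 2"
  show ?thesis
  proof (intro exI[of _ ?C] conjI allI impI)
    show "0 \<le> ?C" using CJ0 by simp
    fix M h v y and G \<zeta> :: "real \<Rightarrow> real"
    assume h: "0 \<le> h" "h \<le> 1" and v: "sdb S (Suc (p + r + k + kF + kO)) M h (poly v)"
      and G: "sdb S (p + r + (k + kF + kF + kO)) M h G" and \<zeta>: "sdb S (p + kF) M h \<zeta>"
    have v': "sdb S (p + kF) (M * h) h (poly (pderiv v))"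
      by (rule sdb_le_order[OF sdb_poly_pderiv[OF v]]) simp
    have G': "sdb S (p + kF) M h G" by (rule sdb_le_order[OF G]) simp
    have "sdb S (p + kF) (2 ^ (p + kF) * ((M * h + \<bar>h\<bar> * M) * M)) h (\<lambda>x. (poly (pderiv v) x - h * G x) * \<zeta> x)"
      by (rule sdb_mult[OF sdb_diff[OF v' sdb_cmult[OF G']] \<zeta>])
    from quadrature_bound[OF True h this] show
      "\<bar>integral S (\<lambda>x. (poly (pderiv v) x - h * G x) * \<zeta> x) - J (\<lambda>x. (poly (pderiv v) x - h * G x) * \<zeta> x)\<bar>
        \<le> ?C * M\<^sup>2 * h * h ^ p"
      using h by (simp add: power2_eq_square mult_ac)
  qed
next
  case False
  then have p': "p \<le> r" "enat p \<le> r_Ii1 J Op (r - k)" using p by (auto simp: le_max_iff_disj)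
  obtain C where C: "C \<ge> 0" "\<forall>M h v G y. 0 \<le> h \<longrightarrow> h \<le> 1 \<longrightarrow> sdb S (r + (kF + k + kF + kO)) M h G \<longrightarrow>
      local_method r k h v G y \<longrightarrow>
      sdb S kF (C * M * h * h ^ p) 1 (\<lambda>x. poly (pderiv v) x - h * G x)"
    using residual_bound[OF A1 kr p'] by blast
  let ?C = "(2 + CJ) * 2 ^ kF * C"
  show ?thesis
  proof (intro exI[of _ ?C] conjI allI impI)
    show "0 \<le> ?C" using CJ0 C(1) by simp
    fix M h v y and G \<zeta> :: "real \<Rightarrow> real"
    assume h: "0 \<le> h" "h \<le> 1" and v: "sdb S (Suc (p + r + k + kF + kO)) M h (poly v)"
      and G: "sdb S (p + r + (k + kF + kF + kO)) M h G" and \<zeta>: "sdb S (p + kF) M h \<zeta>"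
      and lm: "local_method r k h v G y"
    have M0: "0 \<le> M" using sdb_S_nonneg[OF G] .
    define g where "g = (\<lambda>x. (poly (pderiv v) x - h * G x) * \<zeta> x)"
    define B where "B = 2 ^ kF * (C * M * h * h ^ p * M)"
    have G': "sdb S (r + (kF + k + kF + kO)) M h G" by (rule sdb_le_order[OF G]) simp
    have "sdb S kF M 1 \<zeta>"
      using sdb_le_order[OF \<zeta>, of kF] sdb_mono[of S kF M h \<zeta> M 1] h M0 by auto
    with C(2) h G' lm have g: "sdb S kF B 1 g"
      unfolding g_def B_def by (intro sdb_mult) blast+
    have "\<bar>integral S g\<bar> \<le> 2 * B"
      using sdb_norm[OF g] sdb_continuous[OF g] by (intro abs_integral_le) auto
    moreover have "\<bar>J g\<bar> \<le> CJ * B" by (rule J_bound[OF g])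
    ultimately have "\<bar>integral S g - J g\<bar> \<le> 2 * B + CJ * B" by linarith
    also have "\<dots> = ?C * M\<^sup>2 * h * h ^ p" by (simp add: B_def power2_eq_square algebra_simps)
    finally show "\<bar>integral S (\<lambda>x. (poly (pderiv v) x - h * G x) * \<zeta> x) - J (\<lambda>x. (poly (pderiv v) x - h * G x) * \<zeta> x)\<bar>
        \<le> ?C * M\<^sup>2 * h * h ^ p" by (simp add: g_def)
  qed
qed

text \<open>One order of differentiability that dominates all those requested by the three terms of
  the local error.\<close>

definition local_regularity :: "nat \<Rightarrow> nat \<Rightarrow> nat \<Rightarrow> nat" where
  "local_regularity p r k = p + 2 * r + k + kF + kF + kO + 1"

text \<open>Three terms: replacing the integral by \<open>J\<close>, testing with the Taylor
  polynomial of \<open>\<zeta>\<close> together with the jump, and testing with the Taylor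
  remainder. The jump fits into the second term because the polynomial takes the value
  \<open>\<zeta> (- 1)\<close> at -1.\<close>

lemma local_error:
  assumes A1: "A1 J r k" and kr: "k \<le> r"
    and p1: "p \<le> 2 * r - k + 1"
    and p2: "\<And>j. j \<le> r - k \<Longrightarrow> enat p \<le> r_Ii1 J Op j + enat j"
    and p3: "enat p \<le> max (r_ex1 J) (min (enat r) (r_Ii1 J Op (r - k)))"
  shows "\<exists>C\<ge>0. \<forall>M h v G y \<zeta>. 0 \<le> h \<longrightarrow> h \<le> 1 \<longrightarrow>
      sdb S (local_regularity p r k) M h (poly v) \<longrightarrow> sdb S (local_regularity p r k) M h G \<longrightarrow>
      sdb S (local_regularity p r k) M h \<zeta> \<longrightarrow> local_method r k h v G y \<longrightarrow>
      \<bar>integral S (\<lambda>x. (poly (pderiv v) x - h * G x) * \<zeta> x) + (if k = 0 then y * \<zeta> (- 1) else 0)\<bar>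
        \<le> C * M\<^sup>2 * h * h ^ p"
proof -
  let ?n = "Suc (r - k)"
  \<comment> \<open>The order of the residual that \<open>p\<close> guarantees: \<open>p2\<close> at
    \<open>j = r - k\<close> admits \<open>p - (r - k)\<close>, and \<open>residual_bound\<close> is
    capped at \<open>r\<close>.\<close>
  define \<mu> where "\<mu> = min (p - (r - k)) r"
  have \<mu>: "\<mu> \<le> r" "enat \<mu> \<le> r_Ii1 J Op (r - k)"
  proof -
    have "enat (p - (r - k)) \<le> r_Ii1 J Op (r - k)"
      using p2[of "r - k"] by (cases "r_Ii1 J Op (r - k)") auto
    then show "enat \<mu> \<le> r_Ii1 J Op (r - k)"
      unfolding \<mu>_def by (meson enat_ord_simps(1) min.cobounded1 order_trans)
  qed (simp add: \<mu>_def)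
  \<comment> \<open>The remainder adds \<open>r - k + 1\<close> orders. Only the cap
    \<open>\<mu> = r\<close> is restrictive, and it is met by
    \<open>p \<le> 2 * r - k + 1\<close>.\<close>
  have \<mu>p: "p \<le> \<mu> + ?n" using p1 kr by (auto simp: \<mu>_def min_def)
  obtain C1 where C1: "C1 \<ge> 0" "\<And>M h v G y. 0 \<le> h \<Longrightarrow> h \<le> 1 \<Longrightarrow> sdb S (r + (kF + k + kF + kO)) M h G \<Longrightarrow>
      local_method r k h v G y \<Longrightarrow> sdb S kF (C1 * M * h * h ^ \<mu>) 1 (\<lambda>x. poly (pderiv v) x - h * G x)"
    using residual_bound[OF A1 kr \<mu>] by blast
  obtain C2 where C2: "C2 \<ge> 0" "\<And>M h v G y c. 0 \<le> h \<Longrightarrow> h \<le> 1 \<Longrightarrow> 0 \<le> M \<Longrightarrow> sdb S (p + (kF + kO)) M h G \<Longrightarrow>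
      local_method r k h v G y \<Longrightarrow> (\<forall>j < ?n. \<bar>c j\<bar> \<le> M * h ^ j) \<Longrightarrow>
      \<bar>J (\<lambda>x. (poly (pderiv v) x - h * G x) * poly (shifted_poly ?n c) x)
        + (if k = 0 then y * c 0 else 0)\<bar> \<le> C2 * M\<^sup>2 * h * h ^ p"
    using consistency_term[OF kr p2] by blast
  obtain C3 where C3: "C3 \<ge> 0" "\<And>M h v G y \<zeta>. 0 \<le> h \<Longrightarrow> h \<le> 1 \<Longrightarrow> sdb S (Suc (p + r + k + kF + kO)) M h (poly v) \<Longrightarrow>
      sdb S (p + r + (k + kF + kF + kO)) M h G \<Longrightarrow> sdb S (p + kF) M h \<zeta> \<Longrightarrow> local_method r k h v G y \<Longrightarrow>
      \<bar>integral S (\<lambda>x. (poly (pderiv v) x - h * G x) * \<zeta> x) - J (\<lambda>x. (poly (pderiv v) x - h * G x) * \<zeta> x)\<bar>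
        \<le> C3 * M\<^sup>2 * h * h ^ p"
    using quadrature_term[OF A1 kr p3] by blast
  let ?C4 = "CJ * 2 ^ kF * C1 * 2 ^ ?n"
  show ?thesis
  proof (intro exI[of _ "C2 + C3 + ?C4"] conjI allI impI)
    show "0 \<le> C2 + C3 + ?C4" using C1(1) C2(1) C3(1) CJ0 by simp
    fix M h v y and G \<zeta> :: "real \<Rightarrow> real"
    assume h: "0 \<le> h" "h \<le> 1" and v: "sdb S (local_regularity p r k) M h (poly v)"
      and G: "sdb S (local_regularity p r k) M h G" and \<zeta>: "sdb S (local_regularity p r k) M h \<zeta>"
      and lm: "local_method r k h v G y"
    have M0: "0 \<le> M" using sdb_S_nonneg[OF G] .
    define \<rho> where "\<rho> = (\<lambda>x. poly (pderiv v) x - h * G x)"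
    have G1: "sdb S (r + (kF + k + kF + kO)) M h G" "sdb S (p + (kF + kO)) M h G"
      "sdb S (p + r + (k + kF + kF + kO)) M h G"
      by (rule sdb_le_order[OF G]; simp add: local_regularity_def)+
    have v1: "sdb S (Suc (p + r + k + kF + kO)) M h (poly v)"
      by (rule sdb_le_order[OF v]) (simp add: local_regularity_def)
    have \<zeta>1: "sdb S (p + kF) M h \<zeta>" "sdb S (?n + kF) M h \<zeta>" "sdb S kF M h \<zeta>"
      by (rule sdb_le_order[OF \<zeta>]; simp add: local_regularity_def)+
    obtain c where c: "\<And>j. j < ?n \<Longrightarrow> \<bar>c j\<bar> \<le> M * h ^ j" "c 0 = \<zeta> (- 1)"
      and eta: "sdb S kF (2 ^ ?n * M * h ^ ?n) 1 (\<lambda>x. \<zeta> x - poly (shifted_poly ?n c) x)"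
      by (rule taylor_split[OF \<zeta>1(2) h]) auto
    define \<phi> where "\<phi> = shifted_poly ?n c"
    have \<rho>: "sdb S kF (C1 * M * h * h ^ \<mu>) 1 \<rho>" unfolding \<rho>_def by (rule C1(2)[OF h G1(1) lm])
    have r\<rho>: "regular kF \<rho>" using \<rho> by (auto simp: regular_def)
    have r\<zeta>: "regular kF \<zeta>" by (rule regularI[OF \<zeta>1(3) h])
    have "\<bar>J (\<lambda>x. \<rho> x * (\<zeta> x - poly \<phi> x))\<bar> \<le> CJ * (2 ^ kF * (C1 * M * h * h ^ \<mu> * (2 ^ ?n * M * h ^ ?n)))"
      unfolding \<phi>_def by (rule J_bound[OF sdb_mult[OF \<rho> eta]])
    also have "\<dots> = ?C4 * M\<^sup>2 * h * h ^ (\<mu> + ?n)"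
      by (simp only: power_add power2_eq_square mult_ac)
    also have "\<dots> \<le> ?C4 * M\<^sup>2 * h * h ^ p"
      using h CJ0 C1(1) \<mu>p by (intro mult_left_mono power_decreasing) auto
    finally have b4: "\<bar>J (\<lambda>x. \<rho> x * (\<zeta> x - poly \<phi> x))\<bar> \<le> ?C4 * M\<^sup>2 * h * h ^ p" .
    have "J (\<lambda>x. \<rho> x * (\<zeta> x - poly \<phi> x)) = J (\<lambda>x. \<rho> x * \<zeta> x - \<rho> x * poly \<phi> x)"
      by (simp add: right_diff_distrib)
    also have "\<dots> = J (\<lambda>x. \<rho> x * \<zeta> x) - J (\<lambda>x. \<rho> x * poly \<phi> x)"
      using r\<rho> r\<zeta> by (intro J_diff regular_intros)
    finally have e: "J (\<lambda>x. \<rho> x * (\<zeta> x - poly \<phi> x)) = J (\<lambda>x. \<rho> x * \<zeta> x) - J (\<lambda>x. \<rho> x * poly \<phi> x)" .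
    have b2: "\<bar>J (\<lambda>x. \<rho> x * poly \<phi> x) + (if k = 0 then y * \<zeta> (- 1) else 0)\<bar> \<le> C2 * M\<^sup>2 * h * h ^ p"
      using C2(2)[OF h M0 G1(2) lm, of c] c(1) unfolding c(2) \<rho>_def \<phi>_def by blast
    have b3: "\<bar>integral S (\<lambda>x. \<rho> x * \<zeta> x) - J (\<lambda>x. \<rho> x * \<zeta> x)\<bar> \<le> C3 * M\<^sup>2 * h * h ^ p"
      unfolding \<rho>_def by (rule C3(2)[OF h v1 G1(3) \<zeta>1(1) lm])
    have "\<bar>integral S (\<lambda>x. \<rho> x * \<zeta> x) + (if k = 0 then y * \<zeta> (- 1) else 0)\<bar>
        \<le> C2 * M\<^sup>2 * h * h ^ p + C3 * M\<^sup>2 * h * h ^ p + ?C4 * M\<^sup>2 * h * h ^ p"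
      using b2 b3 b4 e by linarith
    also have "\<dots> = (C2 + C3 + ?C4) * M\<^sup>2 * h * h ^ p" by (simp only: distrib_right)
    finally show "\<bar>integral S (\<lambda>x. (poly (pderiv v) x - h * G x) * \<zeta> x) + (if k = 0 then y * \<zeta> (- 1) else 0)\<bar>
        \<le> (C2 + C3 + ?C4) * M\<^sup>2 * h * h ^ p" unfolding \<rho>_def .
  qed
qed

end

section \<open>The adjoint problem and linearization\<close>

text \<open>Picard iteration in an exponentially weighted norm, which is contracting on the whole
  interval at once. The fixed point is the solution divided by the weight \<open>E\<close>.\<close>

lemma lipschitz_ode_backward_solution:
  fixes g :: "real \<Rightarrow> 'a \<Rightarrow> 'a::euclidean_space"
  assumes ab: "a \<le> b" and L0: "0 \<le> L"
    and lip: "\<And>t x y. t \<in> {a..b} \<Longrightarrow> norm (g t x - g t y) \<le> L * norm (x - y)"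
    and cont: "\<And>v. continuous_on {a..b} v \<Longrightarrow> continuous_on {a..b} (\<lambda>t. g t (v t))"
  shows "\<exists>z. z b = w \<and> (\<forall>t\<in>{a..b}. (z has_vector_derivative g t (z t)) (at t within {a..b}))"
proof -
  \<comment> \<open>The contraction factor is at most \<open>L / \<kappa>\<close>, hence below 1/2;
    the added 1 keeps \<open>\<kappa>\<close> positive for \<open>L = 0\<close>.\<close>
  define \<kappa> where "\<kappa> = 2 * L + 1"
  have \<kappa>0: "\<kappa> > 0" using L0 by (simp add: \<kappa>_def)
  define E where "E s = exp (\<kappa> * (b - s))" for s
  have Epos: "E s > 0" for s by (simp add: E_def)
  have Econt: "continuous_on X E" for X unfolding E_def by (intro continuous_intros)
  define G where "G v s = g s (E s *\<^sub>R apply_bcontfun v s)" for v s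
  have Gcont: "continuous_on {a..b} (G v)" for v
    unfolding G_def by (intro cont continuous_on_scaleR Econt continuous_on_apply_bcontfun)
  have Gint: "G v integrable_on {t..b}" if "t \<in> {a..b}" for v t
    using that by (intro integrable_continuous_interval continuous_on_subset[OF Gcont]) auto
  define F where "F v t = (1 / E t) *\<^sub>R (w - integral {t..b} (G v))" for v t
  have Ideriv: "((\<lambda>t. integral {t..b} (G v)) has_vector_derivative - G v t) (at t within {a..b})" if "t \<in> {a..b}" for v t
    using integral_has_vector_derivative'[OF Gcont that] .
  have Fcont: "continuous_on {a..b} (F v)" for v
  proof -
    have "continuous_on {a..b} (\<lambda>t. integral {t..b} (G v))"
      using Ideriv has_vector_derivative_continuous continuous_on_eq_continuous_within by blast
    then show ?thesis unfolding F_def using Epos by (intro continuous_intros Econt) (auto simp: less_imp_neq[OF Epos, symmetric])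
  qed
  \<comment> \<open>Clamping to \<open>{a..b}\<close> extends functions to bounded continuous ones
    on the line, so that the complete space \<open>bcontfun\<close> can be used.\<close>
  define c where "c t = max a (min b t)" for t
  have cin: "c t \<in> {a..b}" for t using ab by (auto simp: c_def)
  have cid: "c t = t" if "t \<in> {a..b}" for t using that by (auto simp: c_def)
  have bc: "(\<lambda>t. F v (c t)) \<in> bcontfun" for v
  proof -
    have "continuous_on UNIV (\<lambda>t. F v (c t))"
      by (rule continuous_on_compose2[OF Fcont, of UNIV c]) (use cin in \<open>auto simp: c_def intro!: continuous_intros\<close>)
    moreover have "bounded (F v ` {a..b})"
      by (intro compact_imp_bounded compact_continuous_image Fcont) auto
    then have "bounded (range (\<lambda>t. F v (c t)))"
      by (rule bounded_subset) (use cin in auto)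
    ultimately show ?thesis by (simp add: bcontfun_def)
  qed
  define \<Phi> where "\<Phi> v = Bcontfun (\<lambda>t. F v (c t))" for v
  have \<Phi>: "apply_bcontfun (\<Phi> v) t = F v (c t)" for v t
    unfolding \<Phi>_def using Bcontfun_inverse[OF bc] by simp
  have contr: "dist (\<Phi> v) (\<Phi> v') \<le> 1/2 * dist v v'" for v v'
  proof (rule dist_bound)
    fix t0
    define t where "t = c t0"
    have t: "t \<in> {a..b}" using cin by (simp add: t_def)
    define d where "d = dist v v'"
    have Eint: "(E has_integral ((E t - 1) / \<kappa>)) {t..b}"
    proof -
      have "(E has_integral (- E b / \<kappa> - (- E t / \<kappa>))) {t..b}"
        using t \<kappa>0 unfolding E_def
        by (intro fundamental_theorem_of_calculus)
          (auto simp flip: has_real_derivative_iff_has_vector_derivative intro!: derivative_eq_intros)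
      then show ?thesis by (simp add: E_def diff_divide_distrib)
    qed
    have "norm (integral {t..b} (\<lambda>s. G v s - G v' s)) \<le> integral {t..b} (\<lambda>s. L * d * E s)"
    proof (rule integral_norm_bound_integral)
      show "(\<lambda>s. G v s - G v' s) integrable_on {t..b}" by (intro integrable_diff Gint t)
      show "(\<lambda>s. L * d * E s) integrable_on {t..b}"
        by (intro integrable_continuous_interval continuous_intros Econt)
      fix s assume "s \<in> {t..b}"
      then have s: "s \<in> {a..b}" using t by auto
      have "norm (G v s - G v' s) \<le> L * norm (E s *\<^sub>R apply_bcontfun v s - E s *\<^sub>R apply_bcontfun v' s)"
        unfolding G_def by (rule lip[OF s])
      also have "\<dots> = L * (E s * dist (apply_bcontfun v s) (apply_bcontfun v' s))"
        using Epos[of s] by (simp add: dist_norm flip: scaleR_diff_right)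
      also have "\<dots> \<le> L * (E s * d)"
        unfolding d_def using Epos[of s] L0 by (intro mult_left_mono dist_bounded) auto
      finally show "norm (G v s - G v' s) \<le> L * d * E s" by (simp add: mult_ac)
    qed
    also have "\<dots> = L * d * ((E t - 1) / \<kappa>)"
      using Eint by (simp add: integral_unique)
    also have "\<dots> \<le> L * d * (E t / \<kappa>)"
      using \<kappa>0 L0 by (intro mult_left_mono divide_right_mono) (auto simp: d_def)
    finally have b1: "norm (integral {t..b} (\<lambda>s. G v s - G v' s)) \<le> L * d * (E t / \<kappa>)" .
    have "F v t - F v' t = - (1 / E t) *\<^sub>R integral {t..b} (\<lambda>s. G v s - G v' s)"
      unfolding F_def by (simp add: integral_diff[OF Gint[OF t] Gint[OF t]] algebra_simps)
    then have "dist (F v t) (F v' t) = (1 / E t) * norm (integral {t..b} (\<lambda>s. G v s - G v' s))"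
      using Epos[of t] by (simp add: dist_norm)
    also have "\<dots> \<le> (1 / E t) * (L * d * (E t / \<kappa>))"
      using b1 Epos[of t] by (intro mult_left_mono) auto
    also have "\<dots> = (L / \<kappa>) * d" using Epos[of t] by simp
    also have "\<dots> \<le> 1/2 * d" using L0 by (intro mult_right_mono) (auto simp: \<kappa>_def d_def field_simps)
    finally show "dist (apply_bcontfun (\<Phi> v) t0) (apply_bcontfun (\<Phi> v') t0) \<le> 1/2 * dist v v'"
      by (simp add: \<Phi> t_def d_def)
  qed
  obtain v where v: "\<Phi> v = v"
    using banach_fix_type[of "1/2" \<Phi>] contr by auto
  define z where "z t = w - integral {t..b} (G v)" for t
  have z: "z t = E t *\<^sub>R apply_bcontfun v t" if "t \<in> {a..b}" for t
    using \<Phi>[of v t] Epos[of t] unfolding v F_def z_def cid[OF that] by simp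
  show ?thesis
  proof (intro exI[of _ z] conjI ballI)
    show "z b = w" by (simp add: z_def)
    fix t assume t: "t \<in> {a..b}"
    have "(z has_vector_derivative 0 - (- G v t)) (at t within {a..b})"
      unfolding z_def by (intro has_vector_derivative_diff has_vector_derivative_const Ideriv t)
    then show "(z has_vector_derivative g t (z t)) (at t within {a..b})"
      using z[OF t] by (simp add: G_def)
  qed
qed

text \<open>Along the segment from \<open>x\<close> to \<open>x - e\<close> the scaled bounds apply
  with \<open>h = norm e\<close>, so the second derivative is at most \<open>C * h * h\<close>; two
  mean value estimates then give the quadratic remainder.\<close>

lemma smooth_linearization:
  fixes g :: "'x::euclidean_space \<Rightarrow> 'y::real_normed_vector"
  assumes g: "smooth_fun g"
  shows "\<exists>C\<ge>0. \<forall>x e. norm x \<le> M \<longrightarrow> norm e \<le> M \<longrightarrow>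
    norm (g x - g (x - e) - frechet_derivative g (at x) e) \<le> C * (norm e)\<^sup>2"
proof -
  \<comment> \<open>\<open>2 * \<bar>M\<bar>\<close> contains the segment, and
    \<open>M1 \<ge> 1\<close> gives \<open>norm e \<le> M1 * h\<close> for the velocity.\<close>
  define M1 where "M1 = 2 * \<bar>M\<bar> + 1"
  obtain C where C: "0 \<le> C" "\<And>S h \<gamma>. 0 \<le> h \<Longrightarrow> sdb S 2 M1 h \<gamma> \<Longrightarrow> sdb S 2 C h (\<lambda>t. g (\<gamma> t))"
    using sdb_smooth_compose[OF g, of 2 M1] by blast
  show ?thesis
  proof (intro exI[of _ C] conjI allI impI C(1))
    fix x e :: 'x assume x: "norm x \<le> M" and e: "norm e \<le> M"
    define h where "h = norm e"
    define \<gamma> where "\<gamma> t = x - t *\<^sub>R e" for t :: real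
    define \<psi> where "\<psi> t = g (\<gamma> t)" for t
    have \<gamma>d: "(\<gamma> has_vector_derivative - e) (at t within {0..1})" for t
      unfolding \<gamma>_def by (auto intro!: derivative_eq_intros)
    have n: "norm (\<gamma> t) \<le> M1" if "t \<in> {0..1}" for t
    proof -
      have "norm (t *\<^sub>R e) \<le> 1 * norm e" using that by (simp add: mult_left_le_one_le)
      then show ?thesis using norm_triangle_ineq4[of x "t *\<^sub>R e"] x e by (simp add: \<gamma>_def M1_def)
    qed
    have "norm (- e) \<le> M1 * h" using mult_right_mono[of 1 M1 "norm e"] by (simp add: M1_def h_def)
    then have "sdb {0..1} (Suc 0) (M1 * h) h (\<lambda>_. - e)" by (intro sdb_const) (auto simp: h_def)
    from sdb_SucI[OF n \<gamma>d this] have "sdb {0..1} 2 M1 h \<gamma>" by (simp only: numeral_2_eq_2)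
    then have \<psi>: "sdb {0..1} (Suc (Suc 0)) C h \<psi>"
      using C(2)[of h "{0..1}" \<gamma>] by (simp add: \<psi>_def[abs_def] h_def numeral_2_eq_2)
    obtain \<psi>' where \<psi>': "\<And>t. t \<in> {0..1} \<Longrightarrow> (\<psi> has_vector_derivative \<psi>' t) (at t within {0..1})"
      "sdb {0..1} (Suc 0) (C * h) h \<psi>'" by (rule sdb_SucE[OF \<psi>]) auto
    obtain \<psi>'' where \<psi>'': "\<And>t. t \<in> {0..1} \<Longrightarrow> (\<psi>' has_vector_derivative \<psi>'' t) (at t within {0..1})"
      "sdb {0..1} 0 (C * h * h) h \<psi>''" by (rule sdb_SucE[OF \<psi>'(2)]) auto
    have b0: "0 \<le> C * h * h" using C(1) by (simp add: h_def)
    have b1: "norm (\<psi>' t - \<psi>' 0) \<le> C * h * h" if t: "t \<in> {0..1}" for t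
    proof -
      have "norm (\<psi>' t - \<psi>' 0) \<le> C * h * h * \<bar>t - 0\<bar>"
        by (rule norm_diff_le_vector_derivative[OF \<psi>''(1)]) (use \<psi>''(2) t in auto)
      also have "\<dots> \<le> C * h * h * 1" using t b0 by (intro mult_left_mono) auto
      finally show ?thesis by simp
    qed
    have "norm ((\<psi> 1 - 1 *\<^sub>R \<psi>' 0) - (\<psi> 0 - 0 *\<^sub>R \<psi>' 0)) \<le> C * h * h * \<bar>1 - 0\<bar>"
    proof (rule norm_diff_le_vector_derivative[of 0 1 "\<lambda>t. \<psi> t - t *\<^sub>R \<psi>' 0" "\<lambda>t. \<psi>' t - \<psi>' 0"])
      fix t :: real assume t: "t \<in> {0..1}"
      have "((\<lambda>t. t *\<^sub>R \<psi>' 0) has_vector_derivative \<psi>' 0) (at t within {0..1})"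
        by (auto intro!: derivative_eq_intros)
      then show "((\<lambda>t. \<psi> t - t *\<^sub>R \<psi>' 0) has_vector_derivative \<psi>' t - \<psi>' 0) (at t within {0..1})"
        by (intro has_vector_derivative_diff \<psi>'(1)[OF t])
    qed (use b1 in auto)
    moreover have "\<psi>' 0 = - frechet_derivative g (at x) e"
    proof -
      have "(\<psi> has_vector_derivative (\<Sum>b\<in>Basis. (- e \<bullet> b) *\<^sub>R frechet_derivative g (at (\<gamma> 0)) b)) (at 0 within {0..1})"
        unfolding \<psi>_def by (rule smooth_compose_derivative[OF g \<gamma>d])
      then have "\<psi>' 0 = (\<Sum>b\<in>Basis. (- e \<bullet> b) *\<^sub>R frechet_derivative g (at (\<gamma> 0)) b)"
        by (rule vector_derivative_unique_within[OF at_within_Icc_neq_bot[of 0 1 0] \<psi>'(1), rotated 3]) auto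
      also have "\<dots> = - frechet_derivative g (at x) e"
        by (subst frechet_derivative_basis_expansion[OF smooth_fun_differentiable[OF g], of x e])
          (simp add: \<gamma>_def sum_negf)
      finally show ?thesis .
    qed
    ultimately have "norm (\<psi> 1 + frechet_derivative g (at x) e - \<psi> 0) \<le> C * h * h" by simp
    moreover have "\<psi> 1 + frechet_derivative g (at x) e - \<psi> 0 = - (g x - g (x - e) - frechet_derivative g (at x) e)"
      by (simp add: \<psi>_def \<gamma>_def)
    ultimately show "norm (g x - g (x - e) - frechet_derivative g (at x) e) \<le> C * (norm e)\<^sup>2"
      by (metis h_def mult.assoc norm_minus_cancel power2_eq_square)
  qed
qed

lemma sdb_inner_Basis:
  assumes "b \<in> Basis" "sdb S K M h g"
  shows "sdb S K M h (\<lambda>t. g t \<bullet> b)"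
  using sdb_linear[OF bounded_linear_inner_left[of b] _ _ assms(2), of 1] Basis_le_norm[OF assms(1)] by simp

lemma sdb_graph:
  fixes U :: "real \<Rightarrow> 'a::euclidean_space"
  assumes "sdb S K M 1 U" "\<And>t. t \<in> S \<Longrightarrow> \<bar>t\<bar> \<le> R" "1 \<le> R"
  shows "sdb S K (R + M) 1 (\<lambda>t. (t, U t))"
proof -
  have "sdb S K (1 * R) 1 (\<lambda>t. (t, 0 :: 'a))"
    by (rule sdb_linear[OF bounded_linear_Pair[OF bounded_linear_ident bounded_linear_zero] _ _ sdb_ident])
      (use assms in \<open>auto simp: norm_Pair\<close>)
  moreover have "sdb S K (1 * M) 1 (\<lambda>t. (0 :: real, U t))"
    by (rule sdb_linear[OF bounded_linear_Pair[OF bounded_linear_zero bounded_linear_ident] _ _ assms(1)])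
      (auto simp: norm_Pair)
  ultimately show ?thesis using sdb_add by fastforce
qed

text \<open>The time component is bounded on \<open>X\<close>, so one constant serves all curves
  with bound \<open>M\<close>; the right-hand sides along all discrete solutions are thus uniformly
  regular.\<close>

lemma sdb_smooth_rhs:
  fixes g :: "real \<times> 'a::euclidean_space \<Rightarrow> 'y::real_normed_vector"
  assumes "smooth_fun g" "bounded X"
  shows "\<exists>M'\<ge>0. \<forall>S U. S \<subseteq> X \<longrightarrow> sdb S K M 1 U \<longrightarrow> sdb S K M' 1 (\<lambda>t. g (t, U t))"
proof -
  obtain R where R: "\<And>t. t \<in> X \<Longrightarrow> \<bar>t\<bar> \<le> R" using assms(2) by (auto simp: bounded_iff)
  obtain M' where M': "0 \<le> M'" "\<And>S h \<gamma>. 0 \<le> h \<Longrightarrow> sdb S K (max R 1 + M) h \<gamma> \<Longrightarrow> sdb S K M' h (\<lambda>t. g (\<gamma> t))"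
    using sdb_smooth_compose[OF assms(1), of K "max R 1 + M"] by blast
  show ?thesis
  proof (intro exI[of _ M'] conjI allI impI M'(1))
    fix S and U :: "real \<Rightarrow> 'a" assume "S \<subseteq> X" "sdb S K M 1 U"
    then have "sdb S K (max R 1 + M) 1 (\<lambda>t. (t, U t))"
      using R by (intro sdb_graph) (auto simp: le_max_iff_disj)
    then show "sdb S K M' 1 (\<lambda>t. g (t, U t))" by (intro M'(2)) auto
  qed
qed

text \<open>Bootstrapping: \<open>K\<close> derivatives of \<open>u\<close> give \<open>K\<close>
  derivatives of the right-hand side, hence \<open>K + 1\<close> of \<open>u\<close>.\<close>

lemma ode_solution_regular:
  fixes u :: "real \<Rightarrow> 'a::euclidean_space"
  assumes g: "smooth_fun g" and u: "\<And>t. t \<in> {a..b} \<Longrightarrow> (u has_vector_derivative g (t, u t)) (at t within {a..b})"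
  shows "\<exists>M\<ge>0. sdb {a..b} K M 1 u"
proof (induction K)
  case 0
  have c: "continuous_on {a..b} u"
    unfolding continuous_on_eq_continuous_within using has_vector_derivative_continuous u by blast
  then have "bounded (u ` {a..b})" by (intro compact_imp_bounded compact_continuous_image) auto
  then obtain B where "\<forall>t\<in>{a..b}. norm (u t) \<le> B" by (auto simp: bounded_iff)
  then show ?case using c by (intro exI[of _ "max B 0"]) (auto simp: le_max_iff_disj)
next
  case (Suc K)
  then obtain M where M: "0 \<le> M" "sdb {a..b} K M 1 u" by blast
  obtain M' where M': "0 \<le> M'" "sdb {a..b} K M' 1 (\<lambda>t. g (t, u t))"
    using sdb_smooth_rhs[OF g, of "{a..b}" K M] M(2) by auto
  have "sdb {a..b} (Suc K) (max M M') 1 u"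
    using M M' u sdb_norm[OF M(2)]
    by (intro sdb_SucI[of _ _ _ "\<lambda>t. g (t, u t)"] sdb_mono[OF M'(2)]) (auto simp: le_max_iff_disj)
  then show ?case using M(1) by (intro exI[of _ "max M M'"]) auto
qed

text \<open>If the vectors \<open>A i t\<close> are the columns of the Jacobian of f with respect to
  u, this is minus the transposed Jacobian applied to \<open>x\<close>.\<close>

definition adjoint_rhs :: "('a \<Rightarrow> real \<Rightarrow> 'a::euclidean_space) \<Rightarrow> real \<Rightarrow> 'a \<Rightarrow> 'a" where
  "adjoint_rhs A t x = - (\<Sum>i\<in>Basis. (x \<bullet> A i t) *\<^sub>R i)"

lemma adjoint_solution:
  fixes A :: "'a \<Rightarrow> real \<Rightarrow> 'a::euclidean_space"
  assumes ab: "a \<le> b" and A: "\<And>c K. \<exists>M\<ge>0. sdb {a..b} K M 1 (A c)"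
  obtains z where "z b = w"
    "\<And>t. t \<in> {a..b} \<Longrightarrow> (z has_vector_derivative adjoint_rhs A t (z t)) (at t within {a..b})"
    "\<And>K. \<exists>M\<ge>0. sdb {a..b} K M 1 z"
proof -
  have Ac: "continuous_on {a..b} (A c)" for c using A[of 0 c] sdb_continuous by blast
  have "\<forall>c. \<exists>M\<ge>0. sdb {a..b} 0 M 1 (A c)" using A by blast
  from choice[OF this] obtain M where M: "\<And>c. 0 \<le> M c" "\<And>c. sdb {a..b} 0 (M c) 1 (A c)" by blast
  have "\<exists>z. z b = w \<and> (\<forall>t\<in>{a..b}. (z has_vector_derivative adjoint_rhs A t (z t)) (at t within {a..b}))"
  proof (rule lipschitz_ode_backward_solution[OF ab])
    show "0 \<le> (\<Sum>i\<in>(Basis::'a set). M i)" using M(1) by (intro sum_nonneg) auto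
    show "continuous_on {a..b} (\<lambda>t. adjoint_rhs A t (v t))" if "continuous_on {a..b} v" for v
      unfolding adjoint_rhs_def by (intro continuous_intros that Ac)
    fix t x y assume t: "t \<in> {a..b}"
    have "adjoint_rhs A t x - adjoint_rhs A t y = - (\<Sum>i\<in>Basis. ((x - y) \<bullet> A i t) *\<^sub>R i)"
      by (simp add: adjoint_rhs_def inner_diff_left scaleR_diff_left sum_subtractf)
    then have "norm (adjoint_rhs A t x - adjoint_rhs A t y) = norm (\<Sum>i\<in>Basis. ((x - y) \<bullet> A i t) *\<^sub>R i)" by simp
    also have "\<dots> \<le> (\<Sum>i\<in>(Basis::'a set). norm (((x - y) \<bullet> A i t) *\<^sub>R i))" by (rule norm_sum)
    also have "\<dots> \<le> (\<Sum>i\<in>(Basis::'a set). M i * norm (x - y))"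
    proof (rule sum_mono)
      fix i :: 'a assume "i \<in> Basis"
      then have "norm (((x - y) \<bullet> A i t) *\<^sub>R i) = \<bar>(x - y) \<bullet> A i t\<bar>" by simp
      also have "\<dots> \<le> norm (x - y) * norm (A i t)" by (rule Cauchy_Schwarz_ineq2)
      also have "\<dots> \<le> norm (x - y) * M i" using sdb_norm[OF M(2) t] by (intro mult_left_mono) auto
      finally show "norm (((x - y) \<bullet> A i t) *\<^sub>R i) \<le> M i * norm (x - y)" by (simp add: mult.commute)
    qed
    finally show "norm (adjoint_rhs A t x - adjoint_rhs A t y) \<le> (\<Sum>i\<in>(Basis::'a set). M i) * norm (x - y)"
      by (simp add: sum_distrib_right)
  qed
  then obtain z where z: "z b = w"
    "\<And>t. t \<in> {a..b} \<Longrightarrow> (z has_vector_derivative adjoint_rhs A t (z t)) (at t within {a..b})" by blast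
  have "\<exists>M\<ge>0. sdb {a..b} K M 1 z" for K
  proof (induction K)
    case 0
    have c: "continuous_on {a..b} z"
      unfolding continuous_on_eq_continuous_within using has_vector_derivative_continuous z(2) by blast
    then have "bounded (z ` {a..b})" by (intro compact_imp_bounded compact_continuous_image) auto
    then obtain B where "\<forall>t\<in>{a..b}. norm (z t) \<le> B" by (auto simp: bounded_iff)
    then show ?case using c by (intro exI[of _ "max B 0"]) (auto simp: le_max_iff_disj)
  next
    case (Suc K)
    then obtain Mz where Mz: "0 \<le> Mz" "sdb {a..b} K Mz 1 z" by blast
    have "\<forall>c. \<exists>M\<ge>0. sdb {a..b} K M 1 (A c)" using A by blast
    from choice[OF this] obtain M where M: "\<And>c. 0 \<le> M c" "\<And>c. sdb {a..b} K (M c) 1 (A c)" by blast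
    have "sdb {a..b} K (2 ^ K * (2 ^ K * (Mz * M i) * 1)) 1 (\<lambda>t. (z t \<bullet> A i t) *\<^sub>R i)" if "i \<in> Basis" for i
      using that
      by (intro sdb_bilinear[OF bounded_bilinear_scaleR _ sdb_bilinear[OF bounded_bilinear_inner _ Mz(2) M(2)] sdb_const])
        (auto simp: Cauchy_Schwarz_ineq2)
    then have "sdb {a..b} K (\<Sum>i\<in>(Basis::'a set). 2 ^ K * (2 ^ K * (Mz * M i) * 1)) 1 (\<lambda>t. \<Sum>i\<in>Basis. (z t \<bullet> A i t) *\<^sub>R i)"
      by (intro sdb_sum) auto
    from sdb_scaleR[OF this, of "- 1"] obtain M' where M': "sdb {a..b} K M' 1 (\<lambda>t. adjoint_rhs A t (z t))"
      by (auto simp: adjoint_rhs_def)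
    have "sdb {a..b} (Suc K) (max Mz M') 1 z"
      using Mz z(2) sdb_norm[OF Mz(2)]
      by (intro sdb_SucI[of _ _ _ "\<lambda>t. adjoint_rhs A t (z t)"] sdb_mono[OF M']) (auto simp: le_max_iff_disj)
    then show ?case using Mz(1) by (intro exI[of _ "max Mz M'"]) auto
  qed
  with z show thesis using that by blast
qed

section \<open>Transport to the mesh intervals\<close>

lemma vpoly_sdb:
  fixes U :: "real \<Rightarrow> 'a::real_normed_vector"
  assumes "vpoly_deg r U" "bounded X"
  shows "\<exists>M\<ge>0. sdb X K M 1 U"
proof -
  obtain c where c: "\<And>t. U t = (\<Sum>j\<le>r. t ^ j *\<^sub>R c j)" using assms(1) by (auto simp: vpoly_deg_def)
  have "\<forall>j. \<exists>B\<ge>0. sdb X K B 1 (\<lambda>x::real. x ^ j)" using sdb_monomial[OF assms(2)] by blast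
  from choice[OF this] obtain B where B: "\<And>j. 0 \<le> B j" "\<And>j. sdb X K (B j) 1 (\<lambda>x::real. x ^ j)" by blast
  have "sdb X K (\<Sum>j\<le>r. 2 ^ K * (B j * norm (c j))) 1 (\<lambda>t. \<Sum>j\<le>r. t ^ j *\<^sub>R c j)"
    by (intro sdb_sum sdb_bilinear[OF bounded_bilinear_scaleR _ B(2) sdb_const]) auto
  moreover have "0 \<le> (\<Sum>j\<le>r. 2 ^ K * (B j * norm (c j)))" using B(1) by (intro sum_nonneg) auto
  ultimately show ?thesis using c[abs_def] by auto
qed

lemma vpoly_has_derivative:
  fixes U :: "real \<Rightarrow> 'a::real_normed_vector"
  assumes "vpoly_deg r U"
  shows "(U has_vector_derivative vder UNIV 1 U t) (at t)" "continuous_on {a..b} (vder UNIV 1 U)"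
proof -
  have *: "continuous_on X (vder UNIV 1 U) \<and> (\<forall>t\<in>X. (U has_vector_derivative vder UNIV 1 U t) (at t))"
    if X: "open X" "bounded X" for X
  proof -
    obtain M where "sdb X (Suc 0) M 1 U" using vpoly_sdb[OF assms X(2)] by blast
    then obtain U' where U': "\<And>t. t \<in> X \<Longrightarrow> (U has_vector_derivative U' t) (at t within X)" "continuous_on X U'"
      by auto
    have d: "(U has_vector_derivative U' t) (at t)" if "t \<in> X" for t
      using U'(1)[OF that] at_within_open[OF that X(1)] by simp
    then have e: "vder UNIV 1 U t = U' t" if "t \<in> X" for t
      using vector_derivative_at that by fastforce
    then have "continuous_on X (vder UNIV 1 U)" using U'(2) by (simp cong: continuous_on_cong)
    then show ?thesis using d e by auto
  qed
  show "(U has_vector_derivative vder UNIV 1 U t) (at t)"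
    using *[of "ball t 1"] by auto
  show "continuous_on {a..b} (vder UNIV 1 U)"
    using *[of "{a - 1<..<b + 1}"] by (auto intro: continuous_on_subset)
qed

lemma vder_component_affine:
  fixes g :: "real \<Rightarrow> 'a::euclidean_space"
  assumes g: "sdb X K M 1 g" and X: "open X" "{m - h..m + h} \<subseteq> X" and h: "0 < h" and j: "j \<le> K" and s: "s \<in> {-1..1}"
  shows "vder {-1..1} j (\<lambda>s. g (m + h * s) \<bullet> b) s = h ^ j * (vder UNIV j g (m + h * s) \<bullet> b)"
proof -
  have in_I: "m + h * s \<in> {m - h..m + h}" if "s \<in> {-1..1}" for s
    using that h mult_left_mono[of "-1" s h] mult_left_mono[of s 1 h] by auto
  have gI: "sdb {m - h..m + h} K M 1 g" by (rule sdb_subset[OF g X(2)])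
  have gA: "sdb {-1..1} K M h (\<lambda>s. g (m + h * s))"
    by (rule sdb_affine[OF gI in_I]) (use h in auto)
  have "vder {-1..1} j (\<lambda>s. g (m + h * s) \<bullet> b) s = vder {-1..1} j (\<lambda>s. g (m + h * s)) s \<bullet> b"
    by (rule vder_linear[OF bounded_linear_inner_left gA _ j s]) simp
  also have "vder {-1..1} j (\<lambda>s. g (m + h * s)) s = h ^ j *\<^sub>R vder {m - h..m + h} j g (m + h * s)"
    by (rule vder_affine[OF gI _ _ in_I j s]) (use h in auto)
  also have "vder {m - h..m + h} j g (m + h * s) = vder UNIV j g (m + h * s)"
    by (rule vder_UNIV_eq[OF g X _ j in_I[OF s], symmetric]) (use h in auto)
  finally show ?thesis by simp
qed

lemma integral_affine_reference:
  fixes g :: "real \<Rightarrow> real"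
  assumes "continuous_on {m - h..m + h} g" "0 < h"
  shows "integral {m - h..m + h} g = integral {-1..1} (\<lambda>s. h * g (m + h * s))"
proof -
  define H where "H t = integral {m - h..t} g" for t
  have Hd: "(H has_vector_derivative g t) (at t within {m - h..m + h})" if "t \<in> {m - h..m + h}" for t
    unfolding H_def by (rule integral_has_vector_derivative[OF assms(1) that])
  have in_I: "m + h * s \<in> {m - h..m + h}" if "s \<in> {-1..1}" for s
    using that assms(2) mult_left_mono[of "-1" s h] mult_left_mono[of s 1 h] by auto
  have "((\<lambda>s. h * g (m + h * s)) has_integral (H (m + h * 1) - H (m + h * (- 1)))) {-1..1}"
  proof (rule fundamental_theorem_of_calculus)
    fix s :: real assume s: "s \<in> {-1..1}"
    have "((\<lambda>s. m + h * s) has_vector_derivative h) (at s within {-1..1})"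
      by (auto intro!: derivative_eq_intros simp flip: has_real_derivative_iff_has_vector_derivative)
    moreover have "(H has_vector_derivative g (m + h * s)) (at (m + h * s) within (\<lambda>s. m + h * s) ` {-1..1})"
      by (rule has_vector_derivative_within_subset[OF Hd[OF in_I[OF s]] image_subsetI[OF in_I]])
    ultimately show "((\<lambda>s. H (m + h * s)) has_vector_derivative h * g (m + h * s)) (at s within {-1..1})"
      using vector_diff_chain_within[of "\<lambda>s. m + h * s" h s "{-1..1}" H "g (m + h * s)"] by (simp add: o_def)
  qed auto
  from integral_unique[OF this] have "integral {-1..1} (\<lambda>s. h * g (m + h * s)) = H (m + h) - H (m - h)"
    by simp
  then show ?thesis by (simp add: H_def)
qed

context reference_element
begin

text \<open>The conditions of the method on the \<open>n\<close>-th mesh interval for the polynomial \<open>U\<close>, with right-hand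
  side \<open>F\<close> and jump \<open>y\<close> at the left end point.\<close>

definition interval_scheme :: "nat \<Rightarrow> nat \<Rightarrow> (nat \<Rightarrow> real) \<Rightarrow> nat \<Rightarrow> (real \<Rightarrow> 'a::euclidean_space) \<Rightarrow>
    (real \<Rightarrow> 'a) \<Rightarrow> 'a \<Rightarrow> bool" where
  "interval_scheme r k tm n U F y \<longleftrightarrow> vpoly_deg r U \<and>
     (\<forall>i < k div 2. vder UNIV (Suc i) U (tm n) = vder UNIV i F (tm n)) \<and>
     (\<forall>i < (k - 1) div 2. vder UNIV (Suc i) U (tm (n - 1)) = vder UNIV i F (tm (n - 1))) \<and>
     (\<forall>\<phi>. vpoly_deg (r - k) \<phi> \<longrightarrow>
        locF J tm n (\<lambda>t. vder UNIV 1 U t \<bullet> \<phi> t) + (if k = 0 then y \<bullet> \<phi> (tm (n - 1)) else 0)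
        = locF J tm n (\<lambda>t. locO Op tm n F t \<bullet> \<phi> t))"

text \<open>Test functions of the form \<open>q\<close> times \<open>b\<close> isolate the component
  \<open>b\<close>, since functional and operator act componentwise. Transport gives
  \<open>h ^ (i + 1)\<close> on the side of \<open>v\<close> and \<open>h ^ i\<close> on the side of
  the right-hand side, which explains the single factor \<open>h\<close> in
  \<open>local_method\<close>.\<close>

lemma scheme_local_method:
  fixes U F :: "real \<Rightarrow> 'a::euclidean_space"
  assumes sch: "interval_scheme r k tm n U F y" and lt: "tm (n - 1) < tm n" and b: "b \<in> Basis"
    and X: "open X" "bounded X" "{tm (n - 1)..tm n} \<subseteq> X" and F: "sdb X k M 1 F"
  defines "h \<equiv> (tm n - tm (n - 1)) / 2"
  obtains v where "\<And>s. poly v s = U (Tn tm n s) \<bullet> b"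
    "\<And>s. s \<in> S \<Longrightarrow> poly (pderiv v) s = h * (vder UNIV 1 U (Tn tm n s) \<bullet> b)"
    "local_method r k h v (\<lambda>s. F (Tn tm n s) \<bullet> b) (y \<bullet> b)"
proof -
  define m where "m = (tm n + tm (n - 1)) / 2"
  have h: "0 < h" using lt by (simp add: h_def)
  have mh: "m - h = tm (n - 1)" "m + h = tm n" by (auto simp: m_def h_def field_simps)
  have T: "Tn tm n = (\<lambda>s. m + h * s)" by (simp add: Tn_def m_def h_def fun_eq_iff)
  have T': "Tn_inv tm n t = (t - m) / h" for t
    using h lt by (simp add: Tn_inv_def m_def h_def field_simps)
  have locF: "locF J tm n g = h * J (g \<circ> Tn tm n)" for g
    by (simp only: locF_def h_def)
  have X': "{m - h..m + h} \<subseteq> X" using X(3) mh by simp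
  have U: "vpoly_deg r U" using sch by (simp add: interval_scheme_def)
  obtain c where c: "\<And>t. U t = (\<Sum>j\<le>r. t ^ j *\<^sub>R c j)" using U by (auto simp: vpoly_deg_def)
  define v where "v = (\<Sum>j\<le>r. smult (c j \<bullet> b) ([:m, h:] ^ j))"
  have pv: "poly v s = U (m + h * s) \<bullet> b" for s
    by (simp add: v_def c poly_sum inner_sum_left mult_ac)
  have deg: "degree v \<le> r"
  proof -
    have "degree (smult (c j \<bullet> b) ([:m, h:] ^ j)) \<le> r" if "j \<le> r" for j
      using degree_power_le[of "[:m, h:]" j] h that by (intro order_trans[OF degree_smult_le]) simp
    then show ?thesis unfolding v_def by (intro degree_sum_le) auto
  qed
  obtain MU where MU: "sdb X (Suc k) MU 1 U" using vpoly_sdb[OF U X(2)] by blast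
  have dv: "poly ((pderiv ^^ j) v) s = h ^ j * (vder UNIV j U (m + h * s) \<bullet> b)" if "j \<le> Suc k" "s \<in> S" for j s
  proof -
    have "poly ((pderiv ^^ j) v) s = vder S j (poly v) s" using that by (simp add: vder_poly)
    also have "poly v = (\<lambda>s. U (m + h * s) \<bullet> b)" using pv by auto
    finally show ?thesis using vder_component_affine[OF MU X(1) X' h that] by simp
  qed
  have dv1: "poly (pderiv v) s = h * (vder UNIV 1 U (m + h * s) \<bullet> b)" if "s \<in> S" for s
    using dv[of 1 s] that by simp
  define G where "G = (\<lambda>s. F (m + h * s) \<bullet> b)"
  have dG: "vder S j G s = h ^ j * (vder UNIV j F (m + h * s) \<bullet> b)" if "j \<le> k" "s \<in> S" for j s
    unfolding G_def by (rule vder_component_affine[OF F X(1) X' h that])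
  have "local_method r k h v G (y \<bullet> b)"
    unfolding local_method_def
  proof (intro conjI allI impI deg)
    show "poly ((pderiv ^^ Suc i) v) 1 = h * vder S i G 1" if "i < k div 2" for i
    proof -
      have "vder UNIV (Suc i) U (m + h) = vder UNIV i F (m + h)"
        using sch that mh unfolding interval_scheme_def by simp
      then show ?thesis using dv[of "Suc i" 1] dG[of i 1] that by simp
    qed
    show "poly ((pderiv ^^ Suc i) v) (- 1) = h * vder S i G (- 1)" if "i < (k - 1) div 2" for i
    proof -
      have "vder UNIV (Suc i) U (m - h) = vder UNIV i F (m - h)"
        using sch that mh unfolding interval_scheme_def by simp
      then show ?thesis using dv[of "Suc i" "- 1"] dG[of i "- 1"] that by simp
    qed
    fix q :: "real poly" assume q: "degree q \<le> r - k"
    define \<phi> where "\<phi> t = poly q ((t - m) / h) *\<^sub>R b" for t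
    have "vpoly_deg (r - k) \<phi>"
    proof -
      define q' where "q' = pcompose q [:- m / h, 1 / h:]"
      have "degree q' \<le> r - k" using q h by (simp add: q'_def degree_pcompose)
      then have q': "q' \<in> polys_below (Suc (r - k))" by (simp add: polys_below_degree)
      have "poly q ((t - m) / h) = poly q' t" for t
        by (simp add: q'_def poly_pcompose diff_divide_distrib)
      then have "\<phi> t = (\<Sum>j\<le>r - k. t ^ j *\<^sub>R (coeff q' j *\<^sub>R b))" for t
        by (simp add: \<phi>_def poly_polys_below[OF q'] scaleR_sum_left mult.commute lessThan_Suc_atMost)
      then show ?thesis unfolding vpoly_deg_def by (intro exI[of _ "\<lambda>j. coeff q' j *\<^sub>R b"] allI)
    qed
    then have "locF J tm n (\<lambda>t. vder UNIV 1 U t \<bullet> \<phi> t) + (if k = 0 then y \<bullet> \<phi> (m - h) else 0)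
        = locF J tm n (\<lambda>t. locO Op tm n F t \<bullet> \<phi> t)"
      using sch unfolding interval_scheme_def mh by blast
    moreover have "y \<bullet> \<phi> (m - h) = (y \<bullet> b) * poly q (- 1)"
      using h by (simp add: \<phi>_def)
    moreover have "locF J tm n (\<lambda>t. vder UNIV 1 U t \<bullet> \<phi> t) = J (\<lambda>x. poly (pderiv v) x * poly q x)"
    proof -
      have "J (\<lambda>x. (1 / h) * (poly (pderiv v) x * poly q x)) = J ((\<lambda>t. vder UNIV 1 U t \<bullet> \<phi> t) \<circ> Tn tm n)"
      proof (rule J_cong)
        show "regular kF (\<lambda>x. (1 / h) * (poly (pderiv v) x * poly q x))" by (intro regular_intros)
        show "(1 / h) * (poly (pderiv v) s * poly q s) = ((\<lambda>t. vder UNIV 1 U t \<bullet> \<phi> t) \<circ> Tn tm n) s" if "s \<in> S" for s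
          using h dv1[OF that] by (simp add: T \<phi>_def del: vder.simps One_nat_def)
      qed
      moreover have "J (\<lambda>x. (1 / h) * (poly (pderiv v) x * poly q x)) = (1 / h) * J (\<lambda>x. poly (pderiv v) x * poly q x)"
        by (intro J_cmult regular_intros)
      ultimately show ?thesis unfolding locF using h by simp
    qed
    moreover have "locF J tm n (\<lambda>t. locO Op tm n F t \<bullet> \<phi> t) = h * J (\<lambda>x. Op G x * poly q x)"
    proof -
      have "((\<lambda>t. locO Op tm n F t \<bullet> \<phi> t) \<circ> Tn tm n) s = Op G s * poly q s" for s
        using h b by (simp add: T T' locO_def \<phi>_def cwO_def inner_sum_left_Basis G_def o_def mult.commute)
      then show ?thesis unfolding locF by (simp add: o_def)
    qed
    ultimately show "J (\<lambda>x. poly (pderiv v) x * poly q x) + (if k = 0 then (y \<bullet> b) * poly q (- 1) else 0)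
        = h * J (\<lambda>x. Op G x * poly q x)"
      by (simp split: if_splits)
  qed
  then show thesis using that[of v] pv dv1 unfolding T G_def by blast
qed

text \<open>The local error summed over the coordinates. The constant is fixed after
  \<open>M\<close> and before mesh, interval and discrete solution. \<open>M0\<close> gives only the
  smoothness near the end points that two-sided derivatives require and does not enter the
  estimate.\<close>

lemma interval_defect:
  fixes M :: real
  assumes A1: "A1 J r k" and kr: "k \<le> r"
    and p1: "p \<le> 2 * r - k + 1"
    and p2: "\<And>j. j \<le> r - k \<Longrightarrow> enat p \<le> r_Ii1 J Op j + enat j"
    and p3: "enat p \<le> max (r_ex1 J) (min (enat r) (r_Ii1 J Op (r - k)))"
  defines "R \<equiv> local_regularity p r k"
  shows "\<exists>C\<ge>0. \<forall>tm n (U :: real \<Rightarrow> 'a::euclidean_space) F z y X M0.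
     interval_scheme r k tm n U F y \<longrightarrow> tm (n - 1) < tm n \<longrightarrow> tm n - tm (n - 1) \<le> 1 \<longrightarrow>
     sdb {tm (n - 1)..tm n} R M 1 U \<longrightarrow> sdb {tm (n - 1)..tm n} R M 1 F \<longrightarrow> sdb {tm (n - 1)..tm n} R M 1 z \<longrightarrow>
     open X \<longrightarrow> bounded X \<longrightarrow> {tm (n - 1)..tm n} \<subseteq> X \<longrightarrow> sdb X R M0 1 F \<longrightarrow>
     \<bar>integral {tm (n - 1)..tm n} (\<lambda>t. (vder UNIV 1 U t - F t) \<bullet> z t) + (if k = 0 then y \<bullet> z (tm (n - 1)) else 0)\<bar>
       \<le> C * (tm n - tm (n - 1)) * (tm n - tm (n - 1)) ^ p"
proof -
  obtain C where C: "C \<ge> 0" "\<And>M h v G y \<zeta>. 0 \<le> h \<Longrightarrow> h \<le> 1 \<Longrightarrow>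
      sdb S R M h (poly v) \<Longrightarrow> sdb S R M h G \<Longrightarrow> sdb S R M h \<zeta> \<Longrightarrow> local_method r k h v G y \<Longrightarrow>
      \<bar>integral S (\<lambda>x. (poly (pderiv v) x - h * G x) * \<zeta> x) + (if k = 0 then y * \<zeta> (- 1) else 0)\<bar>
        \<le> C * M\<^sup>2 * h * h ^ p"
    using local_error[OF A1 kr p1 p2 p3] unfolding R_def by blast
  let ?C = "real DIM('a) * (C * M\<^sup>2)"
  show ?thesis
  proof (intro exI[of _ ?C] conjI allI impI)
    show "0 \<le> ?C" using C(1) by simp
    fix tm n and U F z :: "real \<Rightarrow> 'a" and y X M0
    assume sch: "interval_scheme r k tm n U F y" and lt: "tm (n - 1) < tm n" and le1: "tm n - tm (n - 1) \<le> 1"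
      and U: "sdb {tm (n - 1)..tm n} R M 1 U" and F: "sdb {tm (n - 1)..tm n} R M 1 F" and z: "sdb {tm (n - 1)..tm n} R M 1 z"
      and X: "open X" "bounded X" "{tm (n - 1)..tm n} \<subseteq> X" and FX: "sdb X R M0 1 F"
    define m h where "m = (tm n + tm (n - 1)) / 2" and "h = (tm n - tm (n - 1)) / 2"
    have h: "0 < h" "h \<le> 1" using lt le1 by (auto simp: h_def)
    have mh: "m - h = tm (n - 1)" "m + h = tm n" by (auto simp: m_def h_def field_simps)
    have T: "Tn tm n = (\<lambda>s. m + h * s)" by (simp add: Tn_def m_def h_def fun_eq_iff)
    have in_I: "m + h * s \<in> {tm (n - 1)..tm n}" if "s \<in> S" for s
      using that h mult_left_mono[of "-1" s h] mult_left_mono[of s 1 h] unfolding mh[symmetric] by auto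
    have kR: "k \<le> R" by (simp add: R_def local_regularity_def)
    have aff: "sdb S R M h (\<lambda>s. g (m + h * s) \<bullet> b)"
      if "sdb {tm (n - 1)..tm n} R M 1 g" "b \<in> Basis" for g :: "real \<Rightarrow> 'a" and b
      by (rule sdb_inner_Basis[OF that(2) sdb_affine[OF that(1) in_I]]) (use h in auto)
    have Uv: "vpoly_deg r U" using sch by (simp add: interval_scheme_def)
    have cont: "continuous_on {tm (n - 1)..tm n} (\<lambda>t. ((vder UNIV 1 U t - F t) \<bullet> b) * (z t \<bullet> b))" for b
      by (intro continuous_intros vpoly_has_derivative(2)[OF Uv] sdb_continuous[OF F] sdb_continuous[OF z])
    have comp: "\<bar>integral {tm (n - 1)..tm n} (\<lambda>t. ((vder UNIV 1 U t - F t) \<bullet> b) * (z t \<bullet> b)) +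
        (if k = 0 then (y \<bullet> b) * (z (tm (n - 1)) \<bullet> b) else 0)\<bar> \<le> C * M\<^sup>2 * h * h ^ p" if b: "b \<in> Basis" for b
    proof -
      obtain v where v: "\<And>s. poly v s = U (m + h * s) \<bullet> b"
        "\<And>s. s \<in> S \<Longrightarrow> poly (pderiv v) s = h * (vder UNIV 1 U (m + h * s) \<bullet> b)"
        "local_method r k h v (\<lambda>s. F (m + h * s) \<bullet> b) (y \<bullet> b)"
        using scheme_local_method[OF sch lt b X sdb_le_order[OF FX kR]] unfolding T h_def by blast
      have sv: "sdb S R M h (poly v)"
        by (rule sdb_cong[OF aff[OF U b]]) (simp add: v(1))
      have "integral {tm (n - 1)..tm n} (\<lambda>t. ((vder UNIV 1 U t - F t) \<bullet> b) * (z t \<bullet> b))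
          = integral S (\<lambda>s. h * (((vder UNIV 1 U (m + h * s) - F (m + h * s)) \<bullet> b) * (z (m + h * s) \<bullet> b)))"
        unfolding mh[symmetric] by (rule integral_affine_reference[OF _ h(1)]) (use cont mh in simp)
      also have "\<dots> = integral S (\<lambda>s. (poly (pderiv v) s - h * (F (m + h * s) \<bullet> b)) * (z (m + h * s) \<bullet> b))"
        by (rule integral_cong) (simp add: v(2) inner_diff_left algebra_simps del: vder.simps One_nat_def)
      finally have e: "integral {tm (n - 1)..tm n} (\<lambda>t. ((vder UNIV 1 U t - F t) \<bullet> b) * (z t \<bullet> b))
          = integral S (\<lambda>s. (poly (pderiv v) s - h * (F (m + h * s) \<bullet> b)) * (z (m + h * s) \<bullet> b))" .
      have e': "tm (n - 1) = m + h * (- 1)" using mh by simp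
      show ?thesis
        unfolding e using C(2)[OF _ h(2) sv aff[OF F b] aff[OF z b] v(3)] h(1) unfolding e' by simp
    qed
    have "integral {tm (n - 1)..tm n} (\<lambda>t. (vder UNIV 1 U t - F t) \<bullet> z t) + (if k = 0 then y \<bullet> z (tm (n - 1)) else 0)
      = (\<Sum>b\<in>Basis. integral {tm (n - 1)..tm n} (\<lambda>t. ((vder UNIV 1 U t - F t) \<bullet> b) * (z t \<bullet> b)) +
        (if k = 0 then (y \<bullet> b) * (z (tm (n - 1)) \<bullet> b) else 0))"
    proof -
      have "integral {tm (n - 1)..tm n} (\<lambda>t. (vder UNIV 1 U t - F t) \<bullet> z t) =
          integral {tm (n - 1)..tm n} (\<lambda>t. \<Sum>b\<in>Basis. ((vder UNIV 1 U t - F t) \<bullet> b) * (z t \<bullet> b))"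
        by (rule integral_cong) (rule euclidean_inner)
      also have "\<dots> = (\<Sum>b\<in>Basis. integral {tm (n - 1)..tm n} (\<lambda>t. ((vder UNIV 1 U t - F t) \<bullet> b) * (z t \<bullet> b)))"
        by (intro integral_sum integrable_continuous_interval cont) auto
      finally show ?thesis
        by (simp add: sum.distrib euclidean_inner[of y "z (tm (n - 1))"] del: vder.simps One_nat_def)
    qed
    also have "\<bar>\<dots>\<bar> \<le> (\<Sum>b\<in>(Basis :: 'a set). C * M\<^sup>2 * h * h ^ p)"
      by (intro order_trans[OF sum_abs] sum_mono comp)
    also have "\<dots> = ?C * h * h ^ p" by simp
    also have "\<dots> \<le> ?C * (tm n - tm (n - 1)) * (tm n - tm (n - 1)) ^ p"
    proof -
      have ht: "h \<le> tm n - tm (n - 1)" using lt by (simp add: h_def)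
      show ?thesis
        using h C(1) ht by (intro mult_mono[OF mult_left_mono[OF ht] power_mono[OF ht]]) auto
    qed
    finally show "\<bar>integral {tm (n - 1)..tm n} (\<lambda>t. (vder UNIV 1 U t - F t) \<bullet> z t) + (if k = 0 then y \<bullet> z (tm (n - 1)) else 0)\<bar>
       \<le> ?C * (tm n - tm (n - 1)) * (tm n - tm (n - 1)) ^ p" .
  qed
qed

end

section \<open>Global error\<close>

text \<open>A scalar \<open>g\<close> is embedded as \<open>g x *\<^sub>R b\<close> for one basis
  vector \<open>b\<close>; on the other coordinates \<open>J\<close> and \<open>Op\<close> act on
  zero. The factors \<open>kF + 1\<close> and \<open>kF + kO + 1\<close> count the summands of
  \<open>sup_der\<close>, and absolute values make the constants nonnegative.\<close>

lemma reference_elementI: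
  assumes std: "std_assms J Op kF kO" and A2: "A2 J kF C0 TYPE('a::euclidean_space)"
    and A3: "A3 Op kF kO C1 TYPE('a)"
  shows "reference_element J Op kF kO (\<bar>C0\<bar> * real (kF + 1)) (\<bar>C1\<bar> * real (kF + kO + 1))"
proof -
  obtain b :: 'a where b: "b \<in> Basis" using nonempty_Basis by blast
  have Z: "Ck_on K {-1..1} (\<lambda>_. 0 :: real)" for K
    using sdb_Ck_on[OF sdb_const[of "0::real" 0 1]] by simp
  have J0: "J (\<lambda>_. 0) = 0"
  proof -
    have "J (\<lambda>x. 0 * 0 + 0 * 0) = 0 * J (\<lambda>_. 0) + 0 * J (\<lambda>_. 0)"
      using std Z unfolding std_assms_def by blast
    then show ?thesis by simp
  qed
  have Op0: "Op (\<lambda>_. 0) x = 0" if "x \<in> {-1..1}" for x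
  proof -
    have "Op (\<lambda>x. 0 * 0 + 0 * 0) x = 0 * Op (\<lambda>_. 0) x + 0 * Op (\<lambda>_. 0) x"
      using std Z that unfolding std_assms_def by blast
    then show ?thesis by simp
  qed
  have emb: "sdb {-1..1} K M 1 (\<lambda>x. g x *\<^sub>R b)" if "sdb {-1..1} K M 1 g" for K M and g :: "real \<Rightarrow> real"
    using sdb_linear[OF bounded_linear_scaleR_left[of b] _ _ that, of 1] b by simp
  have coord: "(\<lambda>x. g x *\<^sub>R b \<bullet> i) = (if i = b then g else (\<lambda>_. 0))" if "i \<in> Basis" for g :: "real \<Rightarrow> real" and i
    using b that by (simp add: inner_Basis)
  show ?thesis
  proof
    show "J (\<lambda>x. a * g x + c * h x) = a * J g + c * J h"
      if "Ck_on kF {-1..1} g" "Ck_on kF {-1..1} h" for g h a c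
      using std that unfolding std_assms_def by blast
    show "Op (\<lambda>x. a * g x + c * h x) x = a * Op g x + c * Op h x"
      if "Ck_on kO {-1..1} g" "Ck_on kO {-1..1} h" "x \<in> {-1..1}" for g h a c x
      using std that unfolding std_assms_def by blast
    show "\<bar>J g\<bar> \<le> \<bar>C0\<bar> * real (kF + 1) * M" if g: "sdb {-1..1} kF M 1 g" for g M
    proof -
      have M0: "0 \<le> M" using sdb_norm[OF g, of 0] by (auto intro: order_trans[OF abs_ge_zero])
      have "cwF J (\<lambda>x. g x *\<^sub>R b) = (\<Sum>i\<in>Basis. if i = b then J g *\<^sub>R b else 0)"
        unfolding cwF_def
      proof (intro sum.cong refl)
        fix i :: 'a assume i: "i \<in> Basis"
        show "J (\<lambda>x. g x *\<^sub>R b \<bullet> i) *\<^sub>R i = (if i = b then J g *\<^sub>R b else 0)"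
          unfolding coord[OF i] using J0 by simp
      qed
      also have "\<dots> = J g *\<^sub>R b" using b by (simp add: sum.delta)
      finally have "\<bar>J g\<bar> = norm (cwF J (\<lambda>x. g x *\<^sub>R b))" using b by simp
      also have "\<dots> \<le> C0 * sup_der kF (\<lambda>x. g x *\<^sub>R b)"
        using A2 sdb_Ck_on[OF emb[OF g]] unfolding A2_def by auto
      also have "\<dots> \<le> \<bar>C0\<bar> * (real (kF + 1) * M)"
      proof -
        have "0 \<le> sup_der kF (\<lambda>x. g x *\<^sub>R b)"
          unfolding sup_der_def
        proof (intro sum_nonneg)
          fix j assume "j \<in> {..kF}"
          then show "0 \<le> (SUP x\<in>{-1..1}. norm (vder {-1..1} j (\<lambda>x. g x *\<^sub>R b) x))"
            using norm_vder_le_SUP[OF sdb_Ck_on[OF emb[OF g]], of j 0] by (auto intro: order_trans[OF norm_ge_zero])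
        qed
        then show ?thesis
          using sup_der_le[OF emb[OF g] order_refl] M0 by (intro mult_mono) auto
      qed
      finally show ?thesis by (simp add: mult.assoc)
    qed
    show "sdb {-1..1} kF (\<bar>C1\<bar> * real (kF + kO + 1) * M) 1 (Op g)" if g: "sdb {-1..1} (kF + kO) M 1 g" for g M
    proof -
      have M0: "0 \<le> M" using sdb_norm[OF g, of 0] by (auto intro: order_trans[OF abs_ge_zero])
      have gK: "Ck_on (max kO kF) {-1..1} g"
        using sdb_Ck_on[OF sdb_le_order[OF g, of "max kO kF"]] by auto
      have CO: "Ck_on kF {-1..1} (Op g)" using std gK unfolding std_assms_def by blast
      define \<phi> where "\<phi> = (\<lambda>x. g x *\<^sub>R b)"
      have cw: "cwO Op \<phi> x = Op g x *\<^sub>R b" if x: "x \<in> {-1..1}" for x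
      proof -
        have "cwO Op \<phi> x = (\<Sum>i\<in>Basis. if i = b then Op g x *\<^sub>R b else 0)"
          unfolding cwO_def \<phi>_def
        proof (intro sum.cong refl)
          fix i :: 'a assume i: "i \<in> Basis"
          show "Op (\<lambda>x. g x *\<^sub>R b \<bullet> i) x *\<^sub>R i = (if i = b then Op g x *\<^sub>R b else 0)"
            unfolding coord[OF i] using Op0[OF x] by simp
        qed
        also have "\<dots> = Op g x *\<^sub>R b" using b by (simp add: sum.delta)
        finally show ?thesis .
      qed
      let ?D = "\<lambda>j t. vder {-1..1} j (Op g) t *\<^sub>R b"
      have tw: "deriv_tower {-1..1} kF ?D"
        using Ck_on_tower(1)[OF CO] bounded_linear.has_vector_derivative[OF bounded_linear_scaleR_left[of b]]
        unfolding deriv_tower_def by blast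
      have "Ck_on kF {-1..1} (?D 0)"
        using Ck_on_tower(2)[OF CO] by (intro tower_Ck_on[OF tw] at_within_Icc_neq_bot continuous_intros) auto
      then have Ccw: "Ck_on kF {-1..1} (cwO Op \<phi>)" by (rule Ck_on_cong) (simp add: cw)
      have "norm (vder {-1..1} j (Op g) t) \<le> \<bar>C1\<bar> * real (kF + kO + 1) * M" if j: "j \<le> kF" and t: "t \<in> {-1..1}" for j t
      proof -
        have ord: "max kO j \<le> kF + kO" using j by auto
        have \<phi>s: "sdb {-1..1} (max kO j) M 1 \<phi>" unfolding \<phi>_def by (rule emb[OF sdb_le_order[OF g ord]])
        have "vder {-1..1} j (cwO Op \<phi>) t = ?D j t"
          by (rule vder_Icc_tower_eq[OF tw _ j t]) (simp_all add: cw)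
        then have "norm (vder {-1..1} j (Op g) t) = norm (vder {-1..1} j (cwO Op \<phi>) t)" using b by simp
        also have "\<dots> \<le> (SUP x\<in>{-1..1}. norm (vder {-1..1} j (cwO Op \<phi>) x))"
          by (rule norm_vder_le_SUP[OF Ccw j t])
        also have "\<dots> \<le> C1 * sup_der (max kO j) \<phi>"
          using A3 j sdb_Ck_on[OF \<phi>s] unfolding A3_def by auto
        also have "\<dots> \<le> \<bar>C1\<bar> * (real (kF + kO + 1) * M)"
        proof -
          have "0 \<le> sup_der (max kO j) \<phi>"
            unfolding sup_der_def
          proof (intro sum_nonneg)
            fix i assume "i \<in> {..max kO j}"
            then show "0 \<le> (SUP x\<in>{-1..1}. norm (vder {-1..1} i \<phi> x))"
              using norm_vder_le_SUP[OF sdb_Ck_on[OF \<phi>s], of i 0] by (auto intro: order_trans[OF norm_ge_zero])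
          qed
          moreover have "sup_der (max kO j) \<phi> \<le> real (kF + kO + 1) * M"
            using ord M0 by (intro order_trans[OF sup_der_le[OF \<phi>s order_refl] mult_right_mono]) simp_all
          ultimately show ?thesis by (intro mult_mono) auto
        qed
        finally show ?thesis by (simp add: mult.assoc)
      qed
      then show ?thesis by (rule Ck_on_sdb[OF CO])
    qed
  qed auto
qed

text \<open>The entry \<open>2*r - k + 1\<close> keeps the minimum finite, so
  \<open>the_enat\<close> returns its actual value.\<close>

lemma conv_order_bounds:
  assumes "p = conv_order J Op r k"
  shows "p \<le> 2 * r - k + 1" "\<And>j. j \<le> r - k \<Longrightarrow> enat p \<le> r_Ii1 J Op j + enat j"
    "enat p \<le> max (r_ex1 J) (min (enat r) (r_Ii1 J Op (r - k)))"
proof -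
  define q where "q = min (enat (2*r - k + 1))
      (min (r_var1 J Op r k) (max (r_ex1 J) (min (enat r) (r_Ii1 J Op (r - k)))))"
  have "q \<le> enat (2*r - k + 1)" by (simp add: q_def)
  then have q: "q = enat p" unfolding assms conv_order_def q_def[symmetric] by (cases q) auto
  then show "p \<le> 2 * r - k + 1" using \<open>q \<le> enat (2*r - k + 1)\<close> by simp
  show "enat p \<le> max (r_ex1 J) (min (enat r) (r_Ii1 J Op (r - k)))"
    unfolding q[symmetric] q_def by (meson min.cobounded2 order_trans)
  fix j assume "j \<le> r - k"
  then have "r_var1 J Op r k \<le> r_Ii1 J Op j + enat j" unfolding r_var1_def by (intro Min_le) auto
  moreover have "q \<le> r_var1 J Op r k" unfolding q_def by (meson min.cobounded1 min.cobounded2 order_trans)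
  ultimately show "enat p \<le> r_Ii1 J Op j + enat j" unfolding q by (rule order_trans[rotated])
qed

text \<open>Duality: pairing the error with a solution of the adjoint linearized problem leaves only the
  quadratic linearization error and the residual of the discrete solution.\<close>

lemma error_representation:
  fixes g :: "real \<times> 'a::euclidean_space \<Rightarrow> 'a"
  assumes g: "smooth_fun g" and ac: "a < c"
    and u: "\<And>t. t \<in> {a..c} \<Longrightarrow> (u has_vector_derivative g (t, u t)) (at t within {a..c})"
    and U: "vpoly_deg r U"
    and z: "\<And>t. t \<in> {a..c} \<Longrightarrow>
      (z has_vector_derivative adjoint_rhs (\<lambda>i t. frechet_derivative g (at (t, u t)) (0, i)) t (z t)) (at t within {a..c})"
  shows "(u c - U c) \<bullet> z c - (u a - U a) \<bullet> z a =
     integral {a..c} (\<lambda>t. (g (t, u t) - g (t, U t) - frechet_derivative g (at (t, u t)) (0, u t - U t)) \<bullet> z t)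
     - integral {a..c} (\<lambda>t. (vder UNIV 1 U t - g (t, U t)) \<bullet> z t)"
    and "continuous_on {a..c} (\<lambda>t. (g (t, u t) - g (t, U t) - frechet_derivative g (at (t, u t)) (0, u t - U t)) \<bullet> z t)"
proof -
  define A where "A i t = frechet_derivative g (at (t, u t)) (0, i)" for i t
  define N where "N t = (g (t, u t) - g (t, U t) - frechet_derivative g (at (t, u t)) (0, u t - U t)) \<bullet> z t" for t
  define R where "R t = (vder UNIV 1 U t - g (t, U t)) \<bullet> z t" for t
  have lin: "frechet_derivative g (at (t, u t)) (0, e) = (\<Sum>i\<in>Basis. (e \<bullet> i) *\<^sub>R A i t)" for t e
  proof -
    have l: "linear (frechet_derivative g (at (t, u t)))"
      using smooth_fun_differentiable[OF g] linear_frechet_derivative by blast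
    have "(0 :: real, e) = (\<Sum>i\<in>Basis. (e \<bullet> i) *\<^sub>R (0, i))"
      by (simp add: prod_eq_iff fst_sum snd_sum euclidean_representation)
    then have "frechet_derivative g (at (t, u t)) (0, e) =
        frechet_derivative g (at (t, u t)) (\<Sum>i\<in>Basis. (e \<bullet> i) *\<^sub>R (0, i))" by (simp only:)
    then show ?thesis by (simp only: linear_sum[OF l] linear_scale[OF l] A_def)
  qed
  have uc: "continuous_on {a..c} u" and zc: "continuous_on {a..c} z"
    unfolding continuous_on_eq_continuous_within using has_vector_derivative_continuous u z by blast+
  have Ud: "(U has_vector_derivative vder UNIV 1 U t) (at t)" for t by (rule vpoly_has_derivative(1)[OF U])
  have Uc: "continuous_on {a..c} U"
    using Ud by (auto simp: continuous_on_eq_continuous_within intro: has_vector_derivative_continuous has_vector_derivative_at_within)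
  have sc: "continuous_on {a..c} (\<lambda>t. f (t, v t))"
    if "smooth_fun f" "continuous_on {a..c} v" for f :: "real \<times> 'a \<Rightarrow> 'a" and v
    using that by (intro continuous_on_compose2[OF smooth_fun_continuous[OF that(1)]] continuous_intros) auto
  have Ac: "continuous_on {a..c} (A i)" for i
    unfolding A_def by (rule sc[OF smooth_fun_directional[OF g] uc])
  have Nc: "continuous_on {a..c} N"
    unfolding N_def lin by (intro continuous_intros sc[OF g] uc Uc zc Ac)
  have Rc: "continuous_on {a..c} R"
    unfolding R_def by (intro continuous_intros sc[OF g] vpoly_has_derivative(2)[OF U] Uc zc)
  have "((\<lambda>t. N t - R t) has_integral ((u c - U c) \<bullet> z c - (u a - U a) \<bullet> z a)) {a..c}"
  proof (rule fundamental_theorem_of_calculus)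
    fix t assume t: "t \<in> {a..c}"
    have "((\<lambda>t. u t - U t) has_vector_derivative g (t, u t) - vder UNIV 1 U t) (at t within {a..c})"
      by (intro has_vector_derivative_diff u t has_vector_derivative_at_within[OF Ud])
    from bounded_bilinear.has_vector_derivative[OF bounded_bilinear_inner this z[OF t]]
    have "((\<lambda>t. (u t - U t) \<bullet> z t) has_vector_derivative
        (u t - U t) \<bullet> adjoint_rhs A t (z t) + (g (t, u t) - vder UNIV 1 U t) \<bullet> z t) (at t within {a..c})"
      unfolding A_def[symmetric, abs_def] .
    \<comment> \<open>Transposition: the derivative of \<open>z\<close> cancels the linear part of
      g(t,u) - g(t,U), and \<open>N t - R t\<close> remains.\<close>
    moreover have "(u t - U t) \<bullet> adjoint_rhs A t (z t) = - (frechet_derivative g (at (t, u t)) (0, u t - U t) \<bullet> z t)"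
      unfolding lin adjoint_rhs_def
      by (simp add: inner_sum_left inner_sum_right inner_commute mult.commute)
    then have "(u t - U t) \<bullet> adjoint_rhs A t (z t) + (g (t, u t) - vder UNIV 1 U t) \<bullet> z t = N t - R t"
      by (simp add: N_def R_def inner_diff_left del: vder.simps One_nat_def)
    ultimately show "((\<lambda>t. (u t - U t) \<bullet> z t) has_vector_derivative N t - R t) (at t within {a..c})"
      by (simp only:)
  qed (use ac in auto)
  moreover have "((\<lambda>t. N t - R t) has_integral (integral {a..c} N - integral {a..c} R)) {a..c}"
    by (intro has_integral_diff integrable_integral integrable_continuous_interval Nc Rc)
  ultimately show "(u c - U c) \<bullet> z c - (u a - U a) \<bullet> z a =
     integral {a..c} (\<lambda>t. (g (t, u t) - g (t, U t) - frechet_derivative g (at (t, u t)) (0, u t - U t)) \<bullet> z t)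
     - integral {a..c} (\<lambda>t. (vder UNIV 1 U t - g (t, U t)) \<bullet> z t)"
    using has_integral_unique unfolding N_def R_def by blast
  show "continuous_on {a..c} (\<lambda>t. (g (t, u t) - g (t, U t) - frechet_derivative g (at (t, u t)) (0, u t - U t)) \<bullet> z t)"
    using Nc unfolding N_def .
qed

section \<open>Mesh points and bounds on mesh intervals\<close>

lemma is_mesh_mono:
  assumes "is_mesh t0 T N tm" "i \<le> j" "j \<le> N"
  shows "tm i \<le> tm j"
  using assms(2,3)
proof (induction j rule: dec_induct)
  case (step j)
  have "tm j < tm (Suc j)" using assms(1) step by (auto simp: is_mesh_def dest!: bspec[of _ _ "Suc j"])
  then show ?case using step by auto
qed simp

lemma is_mesh_step:
  assumes "is_mesh t0 T N tm" "n \<in> {1..N}"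
  shows "tm (n - 1) < tm n" "tm n - tm (n - 1) \<le> 1" "t0 \<le> tm (n - 1)" "tm n \<le> t0 + T"
    "tm n - tm (n - 1) \<le> mesh_size N tm"
proof -
  show "tm (n - 1) < tm n" "tm n - tm (n - 1) \<le> 1" using assms by (auto simp: is_mesh_def)
  have e: "tm 0 = t0" "tm N = t0 + T" using assms(1) by (auto simp: is_mesh_def)
  show "t0 \<le> tm (n - 1)" using is_mesh_mono[OF assms(1), of 0 "n - 1"] assms(2) e by auto
  show "tm n \<le> t0 + T" using is_mesh_mono[OF assms(1), of n N] assms(2) e by auto
  show "tm n - tm (n - 1) \<le> mesh_size N tm"
    unfolding mesh_size_def using assms(2) by (intro Max_ge) auto
qed

text \<open>The bound \<open>M0\<close> near the interval depends on \<open>U\<close> and gives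
  smoothness only; the quantitative bound is the one assumed for the two-sided derivatives.\<close>

lemma vpoly_sdb_of_vder:
  fixes U :: "real \<Rightarrow> 'a::real_normed_vector"
  assumes U: "vpoly_deg r U" and "a < c"
    and b: "\<And>j t. j \<le> K \<Longrightarrow> t \<in> {a..c} \<Longrightarrow> norm (vder UNIV j U t) \<le> M"
  shows "sdb {a..c} K M 1 U"
proof -
  define X where "X = {a - 1<..<c + 1}"
  have X: "open X" "bounded X" "{a..c} \<subseteq> X" by (auto simp: X_def)
  obtain M0 where M0: "sdb X K M0 1 U" using vpoly_sdb[OF U X(2)] by blast
  show ?thesis
  proof (rule Ck_on_sdb)
    show "Ck_on K {a..c} U" by (rule sdb_Ck_on[OF sdb_subset[OF M0 X(3)] assms(2)])
    show "norm (vder {a..c} j U t) \<le> M" if "j \<le> K" "t \<in> {a..c}" for j t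
      using vder_UNIV_eq[OF M0 X(1,3) assms(2) that] b[OF that] by simp
  qed
qed

text \<open>The error is measured on half-open intervals; continuity carries the bound to the limit
  at the left end point.\<close>

lemma norm_le_interval_closure:
  fixes e :: "real \<Rightarrow> 'a::real_normed_vector"
  assumes "continuous_on {a..c} e" "a < c" "\<And>t. t \<in> {a<..c} \<Longrightarrow> norm (e t) \<le> B" "t \<in> {a..c}"
  shows "norm (e t) \<le> B"
  using continuous_on_closure_norm_le[of "{a<..c}" e B t] assms by (auto simp: closure_greaterThanAtMost)

theorem mainTheorem16:
  fixes f :: "real \<Rightarrow> 'a::euclidean_space \<Rightarrow> 'a"
    and u :: "real \<Rightarrow> 'a" and u0 :: 'a and t0 T :: real
    and J :: "(real \<Rightarrow> real) \<Rightarrow> real" and Op :: "(real \<Rightarrow> real) \<Rightarrow> (real \<Rightarrow> real)"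
    and r k kF kO :: nat and C0 C1 :: real
  assumes kr: "k \<le> r"
    and T_pos: "T > 0"
    and f_smooth: "smooth_fun (\<lambda>p::real \<times> 'a. f (fst p) (snd p))"
    and u_init: "u t0 = u0"
    and u_ode: "\<forall>t\<in>{t0..t0+T}. (u has_vector_derivative f t (u t)) (at t within {t0..t0+T})"
    and std: "std_assms J Op kF kO"
    and A1: "A1 J r k"
    and A2: "A2 J kF C0 TYPE('a)"
    and A3: "A3 Op kF kO C1 TYPE('a)"
    and bounded: "\<exists>\<tau>0>0. \<exists>B. \<exists>Bd::nat \<Rightarrow> real. \<forall>N tm Up.
        is_mesh t0 T N tm \<longrightarrow> mesh_size N tm \<le> \<tau>0 \<longrightarrow> solves_M J Op f u0 r k N tm Up \<longrightarrow>
          (\<forall>n\<in>{1..N}. \<forall>t\<in>{tm (n-1)<..tm n}. norm (u t - Up n t) \<le> B) \<and>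
          (\<forall>n\<in>{1..N}. \<forall>j. \<forall>t\<in>{tm (n-1)..tm n}. norm (vder UNIV j (Up n) t) \<le> Bd j)"
  shows "\<exists>C. \<exists>\<tau>1>0. \<forall>N tm Up.
        is_mesh t0 T N tm \<longrightarrow> mesh_size N tm \<le> \<tau>1 \<longrightarrow> solves_M J Op f u0 r k N tm Up \<longrightarrow>
          norm (u (tm N) - Up N (tm N)) \<le>
            C * ((SUP n\<in>{1..N}. SUP t\<in>{tm (n-1)<..tm n}. norm (u t - Up n t))\<^sup>2
                 + mesh_size N tm ^ conv_order J Op r k)"
proof -
  define g where "g = (\<lambda>p::real \<times> 'a. f (fst p) (snd p))"
  have g: "smooth_fun g" using f_smooth by (simp add: g_def)
  have fg: "f t x = g (t, x)" for t x by (simp add: g_def)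
  define I where "I = {t0..t0 + T}"
  have I_bdd: "bounded I" by (simp add: I_def)
  have u': "(u has_vector_derivative g (t, u t)) (at t within {t0..t0 + T})" if "t \<in> {t0..t0 + T}" for t
    using u_ode that by (simp add: fg)
  have u_reg: "\<exists>M\<ge>0. sdb I K M 1 u" for K
    unfolding I_def by (rule ode_solution_regular[OF g u'])
  interpret reference_element J Op kF kO "\<bar>C0\<bar> * real (kF + 1)" "\<bar>C1\<bar> * real (kF + kO + 1)"
    by (rule reference_elementI[OF std A2 A3])
  define p where "p = conv_order J Op r k"
  note p_bounds = conv_order_bounds[OF p_def]
  define R where "R = local_regularity p r k"
  obtain \<tau>0 B and Bd :: "nat \<Rightarrow> real" where \<tau>0: "\<tau>0 > 0"
    and bnd: "\<And>N tm Up. is_mesh t0 T N tm \<Longrightarrow> mesh_size N tm \<le> \<tau>0 \<Longrightarrow> solves_M J Op f u0 r k N tm Up \<Longrightarrow>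
          (\<forall>n\<in>{1..N}. \<forall>t\<in>{tm (n-1)<..tm n}. norm (u t - Up n t) \<le> B) \<and>
          (\<forall>n\<in>{1..N}. \<forall>j. \<forall>t\<in>{tm (n-1)..tm n}. norm (vder UNIV j (Up n) t) \<le> Bd j)"
    using bounded by blast
  define MU where "MU = (\<Sum>j\<le>R. \<bar>Bd j\<bar>)"
  have MU0: "0 \<le> MU" by (auto simp: MU_def intro: sum_nonneg)
  have MU: "Bd j \<le> MU" if "j \<le> R" for j
    using that member_le_sum[of j "{..R}" "\<lambda>j. \<bar>Bd j\<bar>"] by (fastforce simp: MU_def)
  obtain Mu where Mu: "0 \<le> Mu" "sdb I 0 Mu 1 u" using u_reg by blast
  \<comment> \<open>A radius for \<open>smooth_linearization\<close> that covers both the points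
    \<open>(t, u t)\<close> and the errors \<open>(0, u t - U t)\<close>.\<close>
  define M where "M = (\<bar>t0\<bar> + T) + Mu + MU"
  obtain CL where CL: "0 \<le> CL" "\<And>x e. norm x \<le> M \<Longrightarrow> norm e \<le> M \<Longrightarrow>
      norm (g x - g (x - e) - frechet_derivative g (at x) e) \<le> CL * (norm e)\<^sup>2"
    using smooth_linearization[OF g, of M] by blast
  obtain MF where MF: "0 \<le> MF" "\<And>S U. S \<subseteq> I \<Longrightarrow> sdb S R MU 1 U \<Longrightarrow> sdb S R MF 1 (\<lambda>t. g (t, U t))"
    using sdb_smooth_rhs[OF g I_bdd, of R MU] by blast
  define A where "A i t = frechet_derivative g (at (t, u t)) (0, i)" for i t
  have A_reg: "\<exists>M\<ge>0. sdb {t0..t0 + T} K M 1 (A i)" for i K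
  proof -
    obtain M where "sdb I K M 1 u" using u_reg by blast
    then show ?thesis
      using sdb_smooth_rhs[OF smooth_fun_directional[OF g, of "(0, i)"] I_bdd, of K M]
      unfolding A_def I_def by blast
  qed
  define err where "err N tm Up = (SUP n\<in>{1..N}. SUP t\<in>{tm (n-1)<..tm n}. norm (u t - Up n t))"
    for N and tm :: "nat \<Rightarrow> real" and Up :: "nat \<Rightarrow> real \<Rightarrow> 'a"
  \<comment> \<open>Each direction \<open>w\<close> has its own adjoint solution and constant,
    chosen before the mesh. In the end only the basis vectors are inserted, so the constants are
    summed.\<close>
  have "\<exists>C\<ge>0. \<forall>N tm Up. is_mesh t0 T N tm \<longrightarrow> mesh_size N tm \<le> \<tau>0 \<longrightarrow> solves_M J Op f u0 r k N tm Up \<longrightarrow>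
      \<bar>(u (tm N) - Up N (tm N)) \<bullet> w\<bar> \<le> C * ((err N tm Up)\<^sup>2 + mesh_size N tm ^ p)" for w :: 'a
  proof -
    obtain z where zT: "z (t0 + T) = w"
      and z': "\<And>t. t \<in> {t0..t0 + T} \<Longrightarrow> (z has_vector_derivative adjoint_rhs A t (z t)) (at t within {t0..t0 + T})"
      and z_reg: "\<And>K. \<exists>M\<ge>0. sdb {t0..t0 + T} K M 1 z"
      using adjoint_solution[of t0 "t0 + T" A w] A_reg T_pos by (metis less_add_same_cancel1 less_imp_le)
    obtain Mz where Mz: "0 \<le> Mz" "sdb I R Mz 1 z" using z_reg unfolding I_def by blast
    define MM where "MM = max MU (max MF Mz)"
    obtain CD where CD: "0 \<le> CD" "\<And>tm n (U :: real \<Rightarrow> 'a) F z y X M0.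
       interval_scheme r k tm n U F y \<Longrightarrow> tm (n - 1) < tm n \<Longrightarrow> tm n - tm (n - 1) \<le> 1 \<Longrightarrow>
       sdb {tm (n - 1)..tm n} R MM 1 U \<Longrightarrow> sdb {tm (n - 1)..tm n} R MM 1 F \<Longrightarrow> sdb {tm (n - 1)..tm n} R MM 1 z \<Longrightarrow>
       open X \<Longrightarrow> bounded X \<Longrightarrow> {tm (n - 1)..tm n} \<subseteq> X \<Longrightarrow> sdb X R M0 1 F \<Longrightarrow>
       \<bar>integral {tm (n - 1)..tm n} (\<lambda>t. (vder UNIV 1 U t - F t) \<bullet> z t) + (if k = 0 then y \<bullet> z (tm (n - 1)) else 0)\<bar>
         \<le> CD * (tm n - tm (n - 1)) * (tm n - tm (n - 1)) ^ p"
      using interval_defect[OF A1 kr p_bounds, where M = MM and 'a = 'a] unfolding R_def by blast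
    show ?thesis
    proof (intro exI[of _ "T * (CL * Mz + CD)"] conjI allI impI)
      show "0 \<le> T * (CL * Mz + CD)" using T_pos CL(1) Mz(1) CD(1) by simp
      fix N tm Up
      assume mesh: "is_mesh t0 T N tm" and size: "mesh_size N tm \<le> \<tau>0" and sol: "solves_M J Op f u0 r k N tm Up"
      define \<epsilon> where "\<epsilon> = err N tm Up"
      define \<tau> where "\<tau> = mesh_size N tm"
      \<comment> \<open>The error contribution per unit length; summed over the mesh it yields
        \<open>T * K\<close>.\<close>
      define K where "K = (CL * Mz + CD) * (\<epsilon>\<^sup>2 + \<tau> ^ p)"
      \<comment> \<open>The paired error at the left limits. It vanishes for \<open>n = 0\<close> by
        the initial value, and at \<open>n = N\<close> it is the component of the error along
        \<open>w\<close>, so it remains to bound increments.\<close>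
      define a where "a n = (u (tm n) - Uminus u0 tm Up n) \<bullet> z (tm n)" for n
      have ends: "tm 0 = t0" "tm N = t0 + T" "1 \<le> N" using mesh by (auto simp: is_mesh_def)
      have step: "\<bar>a n - a (n - 1)\<bar> \<le> (tm n - tm (n - 1)) * K" if n: "n \<in> {1..N}" for n
      proof -
        note st = is_mesh_step[OF mesh n]
        define l c where "l = tm (n - 1)" and "c = tm n"
        have lc: "l < c" "c - l \<le> 1" "t0 \<le> l" "c \<le> t0 + T" "c - l \<le> \<tau>"
          using st by (auto simp: l_def c_def \<tau>_def)
        have sub: "{l..c} \<subseteq> I" using lc by (auto simp: I_def)
        define U where "U = Up n"
        \<comment> \<open>The jump of the discrete solution, zero for \<open>k \<ge> 1\<close>. It
          converts the right limit in the representation formula into the left limit in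
          \<open>a (n - 1)\<close>.\<close>
        define y where "y = U l - Uminus u0 tm Up (n - 1)"
        have solU: "vpoly_deg r U" "k \<ge> 1 \<Longrightarrow> U l = Uminus u0 tm Up (n - 1)"
          using sol n unfolding solves_M_def U_def l_def by blast+
        have sch: "interval_scheme r k tm n U (\<lambda>t. g (t, U t)) y"
          using sol n unfolding solves_M_def interval_scheme_def U_def y_def l_def fg
          by (auto simp del: vder.simps One_nat_def)
        have Ubd: "norm (vder UNIV j U t) \<le> MU" if "j \<le> R" "t \<in> {l..c}" for j t
          using bnd[OF mesh size sol] n that MU[OF that(1)] unfolding U_def l_def c_def by (blast intro: order_trans)
        have sU: "sdb {l..c} R MU 1 U" by (rule vpoly_sdb_of_vder[OF solU(1) lc(1) Ubd])
        have sF: "sdb {l..c} R MF 1 (\<lambda>t. g (t, U t))" by (rule MF(2)[OF sub sU])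
        have sz: "sdb {l..c} R Mz 1 z" by (rule sdb_subset[OF Mz(2) sub])
        have MM: "sdb {l..c} R MM 1 U" "sdb {l..c} R MM 1 (\<lambda>t. g (t, U t))" "sdb {l..c} R MM 1 z"
          using MU0 by (intro sdb_mono[OF sU] sdb_mono[OF sF] sdb_mono[OF sz]; simp add: MM_def le_max_iff_disj)+
        define X where "X = {l - 1<..<c + 1}"
        have X: "open X" "bounded X" "{l..c} \<subseteq> X" by (auto simp: X_def)
        obtain MX where "sdb X R MX 1 U" using vpoly_sdb[OF solU(1) X(2)] by blast
        then obtain MX' where FX: "sdb X R MX' 1 (\<lambda>t. g (t, U t))"
          using sdb_smooth_rhs[OF g X(2), of R MX] by blast
        have defect: "\<bar>integral {l..c} (\<lambda>t. (vder UNIV 1 U t - g (t, U t)) \<bullet> z t) + (if k = 0 then y \<bullet> z l else 0)\<bar>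
            \<le> CD * (c - l) * (c - l) ^ p"
          using CD(2)[OF sch _ _ _ _ _ X(1,2) _ FX, of z] MM lc X(3) unfolding l_def c_def by blast
        have ud: "(u has_vector_derivative g (t, u t)) (at t within {l..c})"
          and zd: "(z has_vector_derivative adjoint_rhs A t (z t)) (at t within {l..c})" if "t \<in> {l..c}" for t
          using that sub unfolding I_def
          by (blast intro: has_vector_derivative_within_subset[OF u'] has_vector_derivative_within_subset[OF z'])+
        define Nt where "Nt t = (g (t, u t) - g (t, U t) - frechet_derivative g (at (t, u t)) (0, u t - U t)) \<bullet> z t" for t
        have rep: "(u c - U c) \<bullet> z c - (u l - U l) \<bullet> z l =
            integral {l..c} Nt - integral {l..c} (\<lambda>t. (vder UNIV 1 U t - g (t, U t)) \<bullet> z t)"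
          and Nc: "continuous_on {l..c} Nt"
          using error_representation[OF g lc(1) ud solU(1) zd[unfolded A_def[abs_def]]] unfolding Nt_def by blast+
        have e_le: "norm (u t - U t) \<le> \<epsilon>" if "t \<in> {l<..c}" for t
        proof -
          \<comment> \<open>The assumed bound \<open>B\<close> makes the suprema over the infinite
            sets of times bounded above, so that they dominate the pointwise errors.\<close>
          have eb: "norm (u s - Up m s) \<le> B" if "m \<in> {1..N}" "s \<in> {tm (m - 1)<..tm m}" for m s
            using bnd[OF mesh size sol] that by blast
          have "norm (u t - U t) \<le> (SUP t\<in>{tm (n-1)<..tm n}. norm (u t - Up n t))"
            using that eb[OF n] unfolding U_def l_def c_def by (intro cSUP_upper bdd_aboveI2)
          also have "\<dots> \<le> \<epsilon>"
            unfolding \<epsilon>_def err_def using n by (intro cSUP_upper bdd_above_finite) auto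
          finally show ?thesis .
        qed
        have ec: "continuous_on {l..c} (\<lambda>t. u t - U t)"
          by (intro continuous_intros sdb_continuous[OF sU] sdb_continuous[OF sdb_subset[OF Mu(2) sub]])
        have e_le': "norm (u t - U t) \<le> \<epsilon>" if "t \<in> {l..c}" for t
          by (rule norm_le_interval_closure[OF ec lc(1) e_le that])
        have N_le: "norm (Nt t) \<le> CL * \<epsilon>\<^sup>2 * Mz" if t: "t \<in> {l..c}" for t
        proof -
          have un: "norm (u t) \<le> Mu" using sdb_norm[OF Mu(2)] t sub by blast
          have Un: "norm (U t) \<le> MU" by (rule sdb_norm[OF sU t])
          have "\<bar>t\<bar> \<le> \<bar>t0\<bar> + T" using t lc by auto
          then have "norm (t, u t) \<le> M" using un MU0 norm_Pair_le[of t "u t"] by (simp add: M_def)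
          moreover have "norm (0 :: real, u t - U t) \<le> M"
            using norm_triangle_ineq4[of "u t" "U t"] un Un T_pos by (simp add: norm_Pair M_def)
          ultimately have "norm (g (t, u t) - g ((t, u t) - (0, u t - U t)) - frechet_derivative g (at (t, u t)) (0, u t - U t))
              \<le> CL * (norm (0 :: real, u t - U t))\<^sup>2" by (rule CL(2))
          then have "norm (g (t, u t) - g (t, U t) - frechet_derivative g (at (t, u t)) (0, u t - U t))
              \<le> CL * (norm (u t - U t))\<^sup>2" by (simp add: norm_Pair)
          also have "\<dots> \<le> CL * \<epsilon>\<^sup>2" using e_le'[OF t] CL(1) by (intro mult_left_mono power_mono) auto
          finally have "norm (g (t, u t) - g (t, U t) - frechet_derivative g (at (t, u t)) (0, u t - U t)) * norm (z t)
              \<le> CL * \<epsilon>\<^sup>2 * Mz"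
            using sdb_norm[OF sz t] CL(1) by (intro mult_mono) auto
          then show ?thesis unfolding Nt_def real_norm_def by (rule order_trans[OF Cauchy_Schwarz_ineq2])
        qed
        have Ni: "\<bar>integral {l..c} Nt\<bar> \<le> CL * \<epsilon>\<^sup>2 * Mz * (c - l)"
          using integral_bound[OF less_imp_le[OF lc(1)] Nc N_le] by simp
        have an: "a n = (u c - U c) \<bullet> z c" using n by (simp add: a_def Uminus_def U_def c_def)
        have "(u l - U l) \<bullet> z l = a (n - 1) - y \<bullet> z l"
          unfolding a_def y_def l_def by (simp add: inner_diff_left)
        moreover have "y \<bullet> z l = (if k = 0 then y \<bullet> z l else 0)"
          using solU(2) by (simp add: y_def)
        ultimately have "a n - a (n - 1) = integral {l..c} Nt -
            (integral {l..c} (\<lambda>t. (vder UNIV 1 U t - g (t, U t)) \<bullet> z t) + (if k = 0 then y \<bullet> z l else 0))"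
          using rep an by linarith
        then have "\<bar>a n - a (n - 1)\<bar> \<le> CL * \<epsilon>\<^sup>2 * Mz * (c - l) + CD * (c - l) * (c - l) ^ p"
          using Ni defect by linarith
        also have "\<dots> \<le> CL * \<epsilon>\<^sup>2 * Mz * (c - l) + CD * (c - l) * \<tau> ^ p"
          using lc CD(1) by (intro add_left_mono mult_left_mono power_mono) auto
        also have "\<dots> = (c - l) * (CL * Mz * \<epsilon>\<^sup>2 + CD * \<tau> ^ p)" by (simp add: algebra_simps)
        also have "\<dots> \<le> (c - l) * K"
        proof -
          have "0 \<le> \<tau>" using lc by linarith
          then have "0 \<le> CL * Mz * \<tau> ^ p + CD * \<epsilon>\<^sup>2" using CL(1) Mz(1) CD(1) by simp
          then show ?thesis using lc by (intro mult_left_mono) (auto simp: K_def algebra_simps)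
        qed
        finally show ?thesis by (simp add: l_def c_def)
      qed
      have "\<bar>a n\<bar> \<le> (tm n - t0) * K" if "n \<le> N" for n
        using that
      proof (induction n)
        case 0
        then show ?case using u_init ends by (simp add: a_def Uminus_def)
      next
        case (Suc n)
        have "\<bar>a (Suc n)\<bar> \<le> \<bar>a (Suc n) - a n\<bar> + \<bar>a n\<bar>" by linarith
        also have "\<dots> \<le> (tm (Suc n) - tm n) * K + (tm n - t0) * K"
          using step[of "Suc n"] Suc by auto
        finally show ?case by (simp add: algebra_simps)
      qed
      from this[of N] have "\<bar>a N\<bar> \<le> T * K" using ends by simp
      then show "\<bar>(u (tm N) - Up N (tm N)) \<bullet> w\<bar> \<le> T * (CL * Mz + CD) * ((err N tm Up)\<^sup>2 + mesh_size N tm ^ p)"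
        using ends zT by (simp add: a_def Uminus_def K_def \<epsilon>_def \<tau>_def mult.assoc)
    qed
  qed
  then obtain C where C: "\<And>w N tm Up. is_mesh t0 T N tm \<Longrightarrow> mesh_size N tm \<le> \<tau>0 \<Longrightarrow> solves_M J Op f u0 r k N tm Up \<Longrightarrow>
      \<bar>(u (tm N) - Up N (tm N)) \<bullet> w\<bar> \<le> C w * ((err N tm Up)\<^sup>2 + mesh_size N tm ^ p)"
    by metis
  show ?thesis
  proof (rule exI[of _ "\<Sum>w\<in>Basis. C w"], rule exI[of _ \<tau>0], intro conjI allI impI \<tau>0)
    fix N tm Up
    assume *: "is_mesh t0 T N tm" "mesh_size N tm \<le> \<tau>0" "solves_M J Op f u0 r k N tm Up"
    have "norm (u (tm N) - Up N (tm N)) \<le> (\<Sum>w\<in>Basis. \<bar>(u (tm N) - Up N (tm N)) \<bullet> w\<bar>)"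
      by (rule norm_le_l1)
    also have "\<dots> \<le> (\<Sum>w\<in>Basis. C w * ((err N tm Up)\<^sup>2 + mesh_size N tm ^ p))"
      by (rule sum_mono) (rule C[OF *])
    finally show "norm (u (tm N) - Up N (tm N)) \<le> (\<Sum>w\<in>Basis. C w) *
        ((SUP n\<in>{1..N}. SUP t\<in>{tm (n-1)<..tm n}. norm (u t - Up n t))\<^sup>2 + mesh_size N tm ^ conv_order J Op r k)"
      by (simp add: sum_distrib_right err_def p_def)
  qed
qed

end
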